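(* Let $X$ and $Y$ be one-sided subshifts (possibly over different finite alphabets). If $X$ and $Y$ are conjugate, then there exists a $*$-isomorphism $\rho$ from $\mathcal O_X$ onto $\mathcal O_Y$ such that $\gamma_z\circ\rho=\rho\circ\gamma_z$ for every $z\in\mathbb T$, where $\gamma$ denotes the gauge action on $\mathcal O_Y$ and on $\mathcal O_X$ respectively.
   Context: Subshifts. Let $\mathfrak a$ be a finite set (the alphabet) with the discrete topology, $\mathbb N_0=\{0,1,2,\dots\}$, and give $\mathfrak a^{\mathbb N_0}$ the product topology. The shift is $(\sigma(x))_i=x_{i+1}$. A (one-sided) subshift is a closed set $X\subseteq\mathfrak a^{\mathbb N_0}$ with $\sigma(X)\subseteq X$ (equality is not required), together with the restriction $\sigma_X$ of $\sigma$ to $X$. Two subshifts $X,Y$ are conjugate if there is a homeomorphism $\varphi:X\to Y$ with $\varphi\circ\sigma_X=\sigma_Y\circ\varphi$. Let $\mathfrak a^*$ be the set of all finite words over $\mathfrak a$, including the empty word $\epsilon$; $|\mu|$ is the length of $\mu$. For $\mu,\nu\in\mathfrak a^*$ put $C(\mu)=\{x\in X: (x_0,\dots,x_{|\mu|-1})=\mu\}$ and $C(\mu,\nu)=C(\nu)\cap\sigma^{-|\nu|}(\sigma^{|\mu|}(C(\mu)))=\{\nu x\in X:\mu x\in X\}$, where $\sigma^{-n}(Y')$ denotes the preimage of $Y'\subseteq X$ under $\sigma^n|_X$. Let $\mathfrak B(X)$ be the $C^*$-algebra of all bounded complex functions on $X$, and let $\widetilde{\mathcal D}_X$ be its $C^*$-subalgebra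 generated by $\{1_{C(\mu,\nu)}:\mu,\nu\in\mathfrak a^*\}$. Cuntz-Pimsner algebras. Let $\mathsf H$ be a right Hilbert module over a $C^*$-algebra $\mathcal A$ (inner product linear in the second variable), $\mathcal L(\mathsf H)$ the adjointable operators, $\theta_{\xi,\eta}(\zeta)=\xi\langle\eta,\zeta\rangle$, and $\mathcal K(\mathsf H)$ the closed linear span of the $\theta_{\xi,\eta}$. A $*$-homomorphism $\phi:\mathcal A\to\mathcal L(\mathsf H)$ makes $\mathsf H$ a $C^*$-correspondence over $\mathcal A$. A Toeplitz representation $(\psi,\pi)$ of $\mathsf H$ in a $C^*$-algebra $B$ is a linear map $\psi:\mathsf H\to B$ and a $*$-homomorphism $\pi:\mathcal A\to B$ with $\psi(\xi a)=\psi(\xi)\pi(a)$, $\psi(\xi)^*\psi(\eta)=\pi(\langle\xi,\eta\rangle)$, $\psi(\phi(a)\xi)=\pi(a)\psi(\xi)$; it induces a $*$-homomorphism $\pi^{(1)}:\mathcal K(\mathsf H)\to B$ with $\pi^{(1)}(\theta_{\xi,\eta})=\psi(\xi)\psi(\eta)^*$. It is Cuntz-Pimsner coinvariant if $\pi^{(1)}(\phi(a))=\pi(a)$ for all $a\in\phi^{-1}(\mathcal K(\mathsf H))$. The Cuntz-Pimsner algebra $\mathcal O_{\mathsf H}$ is the $C^*$-algebra (unique up to isomorphism) with a Cuntz-Pimsner coinvariant Toeplitz representation $(k_{\mathsf H},k_{\mathcal A})$ in it such that $\mathcal O_{\mathsf H}$ is generated by $k_{\mathsf H}(\mathsf H)\cup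 k_{\mathcal A}(\mathcal A)$ and every Cuntz-Pimsner coinvariant Toeplitz representation $(\psi,\pi)$ of $\mathsf H$ is of the form $(\rho\circ k_{\mathsf H},\rho\circ k_{\mathcal A})$ for a $*$-homomorphism $\rho$ of $\mathcal O_{\mathsf H}$. The gauge action on $\mathcal O_{\mathsf H}$ is the strongly continuous action $\gamma:\mathbb T\to\operatorname{Aut}\mathcal O_{\mathsf H}$ of the circle group determined by $\gamma_z(k_{\mathcal A}(a))=k_{\mathcal A}(a)$ and $\gamma_z(k_{\mathsf H}(\xi))=zk_{\mathsf H}(\xi)$ for $a\in\mathcal A$, $\xi\in\mathsf H$. The algebra $\mathcal O_X$. For $a\in\mathfrak a$ let $\widetilde{\mathcal D}_a$ be the (closed) ideal of $\widetilde{\mathcal D}_X$ generated by $1_{\sigma(C(a))}$. Let $\mathsf H_X=\bigoplus_{a\in\mathfrak a}\widetilde{\mathcal D}_a$, a right Hilbert $\widetilde{\mathcal D}_X$-module with $(f_a)_af=(f_af)_a$ and $\langle(f_a)_a,(g_a)_a\rangle=\sum_{a}f_a^*g_a$. For $a\in\mathfrak a$, $f\in\mathfrak B(X)$, $x\in X$ let $\widetilde\lambda_a(f)(x)=f(ax)$ if $ax\in X$ and $0$ otherwise; $\widetilde\lambda_a$ maps $\widetilde{\mathcal D}_X$ into $\widetilde{\mathcal D}_a$. Then $\mathsf H_X$ is a $C^*$-correspondence over $\widetilde{\mathcal D}_X$ via $\phi(f)((f_a)_a)=(\widetilde\lambda_a(f)f_a)_a$. Define $\mathcal O_X:=\mathcal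 O_{\mathsf H_X}$, with its gauge action. *)

theory Defs
  imports "HOL-Analysis.Analysis"
begin

section \<open>$C^*$-algebras with explicit carriers\<close>

record 'v cspace =
  carr :: "'v set"
  vadd :: "'v \<Rightarrow> 'v \<Rightarrow> 'v" (infixl "\<oplus>\<index>" 65)
  vzero :: 'v ("\<zero>\<index>")
  vscale :: "complex \<Rightarrow> 'v \<Rightarrow> 'v" (infixr "\<odot>\<index>" 75)

record 'v calgebra = "'v cspace" +
  vmult :: "'v \<Rightarrow> 'v \<Rightarrow> 'v" (infixl "\<otimes>\<index>" 70)
  vstar :: "'v \<Rightarrow> 'v"
  vnorm :: "'v \<Rightarrow> real"

definition vdiff :: "('v, 'm) cspace_scheme \<Rightarrow> 'v \<Rightarrow> 'v \<Rightarrow> 'v" where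
  "vdiff V x y = vadd V x (vscale V (-1) y)"

locale complex_space =
  fixes V :: "('v, 'm) cspace_scheme" (structure)
  assumes zero_closed: "\<zero> \<in> carr V"
    and add_closed: "\<lbrakk>x \<in> carr V; y \<in> carr V\<rbrakk> \<Longrightarrow> x \<oplus> y \<in> carr V"
    and scale_closed: "x \<in> carr V \<Longrightarrow> c \<odot> x \<in> carr V"
    and add_assoc: "\<lbrakk>x \<in> carr V; y \<in> carr V; z \<in> carr V\<rbrakk> \<Longrightarrow> (x \<oplus> y) \<oplus> z = x \<oplus> (y \<oplus> z)"
    and add_commute: "\<lbrakk>x \<in> carr V; y \<in> carr V\<rbrakk> \<Longrightarrow> x \<oplus> y = y \<oplus> x"
    and add_zero: "x \<in> carr V \<Longrightarrow> x \<oplus> \<zero> = x"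
    and add_minus: "x \<in> carr V \<Longrightarrow> x \<oplus> (-1) \<odot> x = \<zero>"
    and scale_one: "x \<in> carr V \<Longrightarrow> 1 \<odot> x = x"
    and scale_scale: "x \<in> carr V \<Longrightarrow> c \<odot> (d \<odot> x) = (c * d) \<odot> x"
    and scale_add_left: "x \<in> carr V \<Longrightarrow> (c + d) \<odot> x = c \<odot> x \<oplus> d \<odot> x"
    and scale_add_right: "\<lbrakk>x \<in> carr V; y \<in> carr V\<rbrakk> \<Longrightarrow> c \<odot> (x \<oplus> y) = c \<odot> x \<oplus> c \<odot> y"

definition norm_complete :: "('v, 'm) cspace_scheme \<Rightarrow> ('v \<Rightarrow> real) \<Rightarrow> bool" where
  "norm_complete V N \<longleftrightarrow>
    (\<forall>f::nat \<Rightarrow> 'v. (\<forall>n. f n \<in> carr V) \<and>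
        (\<forall>e>0. \<exists>k. \<forall>m\<ge>k. \<forall>n\<ge>k. N (vdiff V (f m) (f n)) < e) \<longrightarrow>
      (\<exists>x\<in>carr V. (\<lambda>n. N (vdiff V (f n) x)) \<longlonglongrightarrow> 0))"

text \<open>A unit is not required, and the zero algebra is allowed.\<close>

locale cstar_algebra = complex_space A for A :: "('v, 'm) calgebra_scheme" (structure) +
  assumes mult_closed: "\<lbrakk>x \<in> carr A; y \<in> carr A\<rbrakk> \<Longrightarrow> x \<otimes> y \<in> carr A"
    and mult_assoc: "\<lbrakk>x \<in> carr A; y \<in> carr A; z \<in> carr A\<rbrakk> \<Longrightarrow> (x \<otimes> y) \<otimes> z = x \<otimes> (y \<otimes> z)"
    and mult_add_left: "\<lbrakk>x \<in> carr A; y \<in> carr A; z \<in> carr A\<rbrakk> \<Longrightarrow> (x \<oplus> y) \<otimes> z = x \<otimes> z \<oplus> y \<otimes> z"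
    and mult_add_right: "\<lbrakk>x \<in> carr A; y \<in> carr A; z \<in> carr A\<rbrakk> \<Longrightarrow> x \<otimes> (y \<oplus> z) = x \<otimes> y \<oplus> x \<otimes> z"
    and mult_scale_left: "\<lbrakk>x \<in> carr A; y \<in> carr A\<rbrakk> \<Longrightarrow> (c \<odot> x) \<otimes> y = c \<odot> (x \<otimes> y)"
    and mult_scale_right: "\<lbrakk>x \<in> carr A; y \<in> carr A\<rbrakk> \<Longrightarrow> x \<otimes> (c \<odot> y) = c \<odot> (x \<otimes> y)"
    and star_closed: "x \<in> carr A \<Longrightarrow> vstar A x \<in> carr A"
    and star_star: "x \<in> carr A \<Longrightarrow> vstar A (vstar A x) = x"
    and star_add: "\<lbrakk>x \<in> carr A; y \<in> carr A\<rbrakk> \<Longrightarrow> vstar A (x \<oplus> y) = vstar A x \<oplus> vstar A y"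
    and star_scale: "x \<in> carr A \<Longrightarrow> vstar A (c \<odot> x) = cnj c \<odot> vstar A x"
    and star_mult: "\<lbrakk>x \<in> carr A; y \<in> carr A\<rbrakk> \<Longrightarrow> vstar A (x \<otimes> y) = vstar A y \<otimes> vstar A x"
    and norm_nonneg: "x \<in> carr A \<Longrightarrow> 0 \<le> vnorm A x"
    and norm_eq_zero: "x \<in> carr A \<Longrightarrow> vnorm A x = 0 \<Longrightarrow> x = \<zero>"
    and norm_triangle: "\<lbrakk>x \<in> carr A; y \<in> carr A\<rbrakk> \<Longrightarrow> vnorm A (x \<oplus> y) \<le> vnorm A x + vnorm A y"
    and norm_scale: "x \<in> carr A \<Longrightarrow> vnorm A (c \<odot> x) = cmod c * vnorm A x"
    and norm_mult: "\<lbrakk>x \<in> carr A; y \<in> carr A\<rbrakk> \<Longrightarrow> vnorm A (x \<otimes> y) \<le> vnorm A x * vnorm A y"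
    and norm_star: "x \<in> carr A \<Longrightarrow> vnorm A (vstar A x \<otimes> x) = (vnorm A x)\<^sup>2"
    and complete: "norm_complete A (vnorm A)"

definition positive :: "('v, 'm) calgebra_scheme \<Rightarrow> 'v \<Rightarrow> bool" where
  "positive A a \<longleftrightarrow> (\<exists>b\<in>carr A. a = vmult A (vstar A b) b)"

definition linear_map ::
    "('v, 'm) cspace_scheme \<Rightarrow> ('w, 'n) cspace_scheme \<Rightarrow> ('v \<Rightarrow> 'w) \<Rightarrow> bool" where
  "linear_map V W f \<longleftrightarrow>
    (\<forall>x\<in>carr V. f x \<in> carr W) \<and>
    (\<forall>x\<in>carr V. \<forall>y\<in>carr V. f (vadd V x y) = vadd W (f x) (f y)) \<and>
    (\<forall>c. \<forall>x\<in>carr V. f (vscale V c x) = vscale W c (f x))"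

definition star_hom ::
    "('v, 'm) calgebra_scheme \<Rightarrow> ('w, 'n) calgebra_scheme \<Rightarrow> ('v \<Rightarrow> 'w) \<Rightarrow> bool" where
  "star_hom A B f \<longleftrightarrow>
    linear_map A B f \<and>
    (\<forall>x\<in>carr A. \<forall>y\<in>carr A. f (vmult A x y) = vmult B (f x) (f y)) \<and>
    (\<forall>x\<in>carr A. f (vstar A x) = vstar B (f x))"

definition star_iso ::
    "('v, 'm) calgebra_scheme \<Rightarrow> ('w, 'n) calgebra_scheme \<Rightarrow> ('v \<Rightarrow> 'w) \<Rightarrow> bool" where
  "star_iso A B f \<longleftrightarrow> star_hom A B f \<and> bij_betw f (carr A) (carr B)"

definition closed_subspace :: "('v, 'm) calgebra_scheme \<Rightarrow> 'v set \<Rightarrow> bool" where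
  "closed_subspace A S \<longleftrightarrow>
    S \<subseteq> carr A \<and> vzero A \<in> S \<and>
    (\<forall>x\<in>S. \<forall>y\<in>S. vadd A x y \<in> S) \<and>
    (\<forall>c. \<forall>x\<in>S. vscale A c x \<in> S) \<and>
    (\<forall>f x. (\<forall>n::nat. f n \<in> S) \<and> x \<in> carr A \<and> (\<lambda>n. vnorm A (vdiff A (f n) x)) \<longlonglongrightarrow> 0 \<longrightarrow> x \<in> S)"

definition cstar_subalgebra :: "('v, 'm) calgebra_scheme \<Rightarrow> 'v set \<Rightarrow> bool" where
  "cstar_subalgebra A S \<longleftrightarrow>
    closed_subspace A S \<and> (\<forall>x\<in>S. \<forall>y\<in>S. vmult A x y \<in> S) \<and> (\<forall>x\<in>S. vstar A x \<in> S)"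

definition closed_ideal :: "('v, 'm) calgebra_scheme \<Rightarrow> 'v set \<Rightarrow> bool" where
  "closed_ideal A I \<longleftrightarrow>
    closed_subspace A I \<and> (\<forall>x\<in>carr A. \<forall>y\<in>I. vmult A x y \<in> I \<and> vmult A y x \<in> I)"

definition closed_span :: "('v, 'm) calgebra_scheme \<Rightarrow> 'v set \<Rightarrow> 'v set" where
  "closed_span A G = \<Inter>{S. closed_subspace A S \<and> G \<subseteq> S}"

definition cstar_generated :: "('v, 'm) calgebra_scheme \<Rightarrow> 'v set \<Rightarrow> 'v set" where
  "cstar_generated A G = \<Inter>{S. cstar_subalgebra A S \<and> G \<subseteq> S}"

definition ideal_generated :: "('v, 'm) calgebra_scheme \<Rightarrow> 'v set \<Rightarrow> 'v set" where
  "ideal_generated A G = \<Inter>{I. closed_ideal A I \<and> G \<subseteq> I}"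


section \<open>Hilbert modules and $C^*$-correspondences\<close>

record ('v, 'h) hmodule = "'h cspace" +
  ract :: "'h \<Rightarrow> 'v \<Rightarrow> 'h"
  hinner :: "'h \<Rightarrow> 'h \<Rightarrow> 'v"

record ('v, 'h) correspondence = "('v, 'h) hmodule" +
  lact :: "'v \<Rightarrow> 'h \<Rightarrow> 'h"

definition hnorm :: "('v, 'm) calgebra_scheme \<Rightarrow> ('v, 'h, 'n) hmodule_scheme \<Rightarrow> 'h \<Rightarrow> real" where
  "hnorm A H \<xi> = sqrt (vnorm A (hinner H \<xi> \<xi>))"

locale hilbert_module = cstar_algebra A + H: complex_space H
  for A :: "('v, 'm) calgebra_scheme" and H :: "('v, 'h, 'n) hmodule_scheme" +
  assumes ract_closed: "\<lbrakk>\<xi> \<in> carr H; a \<in> carr A\<rbrakk> \<Longrightarrow> ract H \<xi> a \<in> carr H"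
    and ract_add_left: "\<lbrakk>\<xi> \<in> carr H; \<eta> \<in> carr H; a \<in> carr A\<rbrakk> \<Longrightarrow>
          ract H (\<xi> \<oplus>\<^bsub>H\<^esub> \<eta>) a = ract H \<xi> a \<oplus>\<^bsub>H\<^esub> ract H \<eta> a"
    and ract_add_right: "\<lbrakk>\<xi> \<in> carr H; a \<in> carr A; b \<in> carr A\<rbrakk> \<Longrightarrow>
          ract H \<xi> (a \<oplus>\<^bsub>A\<^esub> b) = ract H \<xi> a \<oplus>\<^bsub>H\<^esub> ract H \<xi> b"
    and ract_mult: "\<lbrakk>\<xi> \<in> carr H; a \<in> carr A; b \<in> carr A\<rbrakk> \<Longrightarrow>
          ract H \<xi> (a \<otimes>\<^bsub>A\<^esub> b) = ract H (ract H \<xi> a) b"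
    and ract_scale_left: "\<lbrakk>\<xi> \<in> carr H; a \<in> carr A\<rbrakk> \<Longrightarrow>
          ract H (c \<odot>\<^bsub>H\<^esub> \<xi>) a = c \<odot>\<^bsub>H\<^esub> ract H \<xi> a"
    and ract_scale_right: "\<lbrakk>\<xi> \<in> carr H; a \<in> carr A\<rbrakk> \<Longrightarrow>
          ract H \<xi> (c \<odot>\<^bsub>A\<^esub> a) = c \<odot>\<^bsub>H\<^esub> ract H \<xi> a"
    and inner_closed: "\<lbrakk>\<xi> \<in> carr H; \<eta> \<in> carr H\<rbrakk> \<Longrightarrow> hinner H \<xi> \<eta> \<in> carr A"
    and inner_add: "\<lbrakk>\<xi> \<in> carr H; \<eta> \<in> carr H; \<zeta> \<in> carr H\<rbrakk> \<Longrightarrow>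
          hinner H \<xi> (\<eta> \<oplus>\<^bsub>H\<^esub> \<zeta>) = hinner H \<xi> \<eta> \<oplus>\<^bsub>A\<^esub> hinner H \<xi> \<zeta>"
    and inner_scale: "\<lbrakk>\<xi> \<in> carr H; \<eta> \<in> carr H\<rbrakk> \<Longrightarrow>
          hinner H \<xi> (c \<odot>\<^bsub>H\<^esub> \<eta>) = c \<odot>\<^bsub>A\<^esub> hinner H \<xi> \<eta>"
    and inner_ract: "\<lbrakk>\<xi> \<in> carr H; \<eta> \<in> carr H; a \<in> carr A\<rbrakk> \<Longrightarrow>
          hinner H \<xi> (ract H \<eta> a) = hinner H \<xi> \<eta> \<otimes>\<^bsub>A\<^esub> a"
    and inner_star: "\<lbrakk>\<xi> \<in> carr H; \<eta> \<in> carr H\<rbrakk> \<Longrightarrow> vstar A (hinner H \<xi> \<eta>) = hinner H \<eta> \<xi>"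
    and inner_positive: "\<xi> \<in> carr H \<Longrightarrow> positive A (hinner H \<xi> \<xi>)"
    and inner_eq_zero: "\<xi> \<in> carr H \<Longrightarrow> hinner H \<xi> \<xi> = \<zero>\<^bsub>A\<^esub> \<Longrightarrow> \<xi> = \<zero>\<^bsub>H\<^esub>"
    and hcomplete: "norm_complete H (hnorm A H)"

text \<open>Operators on a module are functions that are \<^const>\<open>undefined\<close> off its carrier, so that
  equality of operators is equality on the carrier and adjoints are unique.\<close>

definition is_adjoint :: "('v, 'h, 'n) hmodule_scheme \<Rightarrow> ('h \<Rightarrow> 'h) \<Rightarrow> ('h \<Rightarrow> 'h) \<Rightarrow> bool" where
  "is_adjoint H T S \<longleftrightarrow>
    T \<in> carr H \<rightarrow>\<^sub>E carr H \<and> S \<in> carr H \<rightarrow>\<^sub>E carr H \<and>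
    (\<forall>\<xi>\<in>carr H. \<forall>\<eta>\<in>carr H. hinner H (T \<xi>) \<eta> = hinner H \<xi> (S \<eta>))"

definition adjointable_operators ::
    "('v, 'm) calgebra_scheme \<Rightarrow> ('v, 'h, 'n) hmodule_scheme \<Rightarrow> ('h \<Rightarrow> 'h) calgebra" where
  "adjointable_operators A H =
    \<lparr>carr = {T. \<exists>S. is_adjoint H T S},
     vadd = (\<lambda>T S. \<lambda>\<xi>\<in>carr H. vadd H (T \<xi>) (S \<xi>)),
     vzero = (\<lambda>\<xi>\<in>carr H. vzero H),
     vscale = (\<lambda>c T. \<lambda>\<xi>\<in>carr H. vscale H c (T \<xi>)),
     vmult = (\<lambda>T S. \<lambda>\<xi>\<in>carr H. T (S \<xi>)),
     vstar = (\<lambda>T. THE S. is_adjoint H T S),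
     vnorm = (\<lambda>T. SUP \<xi>\<in>{\<xi> \<in> carr H. hnorm A H \<xi> \<le> 1}. hnorm A H (T \<xi>))\<rparr>"

definition rank_one :: "('v, 'h, 'n) hmodule_scheme \<Rightarrow> 'h \<Rightarrow> 'h \<Rightarrow> 'h \<Rightarrow> 'h" where
  "rank_one H \<xi> \<eta> = (\<lambda>\<zeta>\<in>carr H. ract H \<xi> (hinner H \<eta> \<zeta>))"

definition compact_operators ::
    "('v, 'm) calgebra_scheme \<Rightarrow> ('v, 'h, 'n) hmodule_scheme \<Rightarrow> ('h \<Rightarrow> 'h) calgebra" where
  "compact_operators A H =
    (adjointable_operators A H)
      \<lparr>carr := closed_span (adjointable_operators A H)
                {rank_one H \<xi> \<eta> | \<xi> \<eta>. \<xi> \<in> carr H \<and> \<eta> \<in> carr H}\<rparr>"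

definition left_action :: "('v, 'h, 'n) correspondence_scheme \<Rightarrow> 'v \<Rightarrow> 'h \<Rightarrow> 'h" where
  "left_action H a = (\<lambda>\<xi>\<in>carr H. lact H a \<xi>)"

locale cstar_correspondence = hilbert_module A H
  for A :: "('v, 'm) calgebra_scheme" and H :: "('v, 'h, 'n) correspondence_scheme" +
  assumes left_action_hom: "star_hom A (adjointable_operators A H) (left_action H)"


section \<open>Cuntz-Pimsner algebras\<close>

definition toeplitz_representation ::
    "('v, 'm) calgebra_scheme \<Rightarrow> ('v, 'h, 'n) correspondence_scheme \<Rightarrow> ('w, 'k) calgebra_scheme \<Rightarrow>
     ('h \<Rightarrow> 'w) \<Rightarrow> ('v \<Rightarrow> 'w) \<Rightarrow> bool" where
  "toeplitz_representation A H B \<psi> \<pi> \<longleftrightarrow>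
    linear_map H B \<psi> \<and> star_hom A B \<pi> \<and>
    (\<forall>\<xi>\<in>carr H. \<forall>a\<in>carr A. \<psi> (ract H \<xi> a) = vmult B (\<psi> \<xi>) (\<pi> a)) \<and>
    (\<forall>\<xi>\<in>carr H. \<forall>\<eta>\<in>carr H. vmult B (vstar B (\<psi> \<xi>)) (\<psi> \<eta>) = \<pi> (hinner H \<xi> \<eta>)) \<and>
    (\<forall>a\<in>carr A. \<forall>\<xi>\<in>carr H. \<psi> (lact H a \<xi>) = vmult B (\<pi> a) (\<psi> \<xi>))"

text \<open>The induced $*$-homomorphism \<open>P\<close> on the compact operators always exists, and it is unique
  since $*$-homomorphisms are contractive and the rank-one operators have dense span.\<close>

definition induced_hom ::
    "('v, 'm) calgebra_scheme \<Rightarrow> ('v, 'h, 'n) correspondence_scheme \<Rightarrow> ('w, 'k) calgebra_scheme \<Rightarrow>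
     ('h \<Rightarrow> 'w) \<Rightarrow> (('h \<Rightarrow> 'h) \<Rightarrow> 'w) \<Rightarrow> bool" where
  "induced_hom A H B \<psi> P \<longleftrightarrow>
    star_hom (compact_operators A H) B P \<and>
    (\<forall>\<xi>\<in>carr H. \<forall>\<eta>\<in>carr H. P (rank_one H \<xi> \<eta>) = vmult B (\<psi> \<xi>) (vstar B (\<psi> \<eta>)))"

definition coinvariant ::
    "('v, 'm) calgebra_scheme \<Rightarrow> ('v, 'h, 'n) correspondence_scheme \<Rightarrow> ('w, 'k) calgebra_scheme \<Rightarrow>
     ('h \<Rightarrow> 'w) \<Rightarrow> ('v \<Rightarrow> 'w) \<Rightarrow> bool" where
  "coinvariant A H B \<psi> \<pi> \<longleftrightarrow>
    (\<exists>P. induced_hom A H B \<psi> P \<and>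
      (\<forall>a\<in>carr A. left_action H a \<in> carr (compact_operators A H) \<longrightarrow>
        P (left_action H a) = \<pi> a))"

text \<open>The universal property ranges over the $C^*$-algebras whose elements are taken from the same
  (arbitrary) type \<open>'w\<close> as those of \<open>O\<^sub>H\<close>.  If \<open>A\<close> and \<open>H\<close> are separable, which is the case for
  the correspondence of a subshift, then so is the algebra generated by any representation; hence
  as soon as \<open>'w\<close> has the cardinality of the continuum this is the universal property with
  respect to all $C^*$-algebras.\<close>

locale cuntz_pimsner_algebra = cstar_correspondence A H + O: cstar_algebra O\<^sub>H
  for A :: "('v, 'm) calgebra_scheme" and H :: "('v, 'h, 'n) correspondence_scheme"
    and O\<^sub>H :: "'w calgebra" and k\<^sub>H :: "'h \<Rightarrow> 'w" and k\<^sub>A :: "'v \<Rightarrow> 'w" +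
  assumes universal_toeplitz: "toeplitz_representation A H O\<^sub>H k\<^sub>H k\<^sub>A"
    and universal_coinvariant: "coinvariant A H O\<^sub>H k\<^sub>H k\<^sub>A"
    and generated: "cstar_generated O\<^sub>H (k\<^sub>H ` carr H \<union> k\<^sub>A ` carr A) = carr O\<^sub>H"
    and universal:
      "\<And>(B :: 'w calgebra) \<psi> \<pi>.
        \<lbrakk>cstar_algebra B; toeplitz_representation A H B \<psi> \<pi>; coinvariant A H B \<psi> \<pi>\<rbrakk> \<Longrightarrow>
        \<exists>\<rho>. star_hom O\<^sub>H B \<rho> \<and> (\<forall>\<xi>\<in>carr H. \<rho> (k\<^sub>H \<xi>) = \<psi> \<xi>) \<and> (\<forall>a\<in>carr A. \<rho> (k\<^sub>A a) = \<pi> a)"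

definition gauge_action ::
    "('v, 'm) calgebra_scheme \<Rightarrow> ('v, 'h, 'n) correspondence_scheme \<Rightarrow> ('w, 'k) calgebra_scheme \<Rightarrow>
     ('h \<Rightarrow> 'w) \<Rightarrow> ('v \<Rightarrow> 'w) \<Rightarrow> (complex \<Rightarrow> 'w \<Rightarrow> 'w) \<Rightarrow> bool" where
  "gauge_action A H O\<^sub>H k\<^sub>H k\<^sub>A \<gamma> \<longleftrightarrow>
    (\<forall>z\<in>sphere 0 1. star_iso O\<^sub>H O\<^sub>H (\<gamma> z)) \<and>
    (\<forall>b\<in>carr O\<^sub>H. \<gamma> 1 b = b) \<and>
    (\<forall>z\<in>sphere 0 1. \<forall>w\<in>sphere 0 1. \<forall>b\<in>carr O\<^sub>H. \<gamma> (z * w) b = \<gamma> z (\<gamma> w b)) \<and>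
    (\<forall>b\<in>carr O\<^sub>H. \<forall>w\<in>sphere 0 1.
      ((\<lambda>z. vnorm O\<^sub>H (vdiff O\<^sub>H (\<gamma> z b) (\<gamma> w b))) \<longlongrightarrow> 0) (at w within sphere 0 1)) \<and>
    (\<forall>z\<in>sphere 0 1. \<forall>a\<in>carr A. \<gamma> z (k\<^sub>A a) = k\<^sub>A a) \<and>
    (\<forall>z\<in>sphere 0 1. \<forall>\<xi>\<in>carr H. \<gamma> z (k\<^sub>H \<xi>) = vscale O\<^sub>H z (k\<^sub>H \<xi>))"


section \<open>Subshifts\<close>

definition shift :: "(nat \<Rightarrow> 'a) \<Rightarrow> nat \<Rightarrow> 'a" where
  "shift x = (\<lambda>i. x (Suc i))"

definition full_shift :: "'a set \<Rightarrow> (nat \<Rightarrow> 'a) topology" where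
  "full_shift \<AA> = product_topology (\<lambda>_. discrete_topology \<AA>) UNIV"

definition subshift :: "'a set \<Rightarrow> (nat \<Rightarrow> 'a) set \<Rightarrow> bool" where
  "subshift \<AA> X \<longleftrightarrow> finite \<AA> \<and> closedin (full_shift \<AA>) X \<and> shift ` X \<subseteq> X"

definition conjugate_subshifts ::
    "'a set \<Rightarrow> (nat \<Rightarrow> 'a) set \<Rightarrow> 'b set \<Rightarrow> (nat \<Rightarrow> 'b) set \<Rightarrow> bool" where
  "conjugate_subshifts \<AA> X \<BB> Y \<longleftrightarrow>
    (\<exists>\<phi>. homeomorphic_map (subtopology (full_shift \<AA>) X) (subtopology (full_shift \<BB>) Y) \<phi> \<and>
      (\<forall>x\<in>X. \<phi> (shift x) = shift (\<phi> x)))"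

definition cylinder :: "(nat \<Rightarrow> 'a) set \<Rightarrow> 'a list \<Rightarrow> (nat \<Rightarrow> 'a) set" where
  "cylinder X \<mu> = {x \<in> X. map x [0..<length \<mu>] = \<mu>}"

definition cylinder2 :: "(nat \<Rightarrow> 'a) set \<Rightarrow> 'a list \<Rightarrow> 'a list \<Rightarrow> (nat \<Rightarrow> 'a) set" where
  "cylinder2 X \<mu> \<nu> =
    cylinder X \<nu> \<inter> (shift ^^ length \<nu>) -` ((shift ^^ length \<mu>) ` cylinder X \<mu>)"

text \<open>A function on \<open>X\<close> is represented by its extension by zero; the supremum norm
  of that extension is the one on \<open>X\<close>, and it is 0 if \<open>X\<close> is empty.\<close>

definition bounded_functions :: "'x set \<Rightarrow> ('x \<Rightarrow> complex) calgebra" where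
  "bounded_functions X =
    \<lparr>carr = {f. (\<forall>x. x \<notin> X \<longrightarrow> f x = 0) \<and> bounded (range f)},
     vadd = (\<lambda>f g x. f x + g x),
     vzero = (\<lambda>x. 0),
     vscale = (\<lambda>c f x. c * f x),
     vmult = (\<lambda>f g x. f x * g x),
     vstar = (\<lambda>f x. cnj (f x)),
     vnorm = (\<lambda>f. SUP x. cmod (f x))\<rparr>"

definition subshift_algebra ::
    "'a set \<Rightarrow> (nat \<Rightarrow> 'a) set \<Rightarrow> ((nat \<Rightarrow> 'a) \<Rightarrow> complex) calgebra" where
  "subshift_algebra \<AA> X =
    (bounded_functions X)
      \<lparr>carr := cstar_generated (bounded_functions X)
                {indicator (cylinder2 X \<mu> \<nu>) | \<mu> \<nu>. \<mu> \<in> lists \<AA> \<and> \<nu> \<in> lists \<AA>}\<rparr>"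

definition letter_ideal ::
    "'a set \<Rightarrow> (nat \<Rightarrow> 'a) set \<Rightarrow> 'a \<Rightarrow> ((nat \<Rightarrow> 'a) \<Rightarrow> complex) set" where
  "letter_ideal \<AA> X a =
    ideal_generated (subshift_algebra \<AA> X) {indicator (shift ` cylinder X [a])}"

text \<open>\<^term>\<open>case_nat a x\<close> is the sequence $ax$.\<close>

definition letter_transfer ::
    "(nat \<Rightarrow> 'a) set \<Rightarrow> 'a \<Rightarrow> ((nat \<Rightarrow> 'a) \<Rightarrow> complex) \<Rightarrow> (nat \<Rightarrow> 'a) \<Rightarrow> complex" where
  "letter_transfer X a f x = (if case_nat a x \<in> X then f (case_nat a x) else 0)"

text \<open>An element of the direct sum over the alphabet is a family that is zero off the alphabet.\<close>

definition subshift_correspondence ::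
    "'a set \<Rightarrow> (nat \<Rightarrow> 'a) set \<Rightarrow>
     ((nat \<Rightarrow> 'a) \<Rightarrow> complex, 'a \<Rightarrow> (nat \<Rightarrow> 'a) \<Rightarrow> complex) correspondence" where
  "subshift_correspondence \<AA> X =
    \<lparr>carr = {\<xi>. (\<forall>a\<in>\<AA>. \<xi> a \<in> letter_ideal \<AA> X a) \<and> (\<forall>a. a \<notin> \<AA> \<longrightarrow> \<xi> a = (\<lambda>x. 0))},
     vadd = (\<lambda>\<xi> \<eta> a x. \<xi> a x + \<eta> a x),
     vzero = (\<lambda>a x. 0),
     vscale = (\<lambda>c \<xi> a x. c * \<xi> a x),
     ract = (\<lambda>\<xi> f a x. \<xi> a x * f x),
     hinner = (\<lambda>\<xi> \<eta> x. \<Sum>a\<in>\<AA>. cnj (\<xi> a x) * \<eta> a x),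
     lact = (\<lambda>f \<xi> a x. letter_transfer X a f x * \<xi> a x)\<rparr>"


section \<open>The correspondence of a subshift is a $C^*$-correspondence\<close>

lemma bdd_above_cmod: "bounded (range f) \<Longrightarrow> bdd_above (range (\<lambda>x. cmod (f x)))"
  by (force simp: bounded_iff intro: bdd_aboveI)

lemma cmod_le_vnorm:
  assumes "f \<in> carr (bounded_functions X)"
  shows "cmod (f x) \<le> vnorm (bounded_functions X) f"
  using assms bdd_above_cmod[of f] by (auto simp: bounded_functions_def intro: cSUP_upper)

lemma vnorm_le:
  assumes "\<And>x. cmod (f x) \<le> c"
  shows "vnorm (bounded_functions X) f \<le> c"
  using assms by (auto simp: bounded_functions_def intro: cSUP_least)

lemma carr_bounded_functionsI:
  assumes "\<And>x. x \<notin> X \<Longrightarrow> f x = 0" "\<And>x. cmod (f x) \<le> c"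
  shows "f \<in> carr (bounded_functions X)"
  using assms by (auto simp: bounded_functions_def bounded_iff)

lemma carr_bounded_functionsD:
  "f \<in> carr (bounded_functions X) \<Longrightarrow> x \<notin> X \<Longrightarrow> f x = 0"
  by (simp add: bounded_functions_def)

lemma bounded_functions_simps [simp]:
  "vadd (bounded_functions X) f g = (\<lambda>x. f x + g x)"
  "vzero (bounded_functions X) = (\<lambda>x. 0)"
  "vscale (bounded_functions X) c f = (\<lambda>x. c * f x)"
  "vmult (bounded_functions X) f g = (\<lambda>x. f x * g x)"
  "vstar (bounded_functions X) f = (\<lambda>x. cnj (f x))"
  "vdiff (bounded_functions X) f g = (\<lambda>x. f x - g x)"
  by (auto simp: bounded_functions_def vdiff_def)

lemma norm_complete_bounded_functions:
  "norm_complete (bounded_functions X) (vnorm (bounded_functions X))"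
  unfolding norm_complete_def
proof (intro allI impI, elim conjE)
  fix f :: "nat \<Rightarrow> 'a \<Rightarrow> complex"
  let ?B = "bounded_functions X"
  assume f: "\<forall>n. f n \<in> carr ?B"
    and C: "\<forall>e>0. \<exists>k. \<forall>m\<ge>k. \<forall>n\<ge>k. vnorm ?B (vdiff ?B (f m) (f n)) < e"
  have diffB: "(\<lambda>x. f m x - f n x) \<in> carr ?B" for m n
  proof (rule carr_bounded_functionsI)
    show "f m x - f n x = 0" if "x \<notin> X" for x
      using f that by (simp add: carr_bounded_functionsD[of _ X])
    show "cmod (f m x - f n x) \<le> vnorm ?B (f m) + vnorm ?B (f n)" for x
      using f by (intro order.trans[OF norm_triangle_ineq4] add_mono cmod_le_vnorm) auto
  qed
  have C': "\<exists>k. \<forall>m\<ge>k. \<forall>n\<ge>k. \<forall>x. cmod (f m x - f n x) < e" if "e > 0" for e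
  proof -
    obtain k where k: "\<forall>m\<ge>k. \<forall>n\<ge>k. vnorm ?B (vdiff ?B (f m) (f n)) < e" using C \<open>e > 0\<close> by blast
    have "cmod (f m x - f n x) < e" if "m \<ge> k" "n \<ge> k" for m n x
      using k that le_less_trans[OF cmod_le_vnorm[OF diffB[of m n], of x]] by simp
    then show ?thesis by blast
  qed
  have "Cauchy (\<lambda>n. f n x)" for x
  proof (rule metric_CauchyI)
    fix e :: real assume "e > 0"
    then show "\<exists>k. \<forall>m\<ge>k. \<forall>n\<ge>k. dist (f m x) (f n x) < e"
      unfolding dist_norm using C'[of e] by blast
  qed
  note cauchy = this
  define g where "g x = lim (\<lambda>n. f n x)" for x
  have g: "(\<lambda>n. f n x) \<longlonglongrightarrow> g x" for x
    unfolding g_def using Cauchy_convergent[OF cauchy[of x]] by (simp add: convergent_LIMSEQ_iff)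
  have unif: "\<exists>k. \<forall>n\<ge>k. \<forall>x. cmod (f n x - g x) \<le> e" if "e > 0" for e
  proof -
    obtain k where k: "\<forall>m\<ge>k. \<forall>n\<ge>k. \<forall>x. cmod (f m x - f n x) < e" using C'[OF \<open>e > 0\<close>] by blast
    have "cmod (f n x - g x) \<le> e" if "n \<ge> k" for n x
    proof (rule LIMSEQ_le_const2)
      show "(\<lambda>m. cmod (f n x - f m x)) \<longlonglongrightarrow> cmod (f n x - g x)"
        by (intro tendsto_intros g)
      show "\<exists>N. \<forall>m\<ge>N. cmod (f n x - f m x) \<le> e"
        using k that by (meson less_imp_le)
    qed
    then show ?thesis by blast
  qed
  obtain k where k: "\<And>n x. n \<ge> k \<Longrightarrow> cmod (f n x - g x) \<le> 1" using unif[of 1] by auto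
  have gB: "g \<in> carr ?B"
  proof (rule carr_bounded_functionsI)
    show "g x = 0" if "x \<notin> X" for x
      using g[of x] f that by (simp add: carr_bounded_functionsD[of _ X] LIMSEQ_const_iff)
    show "cmod (g x) \<le> vnorm ?B (f k) + 1" for x
      using k[of k x] cmod_le_vnorm[of "f k" X x] f norm_triangle_ineq4[of "f k x" "f k x - g x"] by simp
  qed
  have "(\<lambda>n. vnorm ?B (vdiff ?B (f n) g)) \<longlonglongrightarrow> 0"
  proof (rule LIMSEQ_I)
    fix e :: real assume "e > 0"
    then obtain k where k: "\<forall>n\<ge>k. \<forall>x. cmod (f n x - g x) \<le> e/2" using unif[of "e/2"] by auto
    have "norm (vnorm ?B (vdiff ?B (f n) g) - 0) < e" if "n \<ge> k" for n
    proof -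
      have "vnorm ?B (\<lambda>x. f n x - g x) \<le> e/2"
        using k that by (intro vnorm_le) blast
      moreover have d: "(\<lambda>x. f n x - g x) \<in> carr ?B"
        using k that f gB by (intro carr_bounded_functionsI[where c="e/2"]) (auto simp: carr_bounded_functionsD[of _ X])
      have "0 \<le> vnorm ?B (\<lambda>x. f n x - g x)"
        using cmod_le_vnorm[OF d, of undefined] norm_ge_zero order.trans by blast
      ultimately show ?thesis using \<open>e > 0\<close> by simp
    qed
    then show "\<exists>no. \<forall>n\<ge>no. norm (vnorm ?B (vdiff ?B (f n) g) - 0) < e" by blast
  qed
  then show "\<exists>x\<in>carr ?B. (\<lambda>n. vnorm ?B (vdiff ?B (f n) x)) \<longlonglongrightarrow> 0" using gB by blast
qed

lemma vnorm_nonneg: "f \<in> carr (bounded_functions X) \<Longrightarrow> 0 \<le> vnorm (bounded_functions X) f"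
  by (rule order.trans[OF norm_ge_zero cmod_le_vnorm])

lemma bounded_functions_scale:
  assumes "f \<in> carr (bounded_functions X)"
  shows "(\<lambda>x. c * f x) \<in> carr (bounded_functions X)"
    and "vnorm (bounded_functions X) (\<lambda>x. c * f x) \<le> cmod c * vnorm (bounded_functions X) f"
proof -
  have *: "cmod (c * f x) \<le> cmod c * vnorm (bounded_functions X) f" for x
    using cmod_le_vnorm[OF assms, of x] by (simp add: norm_mult mult_left_mono)
  show "(\<lambda>x. c * f x) \<in> carr (bounded_functions X)"
    using carr_bounded_functionsD[OF assms] * by (intro carr_bounded_functionsI) auto
  show "vnorm (bounded_functions X) (\<lambda>x. c * f x) \<le> cmod c * vnorm (bounded_functions X) f"
    using * by (rule vnorm_le)
qed

lemma bounded_functions_add: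
  assumes "f \<in> carr (bounded_functions X)" "g \<in> carr (bounded_functions X)"
  shows "(\<lambda>x. f x + g x) \<in> carr (bounded_functions X)"
    and "vnorm (bounded_functions X) (\<lambda>x. f x + g x)
      \<le> vnorm (bounded_functions X) f + vnorm (bounded_functions X) g"
proof -
  have *: "cmod (f x + g x) \<le> vnorm (bounded_functions X) f + vnorm (bounded_functions X) g" for x
    by (intro norm_triangle_mono cmod_le_vnorm assms)
  show "(\<lambda>x. f x + g x) \<in> carr (bounded_functions X)"
    using carr_bounded_functionsD[OF assms(1)] carr_bounded_functionsD[OF assms(2)] *
    by (intro carr_bounded_functionsI) auto
  show "vnorm (bounded_functions X) (\<lambda>x. f x + g x)
      \<le> vnorm (bounded_functions X) f + vnorm (bounded_functions X) g"
    using * by (rule vnorm_le)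
qed

lemma bounded_functions_mult:
  assumes "f \<in> carr (bounded_functions X)" "g \<in> carr (bounded_functions X)"
  shows "(\<lambda>x. f x * g x) \<in> carr (bounded_functions X)"
    and "vnorm (bounded_functions X) (\<lambda>x. f x * g x)
      \<le> vnorm (bounded_functions X) f * vnorm (bounded_functions X) g"
proof -
  have *: "cmod (f x * g x) \<le> vnorm (bounded_functions X) f * vnorm (bounded_functions X) g" for x
    unfolding norm_mult by (intro mult_mono cmod_le_vnorm vnorm_nonneg assms norm_ge_zero)
  show "(\<lambda>x. f x * g x) \<in> carr (bounded_functions X)"
    using carr_bounded_functionsD[OF assms(1)] carr_bounded_functionsD[OF assms(2)] *
    by (intro carr_bounded_functionsI) auto
  show "vnorm (bounded_functions X) (\<lambda>x. f x * g x)
      \<le> vnorm (bounded_functions X) f * vnorm (bounded_functions X) g"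
    using * by (rule vnorm_le)
qed

lemma bounded_functions_cnj:
  assumes "f \<in> carr (bounded_functions X)"
  shows "(\<lambda>x. cnj (f x)) \<in> carr (bounded_functions X)"
  using carr_bounded_functionsD[OF assms] cmod_le_vnorm[OF assms]
  by (intro carr_bounded_functionsI[where c="vnorm (bounded_functions X) f"]) auto

lemma cstar_algebra_bounded_functions: "cstar_algebra (bounded_functions X)"
proof
  let ?B = "bounded_functions X"
  show "\<zero>\<^bsub>?B\<^esub> \<in> carr ?B" by (auto intro: carr_bounded_functionsI)
  show "norm_complete ?B (vnorm ?B)" by (rule norm_complete_bounded_functions)
  fix f :: "'a \<Rightarrow> complex" and c d :: complex
  assume f: "f \<in> carr ?B"
  note N = cmod_le_vnorm[OF f]
  show "f \<oplus>\<^bsub>?B\<^esub> \<zero>\<^bsub>?B\<^esub> = f" "f \<oplus>\<^bsub>?B\<^esub> - 1 \<odot>\<^bsub>?B\<^esub> f = \<zero>\<^bsub>?B\<^esub>" "1 \<odot>\<^bsub>?B\<^esub> f = f"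
    "c \<odot>\<^bsub>?B\<^esub> d \<odot>\<^bsub>?B\<^esub> f = (c * d) \<odot>\<^bsub>?B\<^esub> f" "(c + d) \<odot>\<^bsub>?B\<^esub> f = c \<odot>\<^bsub>?B\<^esub> f \<oplus>\<^bsub>?B\<^esub> d \<odot>\<^bsub>?B\<^esub> f"
    "vstar ?B (vstar ?B f) = f" "vstar ?B (c \<odot>\<^bsub>?B\<^esub> f) = cnj c \<odot>\<^bsub>?B\<^esub> vstar ?B f"
    by (simp_all add: fun_eq_iff algebra_simps)
  show "c \<odot>\<^bsub>?B\<^esub> f \<in> carr ?B" using bounded_functions_scale[OF f] by simp
  show "vstar ?B f \<in> carr ?B" using bounded_functions_cnj[OF f] by simp
  show "0 \<le> vnorm ?B f" by (rule vnorm_nonneg[OF f])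
  show "f = \<zero>\<^bsub>?B\<^esub>" if "vnorm ?B f = 0"
    using N that by (auto simp: fun_eq_iff)
  show "vnorm ?B (c \<odot>\<^bsub>?B\<^esub> f) = cmod c * vnorm ?B f"
  proof (cases "c = 0")
    case False
    have "vnorm ?B f \<le> cmod (1/c) * vnorm ?B (c \<odot>\<^bsub>?B\<^esub> f)"
      using bounded_functions_scale(2)[OF bounded_functions_scale(1)[OF f], of "1/c" c] False by simp
    then show ?thesis using bounded_functions_scale(2)[OF f, of c] False
      by (simp add: norm_divide field_simps)
  next
    case True
    then show ?thesis by (simp add: bounded_functions_def)
  qed
  show "vnorm ?B (vstar ?B f \<otimes>\<^bsub>?B\<^esub> f) = (vnorm ?B f)\<^sup>2"
  proof (rule antisym)
    show "vnorm ?B (vstar ?B f \<otimes>\<^bsub>?B\<^esub> f) \<le> (vnorm ?B f)\<^sup>2"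
      unfolding bounded_functions_simps power2_eq_square
      by (rule vnorm_le) (simp add: norm_mult mult_mono N vnorm_nonneg[OF f])
    have m: "(\<lambda>x. cnj (f x) * f x) \<in> carr ?B"
      by (rule bounded_functions_mult(1)[OF bounded_functions_cnj[OF f] f])
    have "vnorm ?B f \<le> sqrt (vnorm ?B (\<lambda>x. cnj (f x) * f x))"
      using cmod_le_vnorm[OF m]
      by (intro vnorm_le real_le_rsqrt) (simp add: norm_mult power2_eq_square)
    then have "(vnorm ?B f)\<^sup>2 \<le> (sqrt (vnorm ?B (\<lambda>x. cnj (f x) * f x)))\<^sup>2"
      by (intro power_mono vnorm_nonneg f)
    then show "(vnorm ?B f)\<^sup>2 \<le> vnorm ?B (vstar ?B f \<otimes>\<^bsub>?B\<^esub> f)"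
      using vnorm_nonneg[OF m] by simp
  qed
  fix g h :: "'a \<Rightarrow> complex"
  assume g: "g \<in> carr ?B"
  show "f \<oplus>\<^bsub>?B\<^esub> g = g \<oplus>\<^bsub>?B\<^esub> f" "c \<odot>\<^bsub>?B\<^esub> (f \<oplus>\<^bsub>?B\<^esub> g) = c \<odot>\<^bsub>?B\<^esub> f \<oplus>\<^bsub>?B\<^esub> c \<odot>\<^bsub>?B\<^esub> g"
    "(c \<odot>\<^bsub>?B\<^esub> f) \<otimes>\<^bsub>?B\<^esub> g = c \<odot>\<^bsub>?B\<^esub> (f \<otimes>\<^bsub>?B\<^esub> g)" "f \<otimes>\<^bsub>?B\<^esub> (c \<odot>\<^bsub>?B\<^esub> g) = c \<odot>\<^bsub>?B\<^esub> (f \<otimes>\<^bsub>?B\<^esub> g)"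
    "vstar ?B (f \<oplus>\<^bsub>?B\<^esub> g) = vstar ?B f \<oplus>\<^bsub>?B\<^esub> vstar ?B g"
    "vstar ?B (f \<otimes>\<^bsub>?B\<^esub> g) = vstar ?B g \<otimes>\<^bsub>?B\<^esub> vstar ?B f"
    "(f \<oplus>\<^bsub>?B\<^esub> g) \<oplus>\<^bsub>?B\<^esub> h = f \<oplus>\<^bsub>?B\<^esub> (g \<oplus>\<^bsub>?B\<^esub> h)"
    "(f \<otimes>\<^bsub>?B\<^esub> g) \<otimes>\<^bsub>?B\<^esub> h = f \<otimes>\<^bsub>?B\<^esub> (g \<otimes>\<^bsub>?B\<^esub> h)"
    "(f \<oplus>\<^bsub>?B\<^esub> g) \<otimes>\<^bsub>?B\<^esub> h = f \<otimes>\<^bsub>?B\<^esub> h \<oplus>\<^bsub>?B\<^esub> g \<otimes>\<^bsub>?B\<^esub> h"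
    "f \<otimes>\<^bsub>?B\<^esub> (g \<oplus>\<^bsub>?B\<^esub> h) = f \<otimes>\<^bsub>?B\<^esub> g \<oplus>\<^bsub>?B\<^esub> f \<otimes>\<^bsub>?B\<^esub> h"
    by (simp_all add: fun_eq_iff algebra_simps)
  show "f \<oplus>\<^bsub>?B\<^esub> g \<in> carr ?B" "vnorm ?B (f \<oplus>\<^bsub>?B\<^esub> g) \<le> vnorm ?B f + vnorm ?B g"
    using bounded_functions_add[OF f g] by simp_all
  show "f \<otimes>\<^bsub>?B\<^esub> g \<in> carr ?B" "vnorm ?B (f \<otimes>\<^bsub>?B\<^esub> g) \<le> vnorm ?B f * vnorm ?B g"
    using bounded_functions_mult[OF f g] by simp_all
qed

lemma (in cstar_algebra) cstar_algebra_subalgebra: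
  assumes "cstar_subalgebra A S"
  shows "cstar_algebra (A\<lparr>carr := S\<rparr>)"
proof -
  have S: "S \<subseteq> carr A" "\<zero> \<in> S" "\<And>x y. x\<in>S \<Longrightarrow> y\<in>S \<Longrightarrow> x \<oplus> y \<in> S" "\<And>c x. x\<in>S \<Longrightarrow> c \<odot> x \<in> S"
    "\<And>x y. x\<in>S \<Longrightarrow> y\<in>S \<Longrightarrow> x \<otimes> y \<in> S" "\<And>x. x\<in>S \<Longrightarrow> vstar A x \<in> S"
    and cl: "\<And>f x. (\<And>n::nat. f n \<in> S) \<Longrightarrow> x \<in> carr A \<Longrightarrow> (\<lambda>n. vnorm A (vdiff A (f n) x)) \<longlonglongrightarrow> 0 \<Longrightarrow> x \<in> S"
    using assms unfolding cstar_subalgebra_def closed_subspace_def by blast+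
  have sc: "x \<in> S \<Longrightarrow> x \<in> carr A" for x using S(1) by auto
  have "norm_complete (A\<lparr>carr := S\<rparr>) (vnorm A)"
    unfolding norm_complete_def
  proof (intro allI impI, elim conjE)
    fix f :: "nat \<Rightarrow> 'v"
    assume f: "\<forall>n. f n \<in> carr (A\<lparr>carr := S\<rparr>)"
      and "\<forall>e>0. \<exists>k. \<forall>m\<ge>k. \<forall>n\<ge>k. vnorm A (vdiff (A\<lparr>carr := S\<rparr>) (f m) (f n)) < e"
    then obtain x where "x \<in> carr A" "(\<lambda>n. vnorm A (vdiff A (f n) x)) \<longlonglongrightarrow> 0"
      using complete sc unfolding norm_complete_def by (simp add: vdiff_def) blast
    then show "\<exists>x\<in>carr (A\<lparr>carr := S\<rparr>). (\<lambda>n. vnorm A (vdiff (A\<lparr>carr := S\<rparr>) (f n) x)) \<longlonglongrightarrow> 0"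
      using cl[of f x] f by (auto simp: vdiff_def)
  qed
  then show ?thesis
    by unfold_locales (simp_all add: S sc add_assoc add_zero add_minus scale_scale scale_one
      scale_add_left scale_add_right mult_assoc mult_add_left mult_add_right mult_scale_left
      mult_scale_right star_star star_add star_scale star_mult norm_nonneg
      norm_triangle norm_scale norm_mult norm_star, (metis sc add_commute norm_eq_zero)+)
qed

lemma (in cstar_algebra) cstar_subalgebra_carr: "cstar_subalgebra A (carr A)"
  by (auto simp: cstar_subalgebra_def closed_subspace_def zero_closed add_closed scale_closed
      mult_closed star_closed)

lemma (in cstar_algebra) closed_ideal_carr: "closed_ideal A (carr A)"
  by (auto simp: closed_ideal_def closed_subspace_def zero_closed add_closed scale_closed mult_closed)

lemma closed_subspace_Inter:
  assumes "\<And>S. S \<in> \<S> \<Longrightarrow> closed_subspace A S" "\<S> \<noteq> {}"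
  shows "closed_subspace A (\<Inter>\<S>)"
  unfolding closed_subspace_def
proof (intro conjI ballI allI impI)
  fix f x assume h: "(\<forall>n::nat. f n \<in> \<Inter>\<S>) \<and> x \<in> carr A \<and> (\<lambda>n. vnorm A (vdiff A (f n) x)) \<longlonglongrightarrow> 0"
  show "x \<in> \<Inter>\<S>"
  proof
    fix S assume "S \<in> \<S>"
    then have "\<forall>n. f n \<in> S" "closed_subspace A S" using h assms by auto
    then show "x \<in> S" using h unfolding closed_subspace_def by blast
  qed
next
  show "\<Inter>\<S> \<subseteq> carr A" using assms unfolding closed_subspace_def by blast
  show "vzero A \<in> \<Inter>\<S>" using assms unfolding closed_subspace_def by blast
  show "vadd A x y \<in> \<Inter>\<S>" if "x \<in> \<Inter>\<S>" "y \<in> \<Inter>\<S>" for x y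
    using that assms unfolding closed_subspace_def by (meson Inter_iff)
  show "vscale A c x \<in> \<Inter>\<S>" if "x \<in> \<Inter>\<S>" for c x
    using that assms unfolding closed_subspace_def by (meson Inter_iff)
qed

lemma (in cstar_algebra) cstar_subalgebra_generated:
  assumes "G \<subseteq> carr A"
  shows "cstar_subalgebra A (cstar_generated A G)"
proof -
  have "closed_subspace A (cstar_generated A G)"
    unfolding cstar_generated_def
  proof (rule closed_subspace_Inter)
    show "{S. cstar_subalgebra A S \<and> G \<subseteq> S} \<noteq> {}" using cstar_subalgebra_carr assms by blast
  qed (simp add: cstar_subalgebra_def)
  moreover have "x \<otimes> y \<in> cstar_generated A G"
    if "x \<in> cstar_generated A G" "y \<in> cstar_generated A G" for x y
    using that unfolding cstar_generated_def cstar_subalgebra_def by blast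
  moreover have "vstar A x \<in> cstar_generated A G" if "x \<in> cstar_generated A G" for x
    using that unfolding cstar_generated_def cstar_subalgebra_def by blast
  ultimately show ?thesis unfolding cstar_subalgebra_def by simp
qed

lemma (in cstar_algebra) closed_ideal_generated:
  assumes "G \<subseteq> carr A"
  shows "closed_ideal A (ideal_generated A G)"
proof -
  have "closed_subspace A (ideal_generated A G)"
    unfolding ideal_generated_def
  proof (rule closed_subspace_Inter)
    show "{S. closed_ideal A S \<and> G \<subseteq> S} \<noteq> {}" using closed_ideal_carr assms by blast
  qed (simp add: closed_ideal_def)
  moreover have "x \<otimes> y \<in> ideal_generated A G \<and> y \<otimes> x \<in> ideal_generated A G"
    if "x \<in> carr A" "y \<in> ideal_generated A G" for x y
    using that unfolding ideal_generated_def closed_ideal_def by blast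
  ultimately show ?thesis unfolding closed_ideal_def by simp
qed


lemma closed_subspace_limit:
  assumes "closed_subspace A S" "\<And>n::nat. f n \<in> S" "x \<in> carr A"
    "(\<lambda>n. vnorm A (vdiff A (f n) x)) \<longlonglongrightarrow> 0"
  shows "x \<in> S"
  using assms unfolding closed_subspace_def by blast

lemma closed_subspace_closed:
  assumes "closed_subspace A S"
  shows "S \<subseteq> carr A" "vzero A \<in> S" "x \<in> S \<Longrightarrow> vscale A c x \<in> S"
    "x \<in> S \<Longrightarrow> y \<in> S \<Longrightarrow> vadd A x y \<in> S"
  using assms by (simp_all add: closed_subspace_def)

lemma closed_subspace_approx:
  assumes S: "closed_subspace (bounded_functions X) S" and g: "g \<in> carr (bounded_functions X)"
    and approx: "\<And>e. e > 0 \<Longrightarrow> \<exists>f\<in>S. \<forall>x. cmod (f x - g x) \<le> e"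
  shows "g \<in> S"
proof -
  have "\<exists>f\<in>S. \<forall>x. cmod (f x - g x) \<le> inverse (real (Suc n))" for n
    by (rule approx) simp
  then obtain f where f: "\<And>n. f n \<in> S" "\<And>n x. cmod (f n x - g x) \<le> inverse (real (Suc n))"
    by metis
  have fB: "f n \<in> carr (bounded_functions X)" for n
    using f(1) S by (auto simp: closed_subspace_def)
  have d: "(\<lambda>x. f n x - g x) \<in> carr (bounded_functions X)" for n
    using bounded_functions_add(1)[OF fB bounded_functions_scale(1)[OF g, of "-1"]] by simp
  have "(\<lambda>n. vnorm (bounded_functions X) (\<lambda>x. f n x - g x)) \<longlonglongrightarrow> 0"
  proof (rule tendsto_sandwich[OF _ _ tendsto_const LIMSEQ_inverse_real_of_nat])
    show "\<forall>\<^sub>F n in sequentially. 0 \<le> vnorm (bounded_functions X) (\<lambda>x. f n x - g x)"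
      by (rule always_eventually) (simp add: vnorm_nonneg d)
    show "\<forall>\<^sub>F n in sequentially. vnorm (bounded_functions X) (\<lambda>x. f n x - g x) \<le> inverse (real (Suc n))"
      by (rule always_eventually) (intro allI vnorm_le f(2))
  qed
  then show ?thesis using S f(1) g unfolding closed_subspace_def bounded_functions_simps by blast
qed

lemma subshift_algebra_simps [simp]:
  "vadd (subshift_algebra \<AA> X) f g = (\<lambda>x. f x + g x)"
  "vzero (subshift_algebra \<AA> X) = (\<lambda>x. 0)"
  "vscale (subshift_algebra \<AA> X) c f = (\<lambda>x. c * f x)"
  "vmult (subshift_algebra \<AA> X) f g = (\<lambda>x. f x * g x)"
  "vstar (subshift_algebra \<AA> X) f = (\<lambda>x. cnj (f x))"
  "vnorm (subshift_algebra \<AA> X) f = vnorm (bounded_functions X) f"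
  "vdiff (subshift_algebra \<AA> X) f g = (\<lambda>x. f x - g x)"
  by (auto simp: subshift_algebra_def bounded_functions_def vdiff_def)

lemma indicator_bounded_functions:
  "S \<subseteq> X \<Longrightarrow> indicator S \<in> carr (bounded_functions X)"
  by (rule carr_bounded_functionsI[where c=1]) (auto simp: indicator_def)

lemma cylinder2_subset: "cylinder2 X \<mu> \<nu> \<subseteq> X"
  by (auto simp: cylinder2_def cylinder_def)

lemma cstar_subalgebra_subshift_algebra:
  "cstar_subalgebra (bounded_functions X) (carr (subshift_algebra \<AA> X))"
proof -
  have "{indicator (cylinder2 X \<mu> \<nu>) | \<mu> \<nu>. \<mu> \<in> lists \<AA> \<and> \<nu> \<in> lists \<AA>} \<subseteq> carr (bounded_functions X)"
    using indicator_bounded_functions[OF cylinder2_subset] by blast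
  from cstar_algebra.cstar_subalgebra_generated[OF cstar_algebra_bounded_functions this]
  show ?thesis by (simp add: subshift_algebra_def)
qed

lemma cstar_algebra_subshift_algebra: "cstar_algebra (subshift_algebra \<AA> X)"
  using cstar_algebra.cstar_algebra_subalgebra[OF cstar_algebra_bounded_functions
      cstar_subalgebra_subshift_algebra[of X \<AA>]]
  by (simp add: subshift_algebra_def)

lemma subshift_algebra_bounded:
  "f \<in> carr (subshift_algebra \<AA> X) \<Longrightarrow> f \<in> carr (bounded_functions X)"
  using cstar_subalgebra_subshift_algebra[of X \<AA>] unfolding cstar_subalgebra_def closed_subspace_def by blast

lemma subshift_algebra_closed:
  assumes "f \<in> carr (subshift_algebra \<AA> X)"
  shows "(\<lambda>x. c * f x) \<in> carr (subshift_algebra \<AA> X)" "(\<lambda>x. cnj (f x)) \<in> carr (subshift_algebra \<AA> X)"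
    and "g \<in> carr (subshift_algebra \<AA> X) \<Longrightarrow> (\<lambda>x. f x + g x) \<in> carr (subshift_algebra \<AA> X)"
    and "g \<in> carr (subshift_algebra \<AA> X) \<Longrightarrow> (\<lambda>x. f x * g x) \<in> carr (subshift_algebra \<AA> X)"
  using complex_space.scale_closed[OF cstar_algebra.axioms(1), OF cstar_algebra_subshift_algebra, of f \<AA> X c]
    complex_space.add_closed[OF cstar_algebra.axioms(1), OF cstar_algebra_subshift_algebra, of f \<AA> X g]
    cstar_algebra.mult_closed[OF cstar_algebra_subshift_algebra, of f \<AA> X g]
    cstar_algebra.star_closed[OF cstar_algebra_subshift_algebra, of f \<AA> X] assms
  by simp_all

lemma subshift_algebra_zero: "(\<lambda>x. 0) \<in> carr (subshift_algebra \<AA> X)"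
  using complex_space.zero_closed[OF cstar_algebra.axioms(1), OF cstar_algebra_subshift_algebra, of \<AA> X]
  by simp

lemma subshift_algebra_sum:
  assumes "finite I" "\<And>i. i \<in> I \<Longrightarrow> f i \<in> carr (subshift_algebra \<AA> X)"
  shows "(\<lambda>x. \<Sum>i\<in>I. f i x) \<in> carr (subshift_algebra \<AA> X)"
  using assms by (induction I rule: finite_induct) (auto simp: subshift_algebra_zero subshift_algebra_closed(3))

lemma subshift_algebra_generator:
  assumes "\<mu> \<in> lists \<AA>" "\<nu> \<in> lists \<AA>"
  shows "indicator (cylinder2 X \<mu> \<nu>) \<in> carr (subshift_algebra \<AA> X)"
proof -
  have "{indicator (cylinder2 X \<mu> \<nu>) | \<mu> \<nu>. \<mu> \<in> lists \<AA> \<and> \<nu> \<in> lists \<AA>}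
      \<subseteq> carr (subshift_algebra \<AA> X)"
    unfolding subshift_algebra_def cstar_generated_def by auto
  then show ?thesis using assms by blast
qed

lemma subshift_algebra_least:
  assumes "cstar_subalgebra (bounded_functions X) S"
    and "{indicator (cylinder2 X \<mu> \<nu>) | \<mu> \<nu>. \<mu> \<in> lists \<AA> \<and> \<nu> \<in> lists \<AA>} \<subseteq> S"
  shows "carr (subshift_algebra \<AA> X) \<subseteq> S"
  using assms by (simp add: subshift_algebra_def cstar_generated_def Inter_lower)

lemma subshift_algebra_unit: "indicator X \<in> carr (subshift_algebra \<AA> X)"
proof -
  have "cylinder2 X [] [] = X" by (auto simp: cylinder2_def cylinder_def)
  then show ?thesis using subshift_algebra_generator[of "[]" \<AA> "[]" X] by simp
qed

lemma subshift_algebra_sqrt: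
  assumes f: "(\<lambda>x. of_real (r x)) \<in> carr (subshift_algebra \<AA> X)" and r: "\<And>x. 0 \<le> r x"
  shows "(\<lambda>x. of_real (sqrt (r x))) \<in> carr (subshift_algebra \<AA> X)"
proof (rule closed_subspace_approx)
  let ?M = "vnorm (bounded_functions X) (\<lambda>x. of_real (r x))"
  show "closed_subspace (bounded_functions X) (carr (subshift_algebra \<AA> X))"
    using cstar_subalgebra_subshift_algebra[of X \<AA>] unfolding cstar_subalgebra_def by blast
  have M: "r x \<le> ?M" for x
    using cmod_le_vnorm[OF subshift_algebra_bounded[OF f], of x] r[of x] by simp
  have off: "r x = 0" if "x \<notin> X" for x
    using carr_bounded_functionsD[OF subshift_algebra_bounded[OF f] that] by simp
  show "(\<lambda>x. of_real (sqrt (r x))) \<in> carr (bounded_functions X)"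
    by (rule carr_bounded_functionsI[where c="sqrt ?M"]) (auto simp: off r M)
  fix e :: real assume "e > 0"
  have "continuous_on {0..?M} sqrt" by (intro continuous_intros)
  from Stone_Weierstrass_real_polynomial_function[OF compact_Icc this \<open>e > 0\<close>]
  obtain p where p: "real_polynomial_function p" "\<And>t. t \<in> {0..?M} \<Longrightarrow> \<bar>sqrt t - p t\<bar> < e"
    by blast
  have "(\<lambda>x. indicator X x * of_real (p (r x))) \<in> carr (subshift_algebra \<AA> X)"
    using p(1)
  proof (induction p rule: real_polynomial_function.induct)
    case (linear q)
    have "indicator X x * of_real (q (r x)) = of_real (q 1) * (of_real (r x) :: complex)" for x
    proof (cases "x \<in> X")
      case True
      have "q (r x) = r x * q 1" using linear_simps(5)[OF linear.hyps, of "r x" 1] by simp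
      then have "of_real (q (r x)) = of_real (q 1) * (of_real (r x) :: complex)"
        by (simp only: of_real_mult mult.commute)
      then show ?thesis using True by simp
    qed (simp add: off)
    then have "(\<lambda>x. indicator X x * of_real (q (r x))) = (\<lambda>x. of_real (q 1) * (of_real (r x) :: complex))"
      by (rule ext)
    then show ?case using subshift_algebra_closed(1)[OF f] by simp
  next
    case (const c)
    then show ?case
      using subshift_algebra_closed(1)[OF subshift_algebra_unit, of "of_real c"] by (simp add: mult.commute)
  next
    case (add p q)
    have "(\<lambda>x. indicator X x * of_real (p (r x) + q (r x)))
        = (\<lambda>x. indicator X x * of_real (p (r x)) + indicator X x * of_real (q (r x)) :: complex)"
      by (simp add: fun_eq_iff distrib_left)
    then show ?case using subshift_algebra_closed(3)[OF add.IH] by simp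
  next
    case (mult p q)
    have "(\<lambda>x. indicator X x * of_real (p (r x) * q (r x)))
        = (\<lambda>x. (indicator X x * of_real (p (r x))) * (indicator X x * of_real (q (r x))) :: complex)"
      by (auto simp: fun_eq_iff indicator_def)
    then show ?case using subshift_algebra_closed(4)[OF mult.IH] by simp
  qed
  moreover have "cmod (indicator X x * of_real (p (r x)) - of_real (sqrt (r x))) \<le> e" for x
  proof (cases "x \<in> X")
    case True
    have "cmod (of_real (p (r x)) - of_real (sqrt (r x))) = \<bar>p (r x) - sqrt (r x)\<bar>"
      by (simp flip: of_real_diff)
    then show ?thesis using True p(2)[of "r x"] r[of x] M[of x] by simp
  next
    case False
    then show ?thesis using off \<open>e > 0\<close> by simp
  qed
  ultimately show "\<exists>f\<in>carr (subshift_algebra \<AA> X). \<forall>x. cmod (f x - of_real (sqrt (r x))) \<le> e"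
    by (intro bexI[of _ "\<lambda>x. indicator X x * of_real (p (r x))"]) auto
qed

lemma funpow_shift: "(shift ^^ n) x = (\<lambda>i. x (n + i))"
  by (induction n) (auto simp: shift_def)

lemma cylinder_iff: "x \<in> cylinder X \<mu> \<longleftrightarrow> x \<in> X \<and> (\<forall>i<length \<mu>. x i = \<mu> ! i)"
  using list_eq_iff_nth_eq[of "map x [0..<length \<mu>]" \<mu>] by (simp add: cylinder_def)

lemma cylinder2_iff:
  "x \<in> cylinder2 X \<mu> \<nu> \<longleftrightarrow>
    x \<in> cylinder X \<nu> \<and> (\<exists>y\<in>cylinder X \<mu>. \<forall>i. x (length \<nu> + i) = y (length \<mu> + i))"
  by (auto simp: cylinder2_def funpow_shift fun_eq_iff image_iff)

lemma shift_case_nat: "shift (case_nat a x) = x"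
  by (simp add: shift_def)

lemma case_nat_shift: "x 0 = a \<Longrightarrow> case_nat a (shift x) = x"
  by (auto simp: shift_def fun_eq_iff split: nat.split)

lemma shift_image_cylinder:
  assumes "shift ` X \<subseteq> X"
  shows "shift ` cylinder X [a] = {x. case_nat a x \<in> X}"
proof -
  have "x \<in> shift ` cylinder X [a] \<longleftrightarrow> case_nat a x \<in> X" for x
  proof
    assume "case_nat a x \<in> X"
    then show "x \<in> shift ` cylinder X [a]"
      by (intro image_eqI[where x="case_nat a x"]) (auto simp: shift_case_nat cylinder_iff)
  qed (auto simp: cylinder_iff case_nat_shift)
  then show ?thesis by auto
qed

lemma shift_image_cylinder_eq_cylinder2:
  assumes "shift ` X \<subseteq> X"
  shows "shift ` cylinder X [a] = cylinder2 X [a] []"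
  using assms by (auto simp: cylinder2_def cylinder_def)

lemma letter_transfer_indicator_Nil:
  assumes X: "shift ` X \<subseteq> X"
  shows "letter_transfer X a (indicator (cylinder2 X \<mu> [])) =
    (\<lambda>x. indicator (cylinder2 X (\<mu> @ [a]) []) x * indicator (cylinder2 X [a] []) x)"
proof
  fix x
  have a: "x \<in> cylinder2 X [a] [] \<longleftrightarrow> case_nat a x \<in> X"
    by (simp flip: shift_image_cylinder_eq_cylinder2[OF X] add: shift_image_cylinder[OF X])
  have xX: "x \<in> X" if "case_nat a x \<in> X"
    using subsetD[OF X imageI[OF that]] by (simp add: shift_case_nat)
  have iff: "(\<exists>y\<in>cylinder X \<mu>. \<forall>i. case_nat a x i = y (length \<mu> + i)) \<longleftrightarrow>
      (\<exists>y\<in>cylinder X (\<mu> @ [a]). \<forall>i. x i = y (Suc (length \<mu>) + i))" (is "?L \<longleftrightarrow> ?R")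
  proof
    assume ?L
    then obtain y where y: "y \<in> cylinder X \<mu>" "\<And>i. case_nat a x i = y (length \<mu> + i)" by blast
    have "y i = (\<mu> @ [a]) ! i" if "i < length (\<mu> @ [a])" for i
      using y(1) y(2)[of 0] that by (cases "i = length \<mu>") (auto simp: cylinder_iff nth_append)
    then have "y \<in> cylinder X (\<mu> @ [a])"
      using y(1) by (simp add: cylinder_iff)
    moreover have "x i = y (Suc (length \<mu>) + i)" for i using y(2)[of "Suc i"] by simp
    ultimately show ?R by blast
  next
    assume ?R
    then obtain y where y: "y \<in> cylinder X (\<mu> @ [a])" "\<And>i. x i = y (Suc (length \<mu>) + i)" by blast
    then have yX: "y \<in> X" and yi: "\<And>i. i < Suc (length \<mu>) \<Longrightarrow> y i = (\<mu> @ [a]) ! i"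
      by (simp_all add: cylinder_iff)
    have "y i = \<mu> ! i" if "i < length \<mu>" for i
      using yi[of i] that by (simp add: nth_append)
    then have "y \<in> cylinder X \<mu>"
      using yX by (simp add: cylinder_iff)
    moreover have "case_nat a x i = y (length \<mu> + i)" for i
      using y(2) yi[of "length \<mu>"] by (cases i) simp_all
    ultimately show ?L by blast
  qed
  have L: "case_nat a x \<in> cylinder2 X \<mu> [] \<longleftrightarrow> case_nat a x \<in> X \<and> ?L"
    by (simp add: cylinder2_iff cylinder_iff[of _ X "[]"])
  have R: "x \<in> cylinder2 X (\<mu> @ [a]) [] \<longleftrightarrow> x \<in> X \<and> ?R"
    by (simp add: cylinder2_iff cylinder_iff[of _ X "[]"])
  have key: "case_nat a x \<in> X \<and> case_nat a x \<in> cylinder2 X \<mu> [] \<longleftrightarrow>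
      x \<in> cylinder2 X (\<mu> @ [a]) [] \<and> x \<in> cylinder2 X [a] []"
    unfolding L R a iff using xX by satx
  show "letter_transfer X a (indicator (cylinder2 X \<mu> [])) x =
    indicator (cylinder2 X (\<mu> @ [a]) []) x * indicator (cylinder2 X [a] []) x"
    unfolding letter_transfer_def indicator_def using key by (simp split: if_splits) blast
qed

lemma letter_transfer_indicator_Cons:
  assumes X: "shift ` X \<subseteq> X"
  shows "letter_transfer X a (indicator (cylinder2 X \<mu> (b # \<nu>))) =
    (if a = b then (\<lambda>x. indicator (cylinder2 X \<mu> \<nu>) x * indicator (cylinder2 X [a] []) x) else (\<lambda>x. 0))"
proof
  fix x
  have a: "x \<in> cylinder2 X [a] [] \<longleftrightarrow> case_nat a x \<in> X"
    by (simp flip: shift_image_cylinder_eq_cylinder2[OF X] add: shift_image_cylinder[OF X])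
  have xX: "x \<in> X" if "case_nat a x \<in> X"
    using subsetD[OF X imageI[OF that]] by (simp add: shift_case_nat)
  have "(\<forall>i<Suc (length \<nu>). case_nat a x i = (b # \<nu>) ! i) \<longleftrightarrow> a = b \<and> (\<forall>i<length \<nu>. x i = \<nu> ! i)"
    by (simp add: All_less_Suc2)
  then have "case_nat a x \<in> cylinder X (b # \<nu>) \<longleftrightarrow> case_nat a x \<in> X \<and> a = b \<and> x \<in> cylinder X \<nu>"
    using xX by (simp add: cylinder_iff) blast
  then have "case_nat a x \<in> cylinder2 X \<mu> (b # \<nu>) \<longleftrightarrow> case_nat a x \<in> X \<and> a = b \<and> x \<in> cylinder2 X \<mu> \<nu>"
    by (simp add: cylinder2_iff) 
  then show "letter_transfer X a (indicator (cylinder2 X \<mu> (b # \<nu>))) x =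
    (if a = b then (\<lambda>x. indicator (cylinder2 X \<mu> \<nu>) x * indicator (cylinder2 X [a] []) x) else (\<lambda>x. 0)) x"
    using a by (cases "a = b") (simp_all add: letter_transfer_def indicator_def)
qed

lemma letter_transfer_bounded:
  assumes X: "shift ` X \<subseteq> X" and f: "f \<in> carr (bounded_functions X)"
  shows "letter_transfer X a f \<in> carr (bounded_functions X)"
    and "vnorm (bounded_functions X) (letter_transfer X a f) \<le> vnorm (bounded_functions X) f"
proof -
  have *: "cmod (letter_transfer X a f x) \<le> vnorm (bounded_functions X) f" for x
    using cmod_le_vnorm[OF f] vnorm_nonneg[OF f] by (simp add: letter_transfer_def)
  have "case_nat a x \<notin> X" if "x \<notin> X" for x
    using subsetD[OF X imageI[of "case_nat a x" X shift]] that by (auto simp: shift_case_nat)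
  then show "letter_transfer X a f \<in> carr (bounded_functions X)"
    by (intro carr_bounded_functionsI[OF _ *]) (simp add: letter_transfer_def)
  show "vnorm (bounded_functions X) (letter_transfer X a f) \<le> vnorm (bounded_functions X) f"
    using * by (rule vnorm_le)
qed

lemma letter_transfer_algebra:
  assumes X: "shift ` X \<subseteq> X" and a: "a \<in> \<AA>" and f: "f \<in> carr (subshift_algebra \<AA> X)"
  shows "letter_transfer X a f \<in> carr (subshift_algebra \<AA> X)"
proof -
  let ?B = "bounded_functions X" and ?D = "carr (subshift_algebra \<AA> X)" and ?T = "letter_transfer X a"
  let ?S = "{f \<in> carr ?B. ?T f \<in> ?D}"
  have T: "?T (\<lambda>x. 0) = (\<lambda>x. 0)" "?T (\<lambda>x. g x + h x) = (\<lambda>x. ?T g x + ?T h x)"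
    "?T (\<lambda>x. g x * h x) = (\<lambda>x. ?T g x * ?T h x)" "?T (\<lambda>x. g x - h x) = (\<lambda>x. ?T g x - ?T h x)"
    "?T (\<lambda>x. c * g x) = (\<lambda>x. c * ?T g x)" "?T (\<lambda>x. cnj (g x)) = (\<lambda>x. cnj (?T g x))" for g h c
    by (auto simp: fun_eq_iff letter_transfer_def)
  have D: "closed_subspace ?B ?D"
    using cstar_subalgebra_subshift_algebra[of X \<AA>] unfolding cstar_subalgebra_def by blast
  have lim: "g \<in> ?S" if h: "\<forall>n::nat. h n \<in> ?S" "g \<in> carr ?B" "(\<lambda>n. vnorm ?B (vdiff ?B (h n) g)) \<longlonglongrightarrow> 0" for h g
  proof -
    have d: "(\<lambda>x. h n x - g x) \<in> carr ?B" for n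
      using bounded_functions_add(1)[of "h n" X, OF _ bounded_functions_scale(1)[OF h(2), of "-1"]] h(1) by simp
    have "(\<lambda>n. vnorm ?B (\<lambda>x. ?T (h n) x - ?T g x)) \<longlonglongrightarrow> 0"
    proof (rule tendsto_sandwich[OF _ _ tendsto_const])
      show "(\<lambda>n. vnorm ?B (\<lambda>x. h n x - g x)) \<longlonglongrightarrow> 0" using h(3) by simp
      show "\<forall>\<^sub>F n in sequentially. 0 \<le> vnorm ?B (\<lambda>x. ?T (h n) x - ?T g x)"
        using vnorm_nonneg[OF letter_transfer_bounded(1)[OF X d, of a]] by (simp add: T)
      show "\<forall>\<^sub>F n in sequentially. vnorm ?B (\<lambda>x. ?T (h n) x - ?T g x) \<le> vnorm ?B (\<lambda>x. h n x - g x)"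
        using letter_transfer_bounded(2)[OF X d, of a] by (simp add: T)
    qed
    then have "?T g \<in> ?D"
      using h(1) by (intro closed_subspace_limit[OF D _ letter_transfer_bounded(1)[OF X h(2)], of "\<lambda>n. ?T (h n)"]) auto
    then show ?thesis using h(2) by simp
  qed
  have "cstar_subalgebra ?B ?S"
    unfolding cstar_subalgebra_def closed_subspace_def
  proof (intro conjI ballI allI impI)
    show "vzero ?B \<in> ?S"
      using subshift_algebra_zero subshift_algebra_bounded[OF subshift_algebra_zero[of \<AA> X]] by (simp add: T)
    show "x \<in> ?S" if "(\<forall>n. f n \<in> ?S) \<and> x \<in> carr ?B \<and> (\<lambda>n. vnorm ?B (vdiff ?B (f n) x)) \<longlonglongrightarrow> 0" for f x
      by (rule lim[of f x]) (use that in auto)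
    fix g h c assume g: "g \<in> ?S"
    show "vscale ?B c g \<in> ?S" "vstar ?B g \<in> ?S"
      using g bounded_functions_scale(1)[of g X c] bounded_functions_cnj[of g X]
        subshift_algebra_closed(1,2)[of "?T g" \<AA> X]
      unfolding bounded_functions_simps mem_Collect_eq T(5,6) by simp_all
    assume h: "h \<in> ?S"
    show "vadd ?B g h \<in> ?S" "vmult ?B g h \<in> ?S"
      using g h bounded_functions_add(1)[of g X h] bounded_functions_mult(1)[of g X h]
        subshift_algebra_closed(3,4)[of "?T g" \<AA> X "?T h"]
      unfolding bounded_functions_simps mem_Collect_eq T(2,3) by simp_all
  qed blast
  moreover have "indicator (cylinder2 X \<mu> \<nu>) \<in> ?S" if "\<mu> \<in> lists \<AA>" "\<nu> \<in> lists \<AA>" for \<mu> \<nu>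
  proof -
    have "?T (indicator (cylinder2 X \<mu> \<nu>)) \<in> ?D"
    proof (cases \<nu>)
      case Nil
      then show ?thesis
        using that a by (auto simp: letter_transfer_indicator_Nil[OF X]
          intro!: subshift_algebra_closed(4) subshift_algebra_generator)
    next
      case (Cons b \<nu>')
      then show ?thesis
        using that a by (auto simp: letter_transfer_indicator_Cons[OF X] subshift_algebra_zero
          intro!: subshift_algebra_closed(4) subshift_algebra_generator)
    qed
    then show ?thesis by (simp add: indicator_bounded_functions cylinder2_subset)
  qed
  ultimately have "?D \<subseteq> ?S"
    by (intro subshift_algebra_least) blast+
  then show ?thesis using f by auto
qed


lemma closed_ideal_letter_ideal:
  assumes X: "shift ` X \<subseteq> X" and a: "a \<in> \<AA>"
  shows "closed_ideal (subshift_algebra \<AA> X) (letter_ideal \<AA> X a)"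
  unfolding letter_ideal_def
proof (rule cstar_algebra.closed_ideal_generated[OF cstar_algebra_subshift_algebra])
  show "{indicator (shift ` cylinder X [a])} \<subseteq> carr (subshift_algebra \<AA> X)"
    using subshift_algebra_generator[of "[a]" \<AA> "[]" X] a
    by (simp add: shift_image_cylinder_eq_cylinder2[OF X])
qed

lemma letter_ideal_closed:
  assumes X: "shift ` X \<subseteq> X" and a: "a \<in> \<AA>"
  shows "f \<in> letter_ideal \<AA> X a \<Longrightarrow> f \<in> carr (subshift_algebra \<AA> X)"
    and "(\<lambda>x. 0) \<in> letter_ideal \<AA> X a"
    and "f \<in> letter_ideal \<AA> X a \<Longrightarrow> (\<lambda>x. c * f x) \<in> letter_ideal \<AA> X a"
    and "f \<in> letter_ideal \<AA> X a \<Longrightarrow> g \<in> letter_ideal \<AA> X a \<Longrightarrow> (\<lambda>x. f x + g x) \<in> letter_ideal \<AA> X a"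
    and "f \<in> letter_ideal \<AA> X a \<Longrightarrow> h \<in> carr (subshift_algebra \<AA> X) \<Longrightarrow> (\<lambda>x. f x * h x) \<in> letter_ideal \<AA> X a"
    and "f \<in> letter_ideal \<AA> X a \<Longrightarrow> h \<in> carr (subshift_algebra \<AA> X) \<Longrightarrow> (\<lambda>x. h x * f x) \<in> letter_ideal \<AA> X a"
proof -
  have I: "closed_ideal (subshift_algebra \<AA> X) (letter_ideal \<AA> X a)"
    by (rule closed_ideal_letter_ideal[OF X a])
  then have S: "closed_subspace (subshift_algebra \<AA> X) (letter_ideal \<AA> X a)"
    by (simp add: closed_ideal_def)
  note S = closed_subspace_closed[OF S, unfolded subshift_algebra_simps]
  show "f \<in> letter_ideal \<AA> X a \<Longrightarrow> f \<in> carr (subshift_algebra \<AA> X)" by (rule subsetD[OF S(1)])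
  show "(\<lambda>x. 0) \<in> letter_ideal \<AA> X a" by (rule S(2))
  show "f \<in> letter_ideal \<AA> X a \<Longrightarrow> (\<lambda>x. c * f x) \<in> letter_ideal \<AA> X a" by (rule S(3))
  show "f \<in> letter_ideal \<AA> X a \<Longrightarrow> g \<in> letter_ideal \<AA> X a \<Longrightarrow> (\<lambda>x. f x + g x) \<in> letter_ideal \<AA> X a"
    by (rule S(4))
  show "f \<in> letter_ideal \<AA> X a \<Longrightarrow> h \<in> carr (subshift_algebra \<AA> X) \<Longrightarrow> (\<lambda>x. f x * h x) \<in> letter_ideal \<AA> X a"
    "f \<in> letter_ideal \<AA> X a \<Longrightarrow> h \<in> carr (subshift_algebra \<AA> X) \<Longrightarrow> (\<lambda>x. h x * f x) \<in> letter_ideal \<AA> X a"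
    using I by (simp_all add: closed_ideal_def)
qed

lemma letter_ideal_limit:
  assumes X: "shift ` X \<subseteq> X" and a: "a \<in> \<AA>"
    and f: "\<And>n::nat. f n \<in> letter_ideal \<AA> X a" and g: "g \<in> carr (bounded_functions X)"
    and lim: "(\<lambda>n. vnorm (bounded_functions X) (\<lambda>x. f n x - g x)) \<longlonglongrightarrow> 0"
  shows "g \<in> letter_ideal \<AA> X a"
proof -
  have fD: "f n \<in> carr (subshift_algebra \<AA> X)" for n by (rule letter_ideal_closed(1)[OF X a f])
  have "closed_subspace (bounded_functions X) (carr (subshift_algebra \<AA> X))"
    using cstar_subalgebra_subshift_algebra[of X \<AA>] by (simp add: cstar_subalgebra_def)
  then have gD: "g \<in> carr (subshift_algebra \<AA> X)"
    by (rule closed_subspace_limit[where f=f]) (simp_all add: lim fD g)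
  have "closed_subspace (subshift_algebra \<AA> X) (letter_ideal \<AA> X a)"
    using closed_ideal_letter_ideal[OF X a] by (simp add: closed_ideal_def)
  then show ?thesis
    by (rule closed_subspace_limit[where f=f]) (simp_all add: lim f gD)
qed

lemma subshift_correspondence_simps [simp]:
  "vadd (subshift_correspondence \<AA> X) \<xi> \<eta> = (\<lambda>a x. \<xi> a x + \<eta> a x)"
  "vzero (subshift_correspondence \<AA> X) = (\<lambda>a x. 0)"
  "vscale (subshift_correspondence \<AA> X) c \<xi> = (\<lambda>a x. c * \<xi> a x)"
  "vdiff (subshift_correspondence \<AA> X) \<xi> \<eta> = (\<lambda>a x. \<xi> a x - \<eta> a x)"
  "ract (subshift_correspondence \<AA> X) \<xi> f = (\<lambda>a x. \<xi> a x * f x)"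
  "hinner (subshift_correspondence \<AA> X) \<xi> \<eta> = (\<lambda>x. \<Sum>a\<in>\<AA>. cnj (\<xi> a x) * \<eta> a x)"
  "lact (subshift_correspondence \<AA> X) f \<xi> = (\<lambda>a x. letter_transfer X a f x * \<xi> a x)"
  by (auto simp: subshift_correspondence_def vdiff_def)

lemma carr_subshift_correspondence:
  "\<xi> \<in> carr (subshift_correspondence \<AA> X) \<longleftrightarrow>
    (\<forall>a\<in>\<AA>. \<xi> a \<in> letter_ideal \<AA> X a) \<and> (\<forall>a. a \<notin> \<AA> \<longrightarrow> \<xi> a = (\<lambda>x. 0))"
  by (simp add: subshift_correspondence_def)

lemma complex_space_subshift_correspondence:
  assumes "shift ` X \<subseteq> X"
  shows "complex_space (subshift_correspondence \<AA> X)"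
  by unfold_locales
    (auto simp: carr_subshift_correspondence letter_ideal_closed(2,3,4)[OF assms] algebra_simps)

lemma subshift_inner_closed:
  assumes X: "shift ` X \<subseteq> X" and fin: "finite \<AA>"
    and "\<xi> \<in> carr (subshift_correspondence \<AA> X)" "\<eta> \<in> carr (subshift_correspondence \<AA> X)"
  shows "(\<lambda>x. \<Sum>a\<in>\<AA>. cnj (\<xi> a x) * \<eta> a x) \<in> carr (subshift_algebra \<AA> X)"
proof (rule subshift_algebra_sum[OF fin])
  fix a assume a: "a \<in> \<AA>"
  have "\<xi> a \<in> carr (subshift_algebra \<AA> X)" "\<eta> a \<in> carr (subshift_algebra \<AA> X)"
    using assms a by (simp_all add: carr_subshift_correspondence letter_ideal_closed(1)[OF X a])
  then show "(\<lambda>x. cnj (\<xi> a x) * \<eta> a x) \<in> carr (subshift_algebra \<AA> X)"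
    by (intro subshift_algebra_closed(4) subshift_algebra_closed(2))
qed

lemma subshift_inner_self:
  "(\<Sum>a\<in>\<AA>. cnj (\<xi> a x) * \<xi> a x) = of_real (\<Sum>a\<in>\<AA>. (cmod (\<xi> a x))\<^sup>2)"
  unfolding of_real_sum by (intro sum.cong refl) (metis complex_norm_square mult.commute)

lemma cmod_le_hnorm:
  assumes X: "shift ` X \<subseteq> X" and fin: "finite \<AA>" and \<xi>: "\<xi> \<in> carr (subshift_correspondence \<AA> X)"
  shows "cmod (\<xi> a x) \<le> hnorm (subshift_algebra \<AA> X) (subshift_correspondence \<AA> X) \<xi>"
proof (cases "a \<in> \<AA>")
  case True
  let ?N = "vnorm (bounded_functions X) (\<lambda>x. \<Sum>a\<in>\<AA>. cnj (\<xi> a x) * \<xi> a x)"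
  have "(cmod (\<xi> a x))\<^sup>2 \<le> (\<Sum>a\<in>\<AA>. (cmod (\<xi> a x))\<^sup>2)"
    by (rule member_le_sum[OF True _ fin]) simp
  also have "\<dots> = cmod (\<Sum>a\<in>\<AA>. cnj (\<xi> a x) * \<xi> a x)"
    unfolding subshift_inner_self norm_of_real by (simp add: sum_nonneg)
  also have "\<dots> \<le> ?N"
    by (rule cmod_le_vnorm[OF subshift_algebra_bounded[OF subshift_inner_closed[OF X fin \<xi> \<xi>]]])
  finally show ?thesis by (simp add: hnorm_def real_le_rsqrt)
next
  case False
  have "0 \<le> vnorm (bounded_functions X) (\<lambda>x. \<Sum>a\<in>\<AA>. cnj (\<xi> a x) * \<xi> a x)"
    by (rule vnorm_nonneg[OF subshift_algebra_bounded[OF subshift_inner_closed[OF X fin \<xi> \<xi>]]])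
  then show ?thesis using False \<xi> by (simp add: carr_subshift_correspondence hnorm_def)
qed

lemma norm_complete_subshift_correspondence:
  assumes X: "shift ` X \<subseteq> X" and fin: "finite \<AA>"
  shows "norm_complete (subshift_correspondence \<AA> X)
    (hnorm (subshift_algebra \<AA> X) (subshift_correspondence \<AA> X))"
  unfolding norm_complete_def
proof (intro allI impI, elim conjE)
  let ?H = "subshift_correspondence \<AA> X" and ?B = "bounded_functions X"
  let ?N = "hnorm (subshift_algebra \<AA> X) ?H"
  fix f :: "nat \<Rightarrow> 'a \<Rightarrow> (nat \<Rightarrow> 'a) \<Rightarrow> complex"
  assume f: "\<forall>n. f n \<in> carr ?H" and C: "\<forall>e>0. \<exists>k. \<forall>m\<ge>k. \<forall>n\<ge>k. ?N (vdiff ?H (f m) (f n)) < e"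
  interpret H: complex_space ?H by (rule complex_space_subshift_correspondence[OF X])
  have diffH: "vdiff ?H \<xi> \<eta> \<in> carr ?H" if "\<xi> \<in> carr ?H" "\<eta> \<in> carr ?H" for \<xi> \<eta>
    unfolding vdiff_def by (intro H.add_closed H.scale_closed that)
  have ideal: "f n a \<in> letter_ideal \<AA> X a" if "a \<in> \<AA>" for n a
    using f that by (simp add: carr_subshift_correspondence)
  have bdd: "f n a \<in> carr ?B" if "a \<in> \<AA>" for n a
    by (rule subshift_algebra_bounded[OF letter_ideal_closed(1)[OF X that ideal[OF that]]])
  have "\<forall>a\<in>\<AA>. \<exists>h. h \<in> carr ?B \<and> (\<lambda>n. vnorm ?B (\<lambda>x. f n a x - h x)) \<longlonglongrightarrow> 0"
  proof
    fix a assume a: "a \<in> \<AA>"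
    have "\<exists>k. \<forall>m\<ge>k. \<forall>n\<ge>k. vnorm ?B (vdiff ?B (f m a) (f n a)) < e" if "e > 0" for e
    proof -
      obtain k where k: "\<forall>m\<ge>k. \<forall>n\<ge>k. ?N (vdiff ?H (f m) (f n)) < e" using C \<open>e > 0\<close> by blast
      have "vnorm ?B (vdiff ?B (f m a) (f n a)) < e" if "m \<ge> k" "n \<ge> k" for m n
      proof (rule le_less_trans)
        show "vnorm ?B (vdiff ?B (f m a) (f n a)) \<le> ?N (vdiff ?H (f m) (f n))"
          using cmod_le_hnorm[OF X fin diffH[of "f m" "f n"], of a] f by (intro vnorm_le) simp
        show "?N (vdiff ?H (f m) (f n)) < e" using k that by blast
      qed
      then show ?thesis by blast
    qed
    then show "\<exists>h. h \<in> carr ?B \<and> (\<lambda>n. vnorm ?B (\<lambda>x. f n a x - h x)) \<longlonglongrightarrow> 0"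
      using norm_complete_bounded_functions[of X, unfolded norm_complete_def, rule_format, of "\<lambda>n. f n a"] bdd[OF a]
      by (simp add: Bex_def)
  qed
  from bchoice[OF this] obtain h where h: "\<And>a. a \<in> \<AA> \<Longrightarrow> h a \<in> carr ?B"
    "\<And>a. a \<in> \<AA> \<Longrightarrow> (\<lambda>n. vnorm ?B (\<lambda>x. f n a x - h a x)) \<longlonglongrightarrow> 0"
    by auto
  define g where "g a = (if a \<in> \<AA> then h a else (\<lambda>x. 0))" for a
  have gH: "g \<in> carr ?H"
    using letter_ideal_limit[OF X _ ideal h] by (simp add: carr_subshift_correspondence g_def)
  have dB: "(\<lambda>x. f n a x - h a x) \<in> carr ?B" if "a \<in> \<AA>" for n a
    using bounded_functions_add(1)[OF bdd[OF that] bounded_functions_scale(1)[OF h(1)[OF that], of "-1"]]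
    by simp
  have N: "?N (vdiff ?H (f n) g) \<le> sqrt (\<Sum>a\<in>\<AA>. (vnorm ?B (\<lambda>x. f n a x - h a x))\<^sup>2)" for n
  proof -
    have "vnorm ?B (\<lambda>x. \<Sum>a\<in>\<AA>. cnj (f n a x - g a x) * (f n a x - g a x))
        \<le> (\<Sum>a\<in>\<AA>. (vnorm ?B (\<lambda>x. f n a x - h a x))\<^sup>2)"
    proof (rule vnorm_le)
      fix x
      have "cmod (\<Sum>a\<in>\<AA>. cnj (f n a x - g a x) * (f n a x - g a x)) =
          (\<Sum>a\<in>\<AA>. (cmod (f n a x - g a x))\<^sup>2)"
        unfolding subshift_inner_self[of "\<lambda>a x. f n a x - g a x"] norm_of_real by (simp add: sum_nonneg)
      also have "\<dots> \<le> (\<Sum>a\<in>\<AA>. (vnorm ?B (\<lambda>x. f n a x - h a x))\<^sup>2)"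
      proof (intro sum_mono power_mono norm_ge_zero)
        fix a assume "a \<in> \<AA>"
        then show "cmod (f n a x - g a x) \<le> vnorm ?B (\<lambda>x. f n a x - h a x)"
          using cmod_le_vnorm[OF dB, of a n x] by (simp add: g_def)
      qed
      finally show "cmod (\<Sum>a\<in>\<AA>. cnj (f n a x - g a x) * (f n a x - g a x))
        \<le> (\<Sum>a\<in>\<AA>. (vnorm ?B (\<lambda>x. f n a x - h a x))\<^sup>2)" .
    qed
    then show ?thesis by (simp add: hnorm_def)
  qed
  have "(\<lambda>n. sqrt (\<Sum>a\<in>\<AA>. (vnorm ?B (\<lambda>x. f n a x - h a x))\<^sup>2)) \<longlonglongrightarrow> sqrt (\<Sum>a\<in>\<AA>. 0\<^sup>2)"
    by (intro tendsto_real_sqrt tendsto_sum tendsto_power h)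
  then have lim: "(\<lambda>n. sqrt (\<Sum>a\<in>\<AA>. (vnorm ?B (\<lambda>x. f n a x - h a x))\<^sup>2)) \<longlonglongrightarrow> 0" by simp
  have "(\<lambda>n. ?N (vdiff ?H (f n) g)) \<longlonglongrightarrow> 0"
  proof (rule tendsto_sandwich[OF _ _ tendsto_const lim])
    have "0 \<le> ?N (vdiff ?H (f n) g)" for n
      by (rule order.trans[OF norm_ge_zero cmod_le_hnorm[OF X fin diffH]]) (use f gH in auto)
    then show "\<forall>\<^sub>F n in sequentially. 0 \<le> ?N (vdiff ?H (f n) g)" by simp
    show "\<forall>\<^sub>F n in sequentially. ?N (vdiff ?H (f n) g)
        \<le> sqrt (\<Sum>a\<in>\<AA>. (vnorm ?B (\<lambda>x. f n a x - h a x))\<^sup>2)"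
      by (rule always_eventually) (intro allI N)
  qed
  then show "\<exists>\<xi>\<in>carr ?H. (\<lambda>n. ?N (vdiff ?H (f n) \<xi>)) \<longlonglongrightarrow> 0" using gH by blast
qed

lemma hilbert_module_subshift_correspondence:
  assumes X: "shift ` X \<subseteq> X" and fin: "finite \<AA>"
  shows "hilbert_module (subshift_algebra \<AA> X) (subshift_correspondence \<AA> X)"
proof (intro hilbert_module.intro hilbert_module_axioms.intro)
  let ?D = "subshift_algebra \<AA> X" and ?H = "subshift_correspondence \<AA> X"
  show "cstar_algebra ?D" by (rule cstar_algebra_subshift_algebra)
  show "complex_space ?H" by (rule complex_space_subshift_correspondence[OF X])
  show "norm_complete ?H (hnorm ?D ?H)" by (rule norm_complete_subshift_correspondence[OF X fin])
  fix \<xi> \<eta> \<zeta> a b and c :: complex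
  assume \<xi>: "\<xi> \<in> carr ?H"
  show "positive ?D (hinner ?H \<xi> \<xi>)"
    unfolding positive_def
  proof (rule bexI)
    let ?r = "\<lambda>x. \<Sum>a\<in>\<AA>. (cmod (\<xi> a x))\<^sup>2"
    have "(\<lambda>x. of_real (?r x)) \<in> carr ?D"
      using subshift_inner_closed[OF X fin \<xi> \<xi>] unfolding subshift_inner_self .
    then show "(\<lambda>x. of_real (sqrt (?r x))) \<in> carr ?D"
      by (rule subshift_algebra_sqrt) (simp add: sum_nonneg)
    have "sqrt (?r x) * sqrt (?r x) = ?r x" for x
      by (simp add: sum_nonneg)
    then have "complex_of_real (sqrt (?r x)) * of_real (sqrt (?r x)) = of_real (?r x)" for x
      by (metis of_real_mult)
    then show "hinner ?H \<xi> \<xi> = vmult ?D (vstar ?D (\<lambda>x. of_real (sqrt (?r x)))) (\<lambda>x. of_real (sqrt (?r x)))"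
      unfolding subshift_correspondence_simps subshift_algebra_simps subshift_inner_self complex_cnj_complex_of_real
      by simp
  qed
  show "\<xi> = vzero ?H" if "hinner ?H \<xi> \<xi> = vzero ?D"
  proof -
    have "(\<Sum>a\<in>\<AA>. (cmod (\<xi> a x))\<^sup>2) = 0" for x
      using fun_cong[OF that[simplified subshift_correspondence_simps subshift_algebra_simps subshift_inner_self], of x]
      by (simp only: of_real_eq_0_iff)
    then have "\<xi> a x = 0" if "a \<in> \<AA>" for a x
      using that fin by (simp add: sum_nonneg_eq_0_iff)
    then have "\<xi> a x = 0" for a x
      using \<xi> by (cases "a \<in> \<AA>") (auto simp: carr_subshift_correspondence)
    then show ?thesis by (simp add: fun_eq_iff)
  qed
  show "ract ?H \<xi> a \<in> carr ?H" if "a \<in> carr ?D"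
    using \<xi> that by (auto simp: carr_subshift_correspondence letter_ideal_closed(5)[OF X])
  show "ract ?H \<xi> (a \<oplus>\<^bsub>?D\<^esub> b) = ract ?H \<xi> a \<oplus>\<^bsub>?H\<^esub> ract ?H \<xi> b"
    "ract ?H \<xi> (a \<otimes>\<^bsub>?D\<^esub> b) = ract ?H (ract ?H \<xi> a) b"
    "ract ?H (c \<odot>\<^bsub>?H\<^esub> \<xi>) a = c \<odot>\<^bsub>?H\<^esub> ract ?H \<xi> a"
    "ract ?H \<xi> (c \<odot>\<^bsub>?D\<^esub> a) = c \<odot>\<^bsub>?H\<^esub> ract ?H \<xi> a"
    "ract ?H (\<xi> \<oplus>\<^bsub>?H\<^esub> \<eta>) a = ract ?H \<xi> a \<oplus>\<^bsub>?H\<^esub> ract ?H \<eta> a"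
    by (simp_all add: fun_eq_iff algebra_simps)
  show "hinner ?H \<xi> (\<eta> \<oplus>\<^bsub>?H\<^esub> \<zeta>) = hinner ?H \<xi> \<eta> \<oplus>\<^bsub>?D\<^esub> hinner ?H \<xi> \<zeta>"
    "hinner ?H \<xi> (c \<odot>\<^bsub>?H\<^esub> \<eta>) = c \<odot>\<^bsub>?D\<^esub> hinner ?H \<xi> \<eta>"
    "hinner ?H \<xi> (ract ?H \<eta> a) = hinner ?H \<xi> \<eta> \<otimes>\<^bsub>?D\<^esub> a"
    by (simp_all add: fun_eq_iff algebra_simps sum.distrib sum_distrib_left)
  show "vstar ?D (hinner ?H \<xi> \<eta>) = hinner ?H \<eta> \<xi>"
    by (simp add: fun_eq_iff mult.commute)
  show "hinner ?H \<xi> \<eta> \<in> carr ?D" if "\<eta> \<in> carr ?H"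
    using subshift_inner_closed[OF X fin \<xi> that] by simp
qed

lemma (in complex_space) eq_if_diff_eq_zero:
  assumes "x \<in> carr V" "y \<in> carr V" "vdiff V x y = \<zero>"
  shows "x = y"
proof -
  have "x = x \<oplus> (- 1 \<odot> y \<oplus> y)"
    using assms(1,2) by (simp add: add_zero add_minus add_commute[OF scale_closed])
  also have "\<dots> = vdiff V x y \<oplus> y"
    using assms(1,2) by (simp add: vdiff_def add_assoc scale_closed)
  also have "\<dots> = y"
    using assms by (simp add: add_commute[of \<zero>] zero_closed add_zero)
  finally show ?thesis .
qed

lemma (in hilbert_module) adjoint_unique:
  assumes S: "is_adjoint H T S" and S': "is_adjoint H T S'"
  shows "S = S'"
proof
  fix \<eta>
  show "S \<eta> = S' \<eta>"
  proof (cases "\<eta> \<in> carr H")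
    case False
    then show ?thesis using S S' unfolding is_adjoint_def by (metis PiE_arb)
  next
    case True
    have c: "S \<eta> \<in> carr H" "S' \<eta> \<in> carr H" using S S' True unfolding is_adjoint_def by auto
    let ?d = "vdiff H (S \<eta>) (S' \<eta>)"
    have d: "?d \<in> carr H" unfolding vdiff_def using c by (intro H.add_closed H.scale_closed)
    have "hinner H ?d (S \<eta>) = hinner H ?d (S' \<eta>)"
      using S S' True d unfolding is_adjoint_def by metis
    moreover have "hinner H ?d ?d = hinner H ?d (S \<eta>) \<oplus>\<^bsub>A\<^esub> (- 1) \<odot>\<^bsub>A\<^esub> hinner H ?d (S' \<eta>)"
      by (subst (2) vdiff_def) (simp add: inner_add inner_scale c d H.scale_closed)
    ultimately have "hinner H ?d ?d = \<zero>\<^bsub>A\<^esub>"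
      by (simp add: add_minus inner_closed c d)
    then show ?thesis using inner_eq_zero[OF d] H.eq_if_diff_eq_zero c by blast
  qed
qed

lemma (in hilbert_module) star_eq_adjoint:
  "is_adjoint H T S \<Longrightarrow> vstar (adjointable_operators A H) T = S"
  by (auto simp: adjointable_operators_def intro: the_equality adjoint_unique)

lemma is_adjoint_left_action:
  assumes X: "shift ` X \<subseteq> X" and fin: "finite \<AA>" and f: "f \<in> carr (subshift_algebra \<AA> X)"
  shows "is_adjoint (subshift_correspondence \<AA> X) (left_action (subshift_correspondence \<AA> X) f)
    (left_action (subshift_correspondence \<AA> X) (\<lambda>x. cnj (f x)))"
proof -
  let ?H = "subshift_correspondence \<AA> X"
  have closed: "lact ?H g \<xi> \<in> carr ?H" if "g \<in> carr (subshift_algebra \<AA> X)" "\<xi> \<in> carr ?H" for g \<xi>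
    using that by (auto simp: carr_subshift_correspondence
        intro: letter_ideal_closed(6)[OF X] letter_transfer_algebra[OF X])
  have "cnj (letter_transfer X a f x * u) * v = cnj u * (letter_transfer X a (\<lambda>x. cnj (f x)) x * v)" for a x u v
    by (simp add: letter_transfer_def)
  then have "hinner ?H (lact ?H f \<xi>) \<eta> = hinner ?H \<xi> (lact ?H (\<lambda>x. cnj (f x)) \<eta>)" for \<xi> \<eta>
    unfolding subshift_correspondence_simps by (intro ext sum.cong refl)
  then show ?thesis
    using closed[OF f] closed[OF subshift_algebra_closed(2)[OF f]]
    unfolding is_adjoint_def left_action_def by (auto simp del: subshift_correspondence_simps)
qed

theorem cstar_correspondence_subshift:
  assumes "subshift \<AA> X"
  shows "cstar_correspondence (subshift_algebra \<AA> X) (subshift_correspondence \<AA> X)"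
proof (rule cstar_correspondence.intro)
  let ?D = "subshift_algebra \<AA> X" and ?H = "subshift_correspondence \<AA> X"
  let ?L = "adjointable_operators ?D ?H" and ?\<phi> = "left_action (subshift_correspondence \<AA> X)"
  have X: "shift ` X \<subseteq> X" and fin: "finite \<AA>" using assms by (auto simp: subshift_def)
  show "hilbert_module ?D ?H" by (rule hilbert_module_subshift_correspondence[OF X fin])
  then interpret hilbert_module ?D ?H .
  have adj: "is_adjoint ?H (?\<phi> f) (?\<phi> (vstar ?D f))" if "f \<in> carr ?D" for f
    using is_adjoint_left_action[OF X fin that] by simp
  have act: "lact ?H f \<xi> \<in> carr ?H" if "f \<in> carr ?D" "\<xi> \<in> carr ?H" for f \<xi>
  proof -
    have "?\<phi> f \<in> carr ?H \<rightarrow>\<^sub>E carr ?H" using adj[OF that(1)] by (simp only: is_adjoint_def)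
    from PiE_mem[OF this that(2)] show ?thesis using that(2) by (simp add: left_action_def)
  qed
  show "cstar_correspondence_axioms ?D ?H"
  proof (unfold cstar_correspondence_axioms_def star_hom_def linear_map_def, intro conjI ballI allI)
    fix f g and c :: complex assume f: "f \<in> carr ?D"
    show "?\<phi> f \<in> carr ?L" using adj[OF f] by (auto simp: adjointable_operators_def)
    show "?\<phi> (vstar ?D f) = vstar ?L (?\<phi> f)" using star_eq_adjoint[OF adj[OF f]] by simp
    show "?\<phi> (c \<odot>\<^bsub>?D\<^esub> f) = c \<odot>\<^bsub>?L\<^esub> ?\<phi> f"
    proof
      fix \<xi>
      show "?\<phi> (c \<odot>\<^bsub>?D\<^esub> f) \<xi> = (c \<odot>\<^bsub>?L\<^esub> ?\<phi> f) \<xi>"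
        by (simp add: adjointable_operators_def left_action_def letter_transfer_def fun_eq_iff)
    qed
    assume g: "g \<in> carr ?D"
    show "?\<phi> (f \<oplus>\<^bsub>?D\<^esub> g) = ?\<phi> f \<oplus>\<^bsub>?L\<^esub> ?\<phi> g"
    proof
      fix \<xi>
      show "?\<phi> (f \<oplus>\<^bsub>?D\<^esub> g) \<xi> = (?\<phi> f \<oplus>\<^bsub>?L\<^esub> ?\<phi> g) \<xi>"
        by (simp add: adjointable_operators_def left_action_def letter_transfer_def fun_eq_iff distrib_right)
    qed
    show "?\<phi> (f \<otimes>\<^bsub>?D\<^esub> g) = ?\<phi> f \<otimes>\<^bsub>?L\<^esub> ?\<phi> g"
    proof
      fix \<xi>
      show "?\<phi> (f \<otimes>\<^bsub>?D\<^esub> g) \<xi> = (?\<phi> f \<otimes>\<^bsub>?L\<^esub> ?\<phi> g) \<xi>"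
      proof (cases "\<xi> \<in> carr ?H")
        case True
        then show ?thesis using act[OF g True]
          by (simp add: adjointable_operators_def left_action_def letter_transfer_def fun_eq_iff)
      qed (simp add: adjointable_operators_def left_action_def)
    qed
  qed
qed

end

theory Submission
  imports Defs
begin

text \<open>
  A family \<open>\<xi>\<close> in $\mathsf H_X$ is the same as the function \<open>ax \<mapsto> \<xi>\<^sub>a(x)\<close> on \<open>X\<close>, and this
  identifies $\mathsf H_X$ with $\widetilde{\mathcal D}_X$, where \<open>f\<close> acts on the left by multiplication
  and on the right by multiplication with \<open>f \<circ> \<sigma>\<close>, and the inner product sums over the preimages
  under \<open>\<sigma>\<close>.  So the correspondence is determined by $\sigma_X$ and the algebra of functions
  $\widetilde{\mathcal D}_X$, and the latter does not depend on the presentation of \<open>X\<close> either: it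
  contains the indicators of the sets \<open>\<sigma>\<^sup>-\<^sup>n(\<sigma>\<^sup>m(S))\<close> with \<open>S\<close> clopen, because clopen sets are finite
  unions of cylinders.  A conjugacy therefore induces an isomorphism of correspondences, and the
  universal property turns it into an isomorphism of the Cuntz-Pimsner algebras.  That the two
  homomorphisms obtained are mutually inverse and equivariant is checked on generators, which
  suffices because $*$-homomorphisms are continuous.
\<close>

section \<open>Continuity of $*$-homomorphisms\<close>

context complex_space
begin

lemma add_left_commute:
  "\<lbrakk>x \<in> carr V; y \<in> carr V; z \<in> carr V\<rbrakk> \<Longrightarrow> x \<oplus> (y \<oplus> z) = y \<oplus> (x \<oplus> z)"
  by (metis add_assoc add_commute)

lemma add_zero_left: "x \<in> carr V \<Longrightarrow> \<zero> \<oplus> x = x"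
  by (simp add: add_commute[of \<zero>] zero_closed add_zero)

lemma scale_zero_left: "x \<in> carr V \<Longrightarrow> 0 \<odot> x = \<zero>"
  using scale_add_left[of x 1 "-1"] by (simp add: scale_one add_minus)

lemma scale_zero_right: "c \<odot> \<zero> = \<zero>"
  using scale_scale[OF zero_closed, of c 0] scale_zero_left[OF zero_closed] by simp

text \<open>The tail \<open>y\<close> lets opposite multiples cancel at the head of a right-nested
  sum, and \<open>c + d = 0\<close> also matches pairs of numerals such as \<open>-2\<close> and
  \<open>2\<close>.\<close>

lemma scale_cancel:
  "\<lbrakk>x \<in> carr V; y \<in> carr V; c + d = 0\<rbrakk> \<Longrightarrow> c \<odot> x \<oplus> (d \<odot> x \<oplus> y) = y"
  by (metis add_assoc scale_add_left scale_closed scale_zero_left add_zero_left)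

lemma vdiff_closed: "\<lbrakk>x \<in> carr V; y \<in> carr V\<rbrakk> \<Longrightarrow> vdiff V x y \<in> carr V"
  by (simp add: vdiff_def add_closed scale_closed)

lemma vdiff_trans:
  assumes "x \<in> carr V" "y \<in> carr V" "z \<in> carr V"
  shows "vdiff V x z = vdiff V x y \<oplus> vdiff V y z"
proof -
  have "-1 \<odot> y \<oplus> (y \<oplus> -1 \<odot> z) = -1 \<odot> z"
    using scale_cancel[of y "-1 \<odot> z" "-1" 1] assms by (simp add: scale_one scale_closed)
  then show ?thesis using assms by (simp add: vdiff_def add_assoc scale_closed add_closed)
qed

lemma vdiff_commute: "\<lbrakk>x \<in> carr V; y \<in> carr V\<rbrakk> \<Longrightarrow> vdiff V y x = -1 \<odot> vdiff V x y"
  by (simp add: vdiff_def add_commute scale_add_right scale_scale scale_one scale_closed)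

lemma vdiff_self: "x \<in> carr V \<Longrightarrow> vdiff V x x = \<zero>"
  by (simp add: vdiff_def add_minus)

lemma scale_vdiff:
  "\<lbrakk>x \<in> carr V; y \<in> carr V\<rbrakk> \<Longrightarrow> c \<odot> vdiff V x y = vdiff V (c \<odot> x) (c \<odot> y)"
  by (simp add: vdiff_def scale_add_right scale_closed scale_scale mult.commute)

lemma add_vdiff_add:
  assumes "x \<in> carr V" "y \<in> carr V" "z \<in> carr V"
  shows "vdiff V (z \<oplus> x) (z \<oplus> y) = vdiff V x y"
proof -
  have "vdiff V (z \<oplus> x) (z \<oplus> y) = z \<oplus> (x \<oplus> (-1 \<odot> z \<oplus> -1 \<odot> y))"
    using assms by (simp add: vdiff_def add_assoc scale_closed add_closed scale_add_right)
  also have "\<dots> = 1 \<odot> z \<oplus> (-1 \<odot> z \<oplus> (x \<oplus> -1 \<odot> y))"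
    using assms by (simp add: add_left_commute scale_closed add_closed scale_one)
  also have "\<dots> = vdiff V x y"
    unfolding vdiff_def using assms by (intro scale_cancel) (simp_all add: scale_closed add_closed)
  finally show ?thesis .
qed

end

section \<open>Norm estimates and a square root without spectral theory\<close>

context cstar_algebra
begin

lemma norm_zero: "vnorm A \<zero> = 0"
  using norm_scale[OF zero_closed, of 0] by (simp add: scale_zero_right)

lemma norm_vdiff_commute: "\<lbrakk>x \<in> carr A; y \<in> carr A\<rbrakk> \<Longrightarrow> vnorm A (vdiff A y x) = vnorm A (vdiff A x y)"
  by (subst vdiff_commute) (simp_all add: norm_scale vdiff_closed)

lemma norm_vdiff_trans:
  "\<lbrakk>x \<in> carr A; y \<in> carr A; z \<in> carr A\<rbrakk> \<Longrightarrow>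
    vnorm A (vdiff A x z) \<le> vnorm A (vdiff A x y) + vnorm A (vdiff A y z)"
  by (subst vdiff_trans[of x y z]) (simp_all add: norm_triangle vdiff_closed)

lemma norm_vdiff_eq_zero: "\<lbrakk>x \<in> carr A; y \<in> carr A; vnorm A (vdiff A x y) = 0\<rbrakk> \<Longrightarrow> x = y"
  using norm_eq_zero[OF vdiff_closed] eq_if_diff_eq_zero by blast

lemma mult_vdiff_mult:
  assumes c: "x \<in> carr A" "y \<in> carr A" "u \<in> carr A" "v \<in> carr A"
  shows "vdiff A (x \<otimes> u) (y \<otimes> v) = x \<otimes> vdiff A u v \<oplus> vdiff A x y \<otimes> v"
proof -
  have "x \<otimes> vdiff A u v = vdiff A (x \<otimes> u) (x \<otimes> v)" "vdiff A x y \<otimes> v = vdiff A (x \<otimes> v) (y \<otimes> v)"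
    using c by (simp_all add: vdiff_def mult_add_right mult_add_left mult_scale_right mult_scale_left scale_closed)
  then show ?thesis using c by (subst vdiff_trans[of _ "x \<otimes> v"]) (simp_all add: mult_closed)
qed

text \<open>The C*-identity and submultiplicativity bound the square of the norm of \<open>y\<close>
  by the product of the norms of \<open>vstar A y\<close> and \<open>y\<close>. Cancelling gives one
  inequality; replacing \<open>y\<close> by its adjoint gives the other.\<close>

lemma norm_star_eq: "x \<in> carr A \<Longrightarrow> vnorm A (vstar A x) = vnorm A x"
proof -
  have le: "vnorm A y \<le> vnorm A (vstar A y)" if y: "y \<in> carr A" for y
  proof (cases "vnorm A y = 0")
    case False
    have "vnorm A y * vnorm A y \<le> vnorm A (vstar A y) * vnorm A y"
      using norm_star[OF y] norm_mult[OF star_closed[OF y] y] by (simp add: power2_eq_square)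
    then show ?thesis using False norm_nonneg[OF y] by simp
  qed (simp add: norm_nonneg star_closed y)
  assume "x \<in> carr A"
  then show ?thesis using le[of x] le[of "vstar A x"] by (simp add: star_closed star_star)
qed

text \<open>Squaring does not expand distances on the ball of radius 1/2, because xx - yy = x(x - y)
  + (x - y)y. The factor 1/2 in the map \<open>F\<close> of the next lemma then yields a
  contraction.\<close>

lemma norm_square_vdiff_le:
  assumes "x \<in> carr A" "y \<in> carr A" "vnorm A x \<le> 1/2" "vnorm A y \<le> 1/2"
  shows "vnorm A (vdiff A (x \<otimes> x) (y \<otimes> y)) \<le> vnorm A (vdiff A x y)"
proof -
  let ?e = "vdiff A x y"
  have e: "?e \<in> carr A" using assms by (simp add: vdiff_closed)
  have "vnorm A (vdiff A (x \<otimes> x) (y \<otimes> y)) \<le> vnorm A (x \<otimes> ?e) + vnorm A (?e \<otimes> y)"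
    using assms e by (simp add: mult_vdiff_mult norm_triangle mult_closed)
  also have "\<dots> \<le> vnorm A x * vnorm A ?e + vnorm A ?e * vnorm A y"
    by (intro add_mono norm_mult assms e)
  also have "\<dots> \<le> 1/2 * vnorm A ?e + vnorm A ?e * (1/2)"
    by (intro add_mono mult_right_mono mult_left_mono assms norm_nonneg e)
  finally show ?thesis by simp
qed

text \<open>The element \<open>d\<close> is \<open>1 - sqrt (1 - h\<^sup>2)\<close>, which makes sense without a unit.\<close>

lemma exists_sqrt_complement:
  assumes h: "h \<in> carr A" "vnorm A h \<le> 1/2" and self: "vstar A h = h"
  obtains d where "d \<in> carr A" "vstar A d = d" "d \<otimes> h = h \<otimes> d" "h \<otimes> h \<oplus> d \<otimes> d = 2 \<odot> d"
proof -
  \<comment> \<open>The equation to be solved reads \<open>F d = d\<close>. Banach's fixed point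
    theorem is applied on the closed ball \<open>M\<close>, whose radius keeps squaring
    nonexpansive.\<close>
  define M where "M = {d \<in> carr A. vnorm A d \<le> 1/2}"
  \<comment> \<open>\<open>Metric_space\<close> asks for nonnegativity and symmetry at all points of
    the type, hence the default value 0 off the carrier.\<close>
  define dist where "dist x y = (if x \<in> carr A \<and> y \<in> carr A then vnorm A (vdiff A x y) else 0)" for x y
  define F where "F d = (1/2) \<odot> (h \<otimes> h \<oplus> d \<otimes> d)" for d
  have MA: "x \<in> carr A" if "x \<in> M" for x using that by (simp add: M_def)
  have F: "F d \<in> carr A" if "d \<in> carr A" for d
    using that h by (simp add: F_def scale_closed add_closed mult_closed)
  have Fdist: "vnorm A (vdiff A (F x) (F y)) \<le> 1/2 * vnorm A (vdiff A x y)" if "x \<in> M" "y \<in> M" for x y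
  proof -
    have "vdiff A (F x) (F y) = (1/2) \<odot> vdiff A (x \<otimes> x) (y \<otimes> y)"
      using that h by (simp add: MA F_def add_closed mult_closed add_vdiff_add flip: scale_vdiff)
    moreover have "vnorm A (vdiff A (x \<otimes> x) (y \<otimes> y)) \<le> vnorm A (vdiff A x y)"
      using that by (intro norm_square_vdiff_le) (simp_all add: M_def)
    ultimately show ?thesis
      using that by (simp add: MA norm_scale vdiff_closed mult_closed)
  qed
  interpret Met: Metric_space M dist
  proof
    show "0 \<le> dist x y" for x y by (simp add: dist_def norm_nonneg vdiff_closed)
    show "dist x y = dist y x" for x y by (simp add: dist_def norm_vdiff_commute)
    show "dist x y = 0 \<longleftrightarrow> x = y" if "x \<in> M" "y \<in> M" for x y
      using that by (auto simp: MA dist_def norm_vdiff_eq_zero vdiff_self norm_zero)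
    show "dist x z \<le> dist x y + dist y z" if "x \<in> M" "y \<in> M" "z \<in> M" for x y z
      using that by (simp add: MA dist_def norm_vdiff_trans)
  qed
  have "Met.mcomplete"
    unfolding Met.mcomplete_def
  proof (intro allI impI)
    fix s assume s: "Met.MCauchy s"
    then have sM: "s n \<in> M" for n by (auto simp: Met.MCauchy_def)
    have "\<forall>e>0. \<exists>k. \<forall>m\<ge>k. \<forall>n\<ge>k. vnorm A (vdiff A (s m) (s n)) < e"
      using s MA[OF sM] by (auto simp: Met.MCauchy_def dist_def)
    then obtain x where x: "x \<in> carr A" and lim: "(\<lambda>n. vnorm A (vdiff A (s n) x)) \<longlonglongrightarrow> 0"
      using complete MA[OF sM] unfolding norm_complete_def by blast
    have "vnorm A x \<le> 1/2 + vnorm A (vdiff A (s n) x)" for n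
    proof -
      have "vdiff A x \<zero> = x" "vdiff A (s n) \<zero> = s n"
        using x MA[OF sM] by (simp_all add: vdiff_def scale_zero_right add_zero)
      then have "vnorm A x \<le> vnorm A (vdiff A x (s n)) + vnorm A (s n)"
        using norm_vdiff_trans[OF x MA[OF sM, of n] zero_closed] by simp
      then show ?thesis using sM[of n] norm_vdiff_commute[OF x MA[OF sM, of n]] by (simp add: M_def)
    qed
    moreover have "(\<lambda>n. 1/2 + vnorm A (vdiff A (s n) x)) \<longlonglongrightarrow> 1/2 + 0"
      by (intro tendsto_intros lim)
    ultimately have "vnorm A x \<le> 1/2"
      by (intro LIMSEQ_le_const[where X="\<lambda>n. 1/2 + vnorm A (vdiff A (s n) x)"]) auto
    then have xM: "x \<in> M" using x by (simp add: M_def)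
    have "(\<lambda>n. dist (s n) x) \<longlonglongrightarrow> 0" using lim x MA[OF sM] by (simp add: dist_def)
    then have "limitin Met.mtopology s x sequentially"
      unfolding Met.limitin_metric_dist_null using xM sM by simp
    then show "\<exists>x. limitin Met.mtopology s x sequentially" by blast
  qed
  moreover have "M \<noteq> {}" using zero_closed norm_zero by (auto simp: M_def intro!: exI[of _ \<zero>])
  moreover have "F \<in> M \<rightarrow> M"
  proof
    fix d assume d: "d \<in> M"
    have "vnorm A (h \<otimes> h \<oplus> d \<otimes> d) \<le> vnorm A h * vnorm A h + vnorm A d * vnorm A d"
      using h MA[OF d] by (intro order.trans[OF norm_triangle] add_mono norm_mult mult_closed)
    also have "\<dots> \<le> 1/2 * (1/2) + 1/2 * (1/2)"
      using h d by (intro add_mono mult_mono) (auto simp: M_def norm_nonneg)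
    finally show "F d \<in> M"
      using F[OF MA[OF d]] h MA[OF d] by (simp add: M_def F_def norm_scale add_closed mult_closed)
  qed
  moreover have "1/2 < (1::real)" by simp
  moreover have "dist (F x) (F y) \<le> 1/2 * dist x y" if "x \<in> M" "y \<in> M" for x y
    using Fdist[OF that] that by (simp add: dist_def MA F)
  ultimately obtain d where d: "d \<in> M" and Fd: "F d = d"
    by (rule Met.Banach_fixedpoint_thm[of F "1/2"])
  note dA = MA[OF d]
  have eq: "h \<otimes> h \<oplus> d \<otimes> d = 2 \<odot> d"
  proof -
    have "2 \<odot> d = 2 \<odot> F d" by (simp add: Fd)
    then show ?thesis using h dA by (simp add: F_def scale_scale scale_one add_closed mult_closed)
  qed
  \<comment> \<open>As \<open>h\<close> is self-adjoint, \<open>F\<close> commutes with the adjoint,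
    so \<open>vstar A d\<close> is a fixed point in \<open>M\<close> too and the contraction
    estimate identifies it with \<open>d\<close>.\<close>
  have "vstar A d = d"
  proof -
    have s: "vstar A d \<in> M" using d by (simp add: M_def star_closed norm_star_eq)
    have "vstar A (F d) = F (vstar A d)"
      using h dA self by (simp add: F_def star_scale star_add star_mult mult_closed add_closed)
    then have "F (vstar A d) = vstar A d" by (simp add: Fd)
    then have "vnorm A (vdiff A (vstar A d) d) \<le> 1/2 * vnorm A (vdiff A (vstar A d) d)"
      using Fdist[OF s d] by (simp add: Fd)
    then have "vnorm A (vdiff A (vstar A d) d) = 0"
      using norm_nonneg[OF vdiff_closed[OF star_closed[OF dA] dA]] by linarith
    then show ?thesis by (rule norm_vdiff_eq_zero[OF star_closed[OF dA] dA])
  qed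
  \<comment> \<open>The commutator e of \<open>d\<close> and \<open>h\<close> satisfies 2e = de + ed
    by the fixed point equation. Since \<open>d\<close> has norm at most 1/2, twice the norm of e is
    at most the norm of e.\<close>
  moreover have "d \<otimes> h = h \<otimes> d"
  proof -
    let ?e = "vdiff A (d \<otimes> h) (h \<otimes> d)"
    have e: "?e \<in> carr A" using h dA by (simp add: vdiff_closed mult_closed)
    have "2 \<odot> ?e = vdiff A ((2 \<odot> d) \<otimes> h) (h \<otimes> (2 \<odot> d))"
      using h dA by (simp add: scale_vdiff mult_closed mult_scale_left mult_scale_right)
    also have "\<dots> = vdiff A ((h \<otimes> h \<oplus> d \<otimes> d) \<otimes> h) (h \<otimes> (h \<otimes> h \<oplus> d \<otimes> d))"
      by (simp add: eq)
    also have "\<dots> = vdiff A (d \<otimes> (d \<otimes> h)) ((h \<otimes> d) \<otimes> d)"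
      using h dA by (simp add: mult_add_left mult_add_right mult_assoc mult_closed add_vdiff_add)
    also have "\<dots> = d \<otimes> ?e \<oplus> ?e \<otimes> d"
    proof -
      have "d \<otimes> ?e = vdiff A (d \<otimes> (d \<otimes> h)) (d \<otimes> (h \<otimes> d))"
        "?e \<otimes> d = vdiff A (d \<otimes> (h \<otimes> d)) ((h \<otimes> d) \<otimes> d)"
        using h dA by (simp_all add: vdiff_def mult_add_right mult_add_left mult_scale_right mult_scale_left
            scale_closed mult_closed mult_assoc)
      then show ?thesis using h dA
        by (subst vdiff_trans[of _ "d \<otimes> (h \<otimes> d)"]) (simp_all add: mult_closed)
    qed
    finally have "2 * vnorm A ?e = vnorm A (d \<otimes> ?e \<oplus> ?e \<otimes> d)"
      using norm_scale[OF e, of 2] by simp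
    also have "\<dots> \<le> vnorm A d * vnorm A ?e + vnorm A ?e * vnorm A d"
      using e dA by (intro order.trans[OF norm_triangle] add_mono norm_mult mult_closed)
    also have "\<dots> \<le> 1/2 * vnorm A ?e + vnorm A ?e * (1/2)"
      using d by (intro add_mono mult_left_mono mult_right_mono norm_nonneg e) (auto simp: M_def)
    finally have "vnorm A ?e = 0" using norm_nonneg[OF e] by simp
    then show ?thesis using h dA by (intro norm_vdiff_eq_zero) (simp_all add: mult_closed)
  qed
  ultimately show ?thesis using that dA eq by blast
qed

text \<open>Since \<open>p\<^sup>*q\<close> is self-adjoint, \<open>p + iq\<close> and \<open>p - iq\<close> both have squared norm
  \<open>\<parallel>p\<^sup>*p + q\<^sup>*q\<parallel>\<close>, and \<open>p\<close> is their mean.\<close>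

lemma norm_le_norm_sum_squares:
  assumes c: "p \<in> carr A" "q \<in> carr A"
    and comm: "vstar A p \<otimes> q = vstar A q \<otimes> p"
  shows "(vnorm A p)\<^sup>2 \<le> vnorm A (vstar A p \<otimes> p \<oplus> vstar A q \<otimes> q)"
proof -
  let ?S = "vstar A p \<otimes> p \<oplus> vstar A q \<otimes> q"
  have SA: "?S \<in> carr A" using c by (simp add: add_closed mult_closed star_closed)
  have *: "vnorm A (p \<oplus> c \<odot> q) = sqrt (vnorm A ?S)" if "c * c = -1" "cnj c = - c" for c
  proof -
    have u: "p \<oplus> c \<odot> q \<in> carr A" using c by (simp add: add_closed scale_closed)
    have "vstar A (p \<oplus> c \<odot> q) \<otimes> (p \<oplus> c \<odot> q)
        = vstar A p \<otimes> p \<oplus> (c \<odot> (vstar A p \<otimes> q) \<oplus> (- c \<odot> (vstar A q \<otimes> p) \<oplus> (- (c * c)) \<odot> (vstar A q \<otimes> q)))"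
      using c by (simp add: star_add star_scale that star_closed scale_closed add_closed mult_closed
          mult_add_left mult_add_right mult_scale_left mult_scale_right scale_add_right scale_scale add_assoc)
         (simp add: c add_left_commute add_commute star_closed scale_closed add_closed mult_closed)
    \<comment> \<open>The cross terms cancel by \<open>comm\<close>, and \<open>c * c = -1\<close>
      restores the sign of the last summand.\<close>
    also have "\<dots> = ?S"
      using c by (simp add: that comm scale_cancel mult_closed star_closed scale_closed scale_one)
    finally have "(vnorm A (p \<oplus> c \<odot> q))\<^sup>2 = vnorm A ?S" using norm_star[OF u] by simp
    then show ?thesis using norm_nonneg[OF u] by (metis real_sqrt_abs abs_of_nonneg)
  qed
  have "2 \<odot> p = (p \<oplus> \<i> \<odot> q) \<oplus> (p \<oplus> (-\<i>) \<odot> q)"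
  proof -
    have "(p \<oplus> \<i> \<odot> q) \<oplus> (p \<oplus> (-\<i>) \<odot> q) = \<i> \<odot> q \<oplus> (-\<i> \<odot> q \<oplus> (p \<oplus> p))"
      using c by (simp add: add_assoc add_left_commute add_commute scale_closed add_closed)
    also have "\<dots> = p \<oplus> p" using c by (simp add: scale_cancel add_closed)
    also have "\<dots> = 2 \<odot> p" using scale_add_left[of p 1 1] c by (simp add: scale_one)
    finally show ?thesis by simp
  qed
  then have "2 * vnorm A p \<le> vnorm A (p \<oplus> \<i> \<odot> q) + vnorm A (p \<oplus> (-\<i>) \<odot> q)"
    using norm_scale[OF c(1), of 2] norm_triangle[of "p \<oplus> \<i> \<odot> q" "p \<oplus> (-\<i>) \<odot> q"] c
    by (simp add: add_closed scale_closed)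
  also have "\<dots> = 2 * sqrt (vnorm A ?S)" using *[of \<i>] *[of "-\<i>"] by simp
  finally have "vnorm A p \<le> sqrt (vnorm A ?S)" by simp
  then have "(vnorm A p)\<^sup>2 \<le> (sqrt (vnorm A ?S))\<^sup>2" by (intro power_mono norm_nonneg c)
  then show ?thesis by (simp add: norm_nonneg SA)
qed

text \<open>In a unitization the hypothesis reads \<open>x\<^sup>2 + (1 - e)\<^sup>2 = 1\<close>.\<close>

lemma norm_le_1_if_sqrt_complement:
  assumes c: "x \<in> carr A" "e \<in> carr A" and star: "vstar A x = x" "vstar A e = e"
    and comm: "e \<otimes> x = x \<otimes> e" and eq: "x \<otimes> x \<oplus> e \<otimes> e = 2 \<odot> e"
  shows "vnorm A x \<le> 1"
proof -
  define y where "y = x \<otimes> x"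
  \<comment> \<open>In a unitization q = x(1 - e), so its square is y(1 - y) with y = xx, and yy +
    qq = y. The preceding lemma then bounds the squared norm of \<open>y\<close> by the norm of
    \<open>y\<close>.\<close>
  define q where "q = x \<oplus> -1 \<odot> (e \<otimes> x)"
  note closed = mult_closed add_closed scale_closed
  have yA: "y \<in> carr A" and qA: "q \<in> carr A" using c by (simp_all add: y_def q_def closed)
  have ys: "vstar A y = y" using c star by (simp add: y_def star_mult)
  have qs: "vstar A q = q"
    using c by (simp add: q_def star_add star_scale star_mult star comm closed)
  have xex: "x \<otimes> (e \<otimes> z) = e \<otimes> (x \<otimes> z)" if "z \<in> carr A" for z
    using c that comm by (simp flip: mult_assoc)
  have yq: "y \<otimes> q = q \<otimes> y"
    using c by (simp add: y_def q_def mult_add_left mult_add_right mult_scale_left mult_scale_right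
        mult_assoc closed comm[symmetric] xex)
  have qq: "q \<otimes> q = y \<oplus> ((-2) \<odot> (e \<otimes> y) \<oplus> e \<otimes> (e \<otimes> y))"
  proof -
    have "q \<otimes> q = y \<oplus> ((-1) \<odot> (e \<otimes> y) \<oplus> ((-1) \<odot> (e \<otimes> y) \<oplus> e \<otimes> (e \<otimes> y)))"
      using c by (simp add: y_def q_def mult_add_left mult_add_right mult_scale_left mult_scale_right
          mult_assoc closed xex scale_add_right scale_scale scale_one add_assoc comm[symmetric])
    also have "(-1) \<odot> (e \<otimes> y) \<oplus> ((-1) \<odot> (e \<otimes> y) \<oplus> e \<otimes> (e \<otimes> y)) = (-2) \<odot> (e \<otimes> y) \<oplus> e \<otimes> (e \<otimes> y)"
      using scale_add_left[of "e \<otimes> y" "-1" "-1"] c yA by (simp add: closed flip: add_assoc)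
    finally show ?thesis .
  qed
  have yy: "y \<otimes> y \<oplus> e \<otimes> (e \<otimes> y) = 2 \<odot> (e \<otimes> y)"
    using arg_cong[OF eq, of "\<lambda>z. z \<otimes> y"] c yA
    by (simp add: mult_add_left mult_scale_left mult_assoc closed flip: y_def)
  have "y \<otimes> y \<oplus> q \<otimes> q = (-2) \<odot> (e \<otimes> y) \<oplus> ((y \<otimes> y \<oplus> e \<otimes> (e \<otimes> y)) \<oplus> y)"
    using c yA by (simp add: qq add_assoc add_left_commute add_commute closed)
  also have "\<dots> = y" unfolding yy using c yA by (simp add: scale_cancel closed)
  finally have "(vnorm A y)\<^sup>2 \<le> vnorm A y"
    using norm_le_norm_sum_squares[OF yA qA] by (simp add: ys qs yq)
  moreover have "vnorm A y = (vnorm A x)\<^sup>2" using norm_star[OF c(1)] by (simp add: y_def star)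
  ultimately have le: "(vnorm A x)\<^sup>2 * (vnorm A x)\<^sup>2 \<le> (vnorm A x)\<^sup>2 * 1"
    by (simp add: power2_eq_square[of "(vnorm A x)\<^sup>2"])
  have "(vnorm A x)\<^sup>2 \<le> 1"
  proof (cases "vnorm A x = 0")
    case False
    then have "(vnorm A x)\<^sup>2 > 0" by simp
    then show ?thesis using le by (simp only: mult_le_cancel_left_pos)
  qed simp
  then show ?thesis using norm_nonneg[OF c(1)] by (simp add: abs_square_le_1)
qed

end

section \<open>Boundedness of star-homomorphisms and uniqueness on generators\<close>

lemma star_homD:
  assumes "star_hom A B f"
  shows "x \<in> carr A \<Longrightarrow> f x \<in> carr B"
    and "x \<in> carr A \<Longrightarrow> y \<in> carr A \<Longrightarrow> f (vadd A x y) = vadd B (f x) (f y)"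
    and "x \<in> carr A \<Longrightarrow> f (vscale A c x) = vscale B c (f x)"
    and "x \<in> carr A \<Longrightarrow> y \<in> carr A \<Longrightarrow> f (vmult A x y) = vmult B (f x) (f y)"
    and "x \<in> carr A \<Longrightarrow> f (vstar A x) = vstar B (f x)"
  using assms by (simp_all add: star_hom_def linear_map_def)

lemma star_hom_comp:
  assumes "star_hom A B f" "star_hom B C g"
  shows "star_hom A C (g \<circ> f)"
  using assms by (simp add: star_hom_def linear_map_def)

text \<open>The relation between \<open>h\<close> and \<open>d\<close> in
  \<open>exists_sqrt_complement\<close> is algebraic, so \<open>f\<close> preserves it, and
  self-adjoint elements of norm at most 1/2 are mapped into the unit ball. Rescaling gives the
  factor 2 on self-adjoint elements, and the C*-identity carries it over to
  \<open>x\<close>.\<close>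

lemma star_hom_bounded:
  assumes A: "cstar_algebra A" and B: "cstar_algebra B" and f: "star_hom A B f" and x: "x \<in> carr A"
  shows "(vnorm B (f x))\<^sup>2 \<le> 2 * (vnorm A x)\<^sup>2"
proof -
  interpret A: cstar_algebra A by (rule A)
  interpret B: cstar_algebra B by (rule B)
  note f' = star_homD[OF f]
  have small: "vnorm B (f h) \<le> 1" if h: "h \<in> carr A" "vnorm A h \<le> 1/2" "vstar A h = h" for h
  proof -
    obtain d where d: "d \<in> carr A" "vstar A d = d" "vmult A d h = vmult A h d"
      "vadd A (vmult A h h) (vmult A d d) = vscale A 2 d"
      using A.exists_sqrt_complement[OF h] .
    show ?thesis
    proof (rule B.norm_le_1_if_sqrt_complement)
      show "f h \<in> carr B" "f d \<in> carr B" using h d f' by auto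
      show "vstar B (f h) = f h" "vstar B (f d) = f d" using h d f'(5)[of h] f'(5)[of d] by simp_all
      show "vmult B (f d) (f h) = vmult B (f h) (f d)" using h d f'(4)[of d h] f'(4)[of h d] by simp
      show "vadd B (vmult B (f h) (f h)) (vmult B (f d) (f d)) = vscale B 2 (f d)"
        using h d(1) f'(2)[of "vmult A h h" "vmult A d d"] f'(3)[of d 2]
        by (simp add: d(4) f'(4) A.mult_closed)
    qed
  qed
  have self: "vnorm B (f h) \<le> 2 * vnorm A h" if h: "h \<in> carr A" "vstar A h = h" for h
  proof (cases "vnorm A h = 0")
    case True
    then have "h = vscale A 0 h" using A.norm_eq_zero[OF h(1)] A.scale_zero_left[OF h(1)] by simp
    then have "f h = vscale B 0 (f h)" using f'(3)[OF h(1), of 0] by simp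
    then show ?thesis using True f'(1)[OF h(1)] by (simp add: B.scale_zero_left B.norm_zero)
  next
    case False
    then have pos: "vnorm A h > 0" using A.norm_nonneg[OF h(1)] by simp
    let ?r = "1 / (2 * vnorm A h)"
    have r: "cmod (of_real ?r) = ?r" using pos by (simp add: norm_divide norm_mult)
    have "vnorm B (f (vscale A (of_real ?r) h)) \<le> 1"
      using h pos
      by (intro small) (simp_all add: A.scale_closed A.norm_scale r A.star_scale del: of_real_divide of_real_mult)
    then have "?r * vnorm B (f h) \<le> 1"
      using h r by (simp add: f' B.norm_scale del: of_real_divide of_real_mult)
    then show ?thesis using pos by (simp add: field_simps)
  qed
  have "(vnorm B (f x))\<^sup>2 = vnorm B (f (vmult A (vstar A x) x))"
    using x by (simp add: f' A.star_closed B.norm_star)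
  also have "\<dots> \<le> 2 * vnorm A (vmult A (vstar A x) x)"
    using x by (intro self) (simp_all add: A.star_closed A.mult_closed A.star_mult A.star_star)
  finally show ?thesis using x by (simp add: A.norm_star)
qed

text \<open>The set where \<open>f\<close> and \<open>g\<close> agree is a C*-subalgebra: the
  algebraic closure properties are immediate, and boundedness of both maps makes it closed.\<close>

lemma star_hom_eq_on_generated:
  assumes A: "cstar_algebra A" and B: "cstar_algebra B"
    and f: "star_hom A B f" and g: "star_hom A B g"
    and G: "G \<subseteq> carr A" "\<And>x. x \<in> G \<Longrightarrow> f x = g x" and x: "x \<in> cstar_generated A G"
  shows "f x = g x"
proof -
  interpret A: cstar_algebra A by (rule A)
  interpret B: cstar_algebra B by (rule B)
  note f' = star_homD[OF f] and g' = star_homD[OF g]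
  let ?E = "{x \<in> carr A. f x = g x}"
  have zero: "k (vzero A) = vzero B" if k: "star_hom A B k" for k
    using star_homD(3)[OF k A.zero_closed, of 0] star_homD(1)[OF k A.zero_closed]
    by (simp only: A.scale_zero_right B.scale_zero_left)
  have lim: "f x = g x"
    if s: "\<And>n. s n \<in> ?E" and x: "x \<in> carr A" and l: "(\<lambda>n. vnorm A (vdiff A (s n) x)) \<longlonglongrightarrow> 0"
    for s :: "nat \<Rightarrow> _" and x
  proof -
    have cont: "vnorm B (vdiff B (k (s n)) (k x)) \<le> sqrt 2 * vnorm A (vdiff A (s n) x)"
      if k: "star_hom A B k" for k n
    proof -
      have sn: "s n \<in> carr A" using s by simp
      have d: "vdiff A (s n) x \<in> carr A" using sn x by (rule A.vdiff_closed)
      have "k (vdiff A (s n) x) = vdiff B (k (s n)) (k x)"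
        using star_homD[OF k] sn x by (simp add: vdiff_def A.scale_closed)
      then have "(vnorm B (vdiff B (k (s n)) (k x)))\<^sup>2 \<le> 2 * (vnorm A (vdiff A (s n) x))\<^sup>2"
        using star_hom_bounded[OF A B k d] by simp
      from real_le_rsqrt[OF this] show ?thesis
        using A.norm_nonneg[OF d] by (simp add: real_sqrt_mult)
    qed
    \<comment> \<open>The common value \<open>f (s n) = g (s n)\<close> is inserted between
      \<open>f x\<close> and \<open>g x\<close>.\<close>
    have le: "vnorm B (vdiff B (f x) (g x)) \<le> 2 * (sqrt 2 * vnorm A (vdiff A (s n) x))" for n
    proof -
      have sn: "s n \<in> carr A" "f (s n) = g (s n)" using s by simp_all
      have "vnorm B (vdiff B (f x) (g x))
          \<le> vnorm B (vdiff B (f x) (f (s n))) + vnorm B (vdiff B (f (s n)) (g x))"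
        using sn x f'(1) g'(1) by (intro B.norm_vdiff_trans) auto
      also have "\<dots> = vnorm B (vdiff B (f (s n)) (f x)) + vnorm B (vdiff B (g (s n)) (g x))"
        using sn x f'(1) f'(1)[OF sn(1)] B.norm_vdiff_commute[of "g (s n)" "f x"] by simp
      finally show ?thesis using cont[OF f, of n] cont[OF g, of n] by linarith
    qed
    have "(\<lambda>n. 2 * (sqrt 2 * vnorm A (vdiff A (s n) x))) \<longlonglongrightarrow> 2 * (sqrt 2 * 0)"
      by (intro tendsto_intros l)
    from LIMSEQ_le_const[OF this] have "vnorm B (vdiff B (f x) (g x)) \<le> 0"
      using le by auto
    moreover have "0 \<le> vnorm B (vdiff B (f x) (g x))"
      by (intro B.norm_nonneg B.vdiff_closed f'(1) g'(1) x)
    ultimately show ?thesis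
      by (intro B.norm_vdiff_eq_zero f'(1) g'(1) x antisym)
  qed
  have "cstar_subalgebra A ?E"
    unfolding cstar_subalgebra_def closed_subspace_def
  proof (intro conjI allI impI ballI)
    fix s y assume h: "(\<forall>n::nat. s n \<in> ?E) \<and> y \<in> carr A \<and> (\<lambda>n. vnorm A (vdiff A (s n) y)) \<longlonglongrightarrow> 0"
    then have "f y = g y" by (intro lim[of s]) auto
    then show "y \<in> ?E" using h by simp
  qed (auto simp: zero[OF f] zero[OF g] f' g' A.zero_closed A.add_closed A.scale_closed A.mult_closed A.star_closed)
  then have "cstar_generated A G \<subseteq> ?E"
    using G unfolding cstar_generated_def by blast
  then show ?thesis using x by blast
qed

section \<open>Isomorphic correspondences\<close>

context hilbert_module
begin

lemma inner_add_left:
  assumes c: "\<xi> \<in> carr H" "\<eta> \<in> carr H" "\<zeta> \<in> carr H"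
  shows "hinner H (\<xi> \<oplus>\<^bsub>H\<^esub> \<eta>) \<zeta> = hinner H \<xi> \<zeta> \<oplus>\<^bsub>A\<^esub> hinner H \<eta> \<zeta>"
proof -
  have "hinner H (\<xi> \<oplus>\<^bsub>H\<^esub> \<eta>) \<zeta> = vstar A (hinner H \<zeta> (\<xi> \<oplus>\<^bsub>H\<^esub> \<eta>))"
    using c by (simp add: inner_star H.add_closed)
  then show ?thesis using c by (simp add: inner_add star_add inner_closed inner_star)
qed

lemma inner_scale_left:
  assumes c: "\<xi> \<in> carr H" "\<zeta> \<in> carr H"
  shows "hinner H (c \<odot>\<^bsub>H\<^esub> \<xi>) \<zeta> = cnj c \<odot>\<^bsub>A\<^esub> hinner H \<xi> \<zeta>"
proof -
  have "hinner H (c \<odot>\<^bsub>H\<^esub> \<xi>) \<zeta> = vstar A (hinner H \<zeta> (c \<odot>\<^bsub>H\<^esub> \<xi>))"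
    using c by (simp add: inner_star H.scale_closed)
  then show ?thesis using c by (simp add: inner_scale star_scale inner_closed inner_star)
qed

lemma inner_ract_left:
  assumes c: "\<xi> \<in> carr H" "\<zeta> \<in> carr H" "a \<in> carr A"
  shows "hinner H (ract H \<xi> a) \<zeta> = vstar A a \<otimes>\<^bsub>A\<^esub> hinner H \<xi> \<zeta>"
proof -
  have "hinner H (ract H \<xi> a) \<zeta> = vstar A (hinner H \<zeta> (ract H \<xi> a))"
    using c by (simp add: inner_star ract_closed)
  then show ?thesis using c by (simp add: inner_ract star_mult inner_closed inner_star)
qed

lemma adjointable_operators_simps:
  "carr (adjointable_operators A H) = {T. \<exists>S. is_adjoint H T S}"
  "vadd (adjointable_operators A H) T S = (\<lambda>\<xi>\<in>carr H. T \<xi> \<oplus>\<^bsub>H\<^esub> S \<xi>)"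
  "vzero (adjointable_operators A H) = (\<lambda>\<xi>\<in>carr H. \<zero>\<^bsub>H\<^esub>)"
  "vscale (adjointable_operators A H) c T = (\<lambda>\<xi>\<in>carr H. c \<odot>\<^bsub>H\<^esub> T \<xi>)"
  "vmult (adjointable_operators A H) T S = (\<lambda>\<xi>\<in>carr H. T (S \<xi>))"
  "vnorm (adjointable_operators A H) T = (SUP \<xi>\<in>{\<xi> \<in> carr H. hnorm A H \<xi> \<le> 1}. hnorm A H (T \<xi>))"
  by (simp_all add: adjointable_operators_def)

lemma is_adjointD:
  assumes "is_adjoint H T S"
  shows "T \<in> carr H \<rightarrow>\<^sub>E carr H" "S \<in> carr H \<rightarrow>\<^sub>E carr H"
    "\<xi> \<in> carr H \<Longrightarrow> T \<xi> \<in> carr H" "\<xi> \<in> carr H \<Longrightarrow> S \<xi> \<in> carr H"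
    "\<lbrakk>\<xi> \<in> carr H; \<eta> \<in> carr H\<rbrakk> \<Longrightarrow> hinner H (T \<xi>) \<eta> = hinner H \<xi> (S \<eta>)"
  using assms by (auto simp: is_adjoint_def)

lemma is_adjoint_zero: "is_adjoint H (\<lambda>\<xi>\<in>carr H. \<zero>\<^bsub>H\<^esub>) (\<lambda>\<xi>\<in>carr H. \<zero>\<^bsub>H\<^esub>)"
proof -
  have "hinner H \<zero>\<^bsub>H\<^esub> \<xi> = \<zero>\<^bsub>A\<^esub>" "hinner H \<xi> \<zero>\<^bsub>H\<^esub> = \<zero>\<^bsub>A\<^esub>" if "\<xi> \<in> carr H" for \<xi>
    using inner_scale[OF that that, of 0] inner_scale_left[OF that that, of 0] that
    by (simp_all add: scale_zero_left H.scale_zero_left inner_closed)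
  then show ?thesis by (auto simp: is_adjoint_def H.zero_closed)
qed

lemma is_adjoint_add:
  "\<lbrakk>is_adjoint H T S; is_adjoint H T' S'\<rbrakk> \<Longrightarrow>
    is_adjoint H (\<lambda>\<xi>\<in>carr H. T \<xi> \<oplus>\<^bsub>H\<^esub> T' \<xi>) (\<lambda>\<xi>\<in>carr H. S \<xi> \<oplus>\<^bsub>H\<^esub> S' \<xi>)"
  unfolding is_adjoint_def[of H "\<lambda>\<xi>\<in>carr H. T \<xi> \<oplus>\<^bsub>H\<^esub> T' \<xi>"]
  by (auto simp: H.add_closed is_adjointD(3-5) inner_add inner_add_left)

lemma is_adjoint_scale:
  "is_adjoint H T S \<Longrightarrow>
    is_adjoint H (\<lambda>\<xi>\<in>carr H. c \<odot>\<^bsub>H\<^esub> T \<xi>) (\<lambda>\<xi>\<in>carr H. cnj c \<odot>\<^bsub>H\<^esub> S \<xi>)"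
  unfolding is_adjoint_def[of H "\<lambda>\<xi>\<in>carr H. c \<odot>\<^bsub>H\<^esub> T \<xi>"]
  by (auto simp: H.scale_closed is_adjointD(3-5) inner_scale inner_scale_left)

lemma is_adjoint_rank_one:
  assumes "\<xi> \<in> carr H" "\<eta> \<in> carr H"
  shows "is_adjoint H (rank_one H \<xi> \<eta>) (rank_one H \<eta> \<xi>)"
  using assms
  by (auto simp: is_adjoint_def rank_one_def ract_closed inner_closed inner_ract inner_ract_left inner_star)

text \<open>Limits are taken inside the carrier, so only the linear operations matter. This provides
  a member of the family intersected in \<open>closed_span\<close>, so that compact operators are
  adjointable.\<close>

lemma closed_subspace_adjointable:
  "closed_subspace (adjointable_operators A H) (carr (adjointable_operators A H))"
  unfolding closed_subspace_def adjointable_operators_simps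
  using is_adjoint_zero is_adjoint_add is_adjoint_scale by blast

lemma rank_one_adjointable:
  "{rank_one H \<xi> \<eta> | \<xi> \<eta>. \<xi> \<in> carr H \<and> \<eta> \<in> carr H} \<subseteq> carr (adjointable_operators A H)"
  unfolding adjointable_operators_simps using is_adjoint_rank_one by blast

lemma compact_operators_simps:
  "carr (compact_operators A H) = closed_span (adjointable_operators A H)
    {rank_one H \<xi> \<eta> | \<xi> \<eta>. \<xi> \<in> carr H \<and> \<eta> \<in> carr H}"
  "vadd (compact_operators A H) = vadd (adjointable_operators A H)"
  "vscale (compact_operators A H) = vscale (adjointable_operators A H)"
  "vmult (compact_operators A H) = vmult (adjointable_operators A H)"
  "vstar (compact_operators A H) = vstar (adjointable_operators A H)"
  by (simp_all add: compact_operators_def)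

lemma compact_operators_subset: "carr (compact_operators A H) \<subseteq> carr (adjointable_operators A H)"
  unfolding compact_operators_simps closed_span_def
  using closed_subspace_adjointable rank_one_adjointable by blast

end

section \<open>Transport of operators and representations along an isomorphism of
  correspondences\<close>

locale correspondence_iso =
  dom: cstar_correspondence A H + cod: cstar_correspondence A' H'
  for A :: "('v, 'm) calgebra_scheme" and H :: "('v, 'h, 'n) correspondence_scheme"
    and A' :: "('w, 'm2) calgebra_scheme" and H' :: "('w, 'k, 'n2) correspondence_scheme" +
  fixes \<alpha> :: "'v \<Rightarrow> 'w" and U :: "'h \<Rightarrow> 'k" and W :: "'k \<Rightarrow> 'h"
  assumes \<alpha>: "star_hom A A' \<alpha>"
    and isometric: "a \<in> carr A \<Longrightarrow> vnorm A' (\<alpha> a) = vnorm A a"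
    and U: "linear_map H H' U"
    and W: "\<zeta> \<in> carr H' \<Longrightarrow> W \<zeta> \<in> carr H"
    and UW: "\<zeta> \<in> carr H' \<Longrightarrow> U (W \<zeta>) = \<zeta>"
    and WU: "\<xi> \<in> carr H \<Longrightarrow> W (U \<xi>) = \<xi>"
    and U_ract: "\<lbrakk>\<xi> \<in> carr H; a \<in> carr A\<rbrakk> \<Longrightarrow> U (ract H \<xi> a) = ract H' (U \<xi>) (\<alpha> a)"
    and U_inner: "\<lbrakk>\<xi> \<in> carr H; \<eta> \<in> carr H\<rbrakk> \<Longrightarrow> hinner H' (U \<xi>) (U \<eta>) = \<alpha> (hinner H \<xi> \<eta>)"
    and U_lact: "\<lbrakk>a \<in> carr A; \<xi> \<in> carr H\<rbrakk> \<Longrightarrow> U (lact H a \<xi>) = lact H' (\<alpha> a) (U \<xi>)"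
begin

abbreviation "L \<equiv> adjointable_operators A H"
abbreviation "L' \<equiv> adjointable_operators A' H'"
abbreviation "K \<equiv> compact_operators A H"
abbreviation "K' \<equiv> compact_operators A' H'"

text \<open>This is conjugation by the unitary \<open>U\<close>, with \<open>W\<close> as its
  inverse. The restriction follows the convention that operators are undefined off the
  carrier.\<close>

definition conj_op :: "('h \<Rightarrow> 'h) \<Rightarrow> 'k \<Rightarrow> 'k" where
  "conj_op T = (\<lambda>\<eta>\<in>carr H'. U (T (W \<eta>)))"

lemma U_map:
  "\<xi> \<in> carr H \<Longrightarrow> U \<xi> \<in> carr H'"
  "\<lbrakk>\<xi> \<in> carr H; \<eta> \<in> carr H\<rbrakk> \<Longrightarrow> U (vadd H \<xi> \<eta>) = vadd H' (U \<xi>) (U \<eta>)"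
  "\<xi> \<in> carr H \<Longrightarrow> U (vscale H c \<xi>) = vscale H' c (U \<xi>)"
  using U by (simp_all add: linear_map_def)

lemma is_adjoint_conj_op:
  assumes "is_adjoint H T S"
  shows "is_adjoint H' (conj_op T) (conj_op S)"
proof -
  note TS = dom.is_adjointD[OF assms]
  have "hinner H' (U (T (W \<xi>))) \<eta> = hinner H' \<xi> (U (S (W \<eta>)))"
    if "\<xi> \<in> carr H'" "\<eta> \<in> carr H'" for \<xi> \<eta>
    using U_inner[of "T (W \<xi>)" "W \<eta>"] U_inner[of "W \<xi>" "S (W \<eta>)"] that
    by (simp add: UW W TS)
  then show ?thesis by (auto simp: is_adjoint_def conj_op_def U_map W TS)
qed

lemma U_zero: "U (vzero H) = vzero H'"
  using U_map(3)[OF dom.H.zero_closed, of 0] U_map(1)[OF dom.H.zero_closed]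
  by (simp add: dom.H.scale_zero_right cod.H.scale_zero_left)

lemma adjointable_apply: "\<lbrakk>T \<in> carr L; \<xi> \<in> carr H\<rbrakk> \<Longrightarrow> T \<xi> \<in> carr H"
  unfolding dom.adjointable_operators_simps by (auto dest: dom.is_adjointD(3))

lemma conj_op_add:
  "\<lbrakk>T \<in> carr L; S \<in> carr L\<rbrakk> \<Longrightarrow> conj_op (vadd L T S) = vadd L' (conj_op T) (conj_op S)"
  by (auto simp: dom.adjointable_operators_simps(2) cod.adjointable_operators_simps(2)
      conj_op_def U_map W adjointable_apply intro!: restrict_ext)

lemma conj_op_scale: "T \<in> carr L \<Longrightarrow> conj_op (vscale L c T) = vscale L' c (conj_op T)"
  by (auto simp: dom.adjointable_operators_simps(4) cod.adjointable_operators_simps(4)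
      conj_op_def U_map W adjointable_apply intro!: restrict_ext)

lemma conj_op_mult:
  "\<lbrakk>T \<in> carr L; S \<in> carr L\<rbrakk> \<Longrightarrow> conj_op (vmult L T S) = vmult L' (conj_op T) (conj_op S)"
  by (auto simp: dom.adjointable_operators_simps(5) cod.adjointable_operators_simps(5)
      conj_op_def U_map WU W adjointable_apply intro!: restrict_ext)

lemma conj_op_star: "T \<in> carr L \<Longrightarrow> conj_op (vstar L T) = vstar L' (conj_op T)"
proof -
  assume "T \<in> carr L"
  then obtain S where S: "is_adjoint H T S" unfolding dom.adjointable_operators_simps by blast
  then show ?thesis
    using dom.star_eq_adjoint[OF S] cod.star_eq_adjoint[OF is_adjoint_conj_op[OF S]] by simp
qed

lemma conj_op_zero: "conj_op (vzero L) = vzero L'"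
  unfolding dom.adjointable_operators_simps cod.adjointable_operators_simps
  by (auto simp: conj_op_def W U_zero intro!: restrict_ext)

lemma conj_op_carr: "T \<in> carr L \<Longrightarrow> conj_op T \<in> carr L'"
  unfolding dom.adjointable_operators_simps cod.adjointable_operators_simps
  using is_adjoint_conj_op by blast

lemma hnorm_U: "\<xi> \<in> carr H \<Longrightarrow> hnorm A' H' (U \<xi>) = hnorm A H \<xi>"
  by (simp add: hnorm_def U_inner isometric dom.inner_closed)

text \<open>\<open>U\<close> maps the unit ball of \<open>H\<close> onto that of \<open>H'\<close>
  and preserves \<open>hnorm\<close>, so both suprema run over the same set of values.\<close>

lemma norm_conj_op:
  assumes "T \<in> carr L"
  shows "vnorm L' (conj_op T) = vnorm L T"
proof -
  note T = adjointable_apply[OF assms]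
  have "{\<eta> \<in> carr H'. hnorm A' H' \<eta> \<le> 1} = U ` {\<xi> \<in> carr H. hnorm A H \<xi> \<le> 1}"
  proof (intro set_eqI iffI)
    fix \<eta> assume "\<eta> \<in> {\<eta> \<in> carr H'. hnorm A' H' \<eta> \<le> 1}"
    then show "\<eta> \<in> U ` {\<xi> \<in> carr H. hnorm A H \<xi> \<le> 1}"
      using hnorm_U[of "W \<eta>"] by (intro image_eqI[of _ _ "W \<eta>"]) (simp_all add: UW W)
  qed (auto simp: U_map hnorm_U)
  then show ?thesis
    by (auto simp: dom.adjointable_operators_simps(6) cod.adjointable_operators_simps(6) image_image conj_op_def U_map WU T hnorm_U intro!: arg_cong[of _ _ Sup] image_cong)
qed

lemma conj_op_rank_one:
  "\<lbrakk>\<xi> \<in> carr H; \<eta> \<in> carr H\<rbrakk> \<Longrightarrow> conj_op (rank_one H \<xi> \<eta>) = rank_one H' (U \<xi>) (U \<eta>)"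
proof -
  assume c: "\<xi> \<in> carr H" "\<eta> \<in> carr H"
  have "\<alpha> (hinner H \<eta> (W \<zeta>)) = hinner H' (U \<eta>) \<zeta>" if "\<zeta> \<in> carr H'" for \<zeta>
    using U_inner[OF c(2) W[OF that]] by (simp add: UW that)
  then show ?thesis using c
    by (auto simp: conj_op_def rank_one_def W U_ract dom.inner_closed intro!: restrict_ext)
qed

lemma conj_op_left_action: "a \<in> carr A \<Longrightarrow> conj_op (left_action H a) = left_action H' (\<alpha> a)"
  by (auto simp: conj_op_def left_action_def W U_lact UW intro!: restrict_ext)

text \<open>\<open>closed_span\<close> is an intersection, so membership is tested against each
  closed subspace containing the rank-one operators. Its preimage under \<open>conj_op\<close> is
  again such a subspace, since \<open>conj_op\<close> is linear and isometric and maps rank-one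
  operators to rank-one operators.\<close>

lemma conj_op_compact:
  assumes T: "T \<in> carr K"
  shows "conj_op T \<in> carr K'"
proof -
  let ?G = "{rank_one H \<xi> \<eta> | \<xi> \<eta>. \<xi> \<in> carr H \<and> \<eta> \<in> carr H}"
  let ?G' = "{rank_one H' \<xi> \<eta> | \<xi> \<eta>. \<xi> \<in> carr H' \<and> \<eta> \<in> carr H'}"
  have "conj_op T \<in> S'" if S': "closed_subspace L' S'" "?G' \<subseteq> S'" for S'
  proof -
    let ?S = "{T \<in> carr L. conj_op T \<in> S'}"
    note S'_closed = closed_subspace_closed[OF S'(1)] and L_closed = closed_subspace_closed[OF dom.closed_subspace_adjointable]
    have diff: "vnorm L' (vdiff L' (conj_op R) (conj_op T)) = vnorm L (vdiff L R T)"
      if "R \<in> carr L" "T \<in> carr L" for R T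
    proof -
      have "conj_op (vdiff L R T) = vdiff L' (conj_op R) (conj_op T)"
        using that L_closed(3)[OF that(2)] by (simp add: vdiff_def conj_op_add conj_op_scale)
      moreover have "vdiff L R T \<in> carr L"
        unfolding vdiff_def by (intro L_closed(3,4) that)
      ultimately show ?thesis using norm_conj_op by metis
    qed
    have "closed_subspace L ?S"
      unfolding closed_subspace_def
    proof (intro conjI allI impI ballI)
      fix f T assume f: "(\<forall>n::nat. f n \<in> ?S) \<and> T \<in> carr L \<and> (\<lambda>n. vnorm L (vdiff L (f n) T)) \<longlonglongrightarrow> 0"
      then have "(\<lambda>n. vnorm L' (vdiff L' (conj_op (f n)) (conj_op T))) \<longlonglongrightarrow> 0"
        by (simp add: diff)
      moreover have "conj_op (f n) \<in> S'" for n using f by simp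
      ultimately have "conj_op T \<in> S'"
        using conj_op_carr[of T] f closed_subspace_limit[OF S'(1), of "\<lambda>n. conj_op (f n)" "conj_op T"]
        by blast
      then show "T \<in> ?S" using f by simp
    next
      show "vzero L \<in> ?S" using L_closed(2) S'_closed(2) by (simp add: conj_op_zero)
      show "vadd L R T \<in> ?S" if "R \<in> ?S" "T \<in> ?S" for R T
        using that L_closed(4)[of R T] S'_closed(4)[of "conj_op R" "conj_op T"] by (simp add: conj_op_add)
      show "vscale L c T \<in> ?S" if "T \<in> ?S" for c T
        using that L_closed(3)[of T c] S'_closed(3)[of "conj_op T" c] by (simp add: conj_op_scale)
    qed blast
    moreover have "?G \<subseteq> ?S"
    proof
      fix R assume "R \<in> ?G"
      then obtain \<xi> \<eta> where R: "R = rank_one H \<xi> \<eta>" "\<xi> \<in> carr H" "\<eta> \<in> carr H" by blast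
      then have "conj_op R \<in> ?G'" using conj_op_rank_one U_map(1) by blast
      then show "R \<in> ?S" using \<open>R \<in> ?G\<close> dom.rank_one_adjointable S'(2) by blast
    qed
    ultimately have "closed_span L ?G \<subseteq> ?S" unfolding closed_span_def by blast
    then show ?thesis using T unfolding dom.compact_operators_simps by blast
  qed
  then show ?thesis unfolding cod.compact_operators_simps closed_span_def by blast
qed

lemma toeplitz_representation_comp:
  assumes "toeplitz_representation A' H' B \<psi> \<pi>"
  shows "toeplitz_representation A H B (\<psi> \<circ> U) (\<pi> \<circ> \<alpha>)"
proof -
  have "linear_map H B (\<psi> \<circ> U)"
    using assms U_map by (simp add: toeplitz_representation_def linear_map_def)
  moreover have "star_hom A B (\<pi> \<circ> \<alpha>)"
    by (rule star_hom_comp[OF \<alpha>]) (use assms in \<open>simp add: toeplitz_representation_def\<close>)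
  ultimately show ?thesis
    using assms U_map(1) star_homD(1)[OF \<alpha>]
    by (simp add: toeplitz_representation_def U_ract U_lact U_inner)
qed

text \<open>The induced homomorphism is \<open>P\<close> after \<open>conj_op\<close>. If
  \<open>a\<close> acts by a compact operator on \<open>H\<close>, then \<open>\<alpha> a\<close>
  does so on \<open>H'\<close>, where coinvariance is assumed.\<close>

lemma coinvariant_comp:
  assumes "coinvariant A' H' B \<psi> \<pi>"
  shows "coinvariant A H B (\<psi> \<circ> U) (\<pi> \<circ> \<alpha>)"
proof -
  obtain P where P: "induced_hom A' H' B \<psi> P"
    and P\<pi>: "\<And>a. a \<in> carr A' \<Longrightarrow> left_action H' a \<in> carr K' \<Longrightarrow> P (left_action H' a) = \<pi> a"
    using assms unfolding coinvariant_def by blast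
  have hom: "star_hom K K' conj_op"
  proof -
    note L = subsetD[OF dom.compact_operators_subset]
    show ?thesis
      unfolding star_hom_def linear_map_def dom.compact_operators_simps(2-) cod.compact_operators_simps(2-)
      using conj_op_compact conj_op_add[OF L L] conj_op_scale[OF L] conj_op_mult[OF L L] conj_op_star[OF L]
      by blast
  qed
  have "star_hom K B (P \<circ> conj_op)"
    by (rule star_hom_comp[OF hom]) (use P in \<open>simp add: induced_hom_def\<close>)
  then have "induced_hom A H B (\<psi> \<circ> U) (P \<circ> conj_op)"
    using P by (simp add: induced_hom_def conj_op_rank_one U_map)
  moreover have "(P \<circ> conj_op) (left_action H a) = (\<pi> \<circ> \<alpha>) a"
    if "a \<in> carr A" "left_action H a \<in> carr K" for a
    using P\<pi>[of "\<alpha> a"] conj_op_compact[OF that(2)] star_homD(1)[OF \<alpha> that(1)] that(1)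
    by (simp add: conj_op_left_action)
  ultimately show ?thesis unfolding coinvariant_def by blast
qed

end

section \<open>Isomorphisms of Cuntz-Pimsner algebras\<close>

lemma (in cuntz_pimsner_algebra) generators_closed:
  "\<xi> \<in> carr H \<Longrightarrow> k\<^sub>H \<xi> \<in> carr O\<^sub>H" "a \<in> carr A \<Longrightarrow> k\<^sub>A a \<in> carr O\<^sub>H"
  using universal_toeplitz by (auto simp: toeplitz_representation_def linear_map_def star_hom_def)

lemma (in cuntz_pimsner_algebra) star_hom_unique:
  assumes B: "cstar_algebra B" and f: "star_hom O\<^sub>H B f" and g: "star_hom O\<^sub>H B g"
    and "\<And>\<xi>. \<xi> \<in> carr H \<Longrightarrow> f (k\<^sub>H \<xi>) = g (k\<^sub>H \<xi>)" "\<And>a. a \<in> carr A \<Longrightarrow> f (k\<^sub>A a) = g (k\<^sub>A a)"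
    and b: "b \<in> carr O\<^sub>H"
  shows "f b = g b"
proof (rule star_hom_eq_on_generated[OF O.cstar_algebra_axioms B f g])
  show "b \<in> cstar_generated O\<^sub>H (k\<^sub>H ` carr H \<union> k\<^sub>A ` carr A)" using b by (simp add: generated)
qed (use assms generators_closed in auto)

lemma star_hom_id: "star_hom A A (\<lambda>x. x)"
  by (simp add: star_hom_def linear_map_def)

text \<open>The universal representation of \<open>H'\<close>, composed with \<open>U\<close> and
  \<open>\<alpha>\<close>, is a coinvariant representation of \<open>H\<close>. Both algebras have
  elements of the same type \<open>'w\<close> because the universal property ranges over algebras on
  that type.\<close>

lemma cuntz_pimsner_hom:
  fixes O\<^sub>H O\<^sub>H' :: "'w calgebra"
  assumes "correspondence_iso A H A' H' \<alpha> U W"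
    and "cuntz_pimsner_algebra A H O\<^sub>H k\<^sub>H k\<^sub>A" and "cuntz_pimsner_algebra A' H' O\<^sub>H' k\<^sub>H' k\<^sub>A'"
  obtains \<rho> where "star_hom O\<^sub>H O\<^sub>H' \<rho>"
    "\<And>\<xi>. \<xi> \<in> carr H \<Longrightarrow> \<rho> (k\<^sub>H \<xi>) = k\<^sub>H' (U \<xi>)" "\<And>a. a \<in> carr A \<Longrightarrow> \<rho> (k\<^sub>A a) = k\<^sub>A' (\<alpha> a)"
proof -
  interpret correspondence_iso A H A' H' \<alpha> U W by (rule assms)
  interpret D: cuntz_pimsner_algebra A H O\<^sub>H k\<^sub>H k\<^sub>A by (rule assms)
  interpret C: cuntz_pimsner_algebra A' H' O\<^sub>H' k\<^sub>H' k\<^sub>A' by (rule assms)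
  show ?thesis
    using D.universal[OF C.O.cstar_algebra_axioms toeplitz_representation_comp[OF C.universal_toeplitz]
        coinvariant_comp[OF C.universal_coinvariant]] that
    by auto
qed

theorem cuntz_pimsner_iso:
  fixes O\<^sub>H O\<^sub>H' :: "'w calgebra"
  assumes iso: "correspondence_iso A H A' H' \<alpha> U W" and inv: "correspondence_iso A' H' A H \<beta> W U"
    and \<beta>\<alpha>: "\<And>a. a \<in> carr A \<Longrightarrow> \<beta> (\<alpha> a) = a" and \<alpha>\<beta>: "\<And>a. a \<in> carr A' \<Longrightarrow> \<alpha> (\<beta> a) = a"
    and O\<^sub>H: "cuntz_pimsner_algebra A H O\<^sub>H k\<^sub>H k\<^sub>A" and O\<^sub>H': "cuntz_pimsner_algebra A' H' O\<^sub>H' k\<^sub>H' k\<^sub>A'"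
    and \<gamma>: "gauge_action A H O\<^sub>H k\<^sub>H k\<^sub>A \<gamma>" and \<gamma>': "gauge_action A' H' O\<^sub>H' k\<^sub>H' k\<^sub>A' \<gamma>'"
  shows "\<exists>\<rho>. star_iso O\<^sub>H O\<^sub>H' \<rho> \<and> (\<forall>z\<in>sphere 0 1. \<forall>b\<in>carr O\<^sub>H. \<gamma>' z (\<rho> b) = \<rho> (\<gamma> z b))"
proof -
  interpret F: correspondence_iso A H A' H' \<alpha> U W by (rule iso)
  interpret G: correspondence_iso A' H' A H \<beta> W U by (rule inv)
  interpret D: cuntz_pimsner_algebra A H O\<^sub>H k\<^sub>H k\<^sub>A by (rule O\<^sub>H)
  interpret C: cuntz_pimsner_algebra A' H' O\<^sub>H' k\<^sub>H' k\<^sub>A' by (rule O\<^sub>H')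
  obtain \<rho> where \<rho>: "star_hom O\<^sub>H O\<^sub>H' \<rho>"
    and \<rho>k: "\<And>\<xi>. \<xi> \<in> carr H \<Longrightarrow> \<rho> (k\<^sub>H \<xi>) = k\<^sub>H' (U \<xi>)" "\<And>a. a \<in> carr A \<Longrightarrow> \<rho> (k\<^sub>A a) = k\<^sub>A' (\<alpha> a)"
    using cuntz_pimsner_hom[OF iso O\<^sub>H O\<^sub>H'] by blast
  obtain \<tau> where \<tau>: "star_hom O\<^sub>H' O\<^sub>H \<tau>"
    and \<tau>k: "\<And>\<xi>. \<xi> \<in> carr H' \<Longrightarrow> \<tau> (k\<^sub>H' \<xi>) = k\<^sub>H (W \<xi>)" "\<And>a. a \<in> carr A' \<Longrightarrow> \<tau> (k\<^sub>A' a) = k\<^sub>A (\<beta> a)"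
    using cuntz_pimsner_hom[OF inv O\<^sub>H' O\<^sub>H] by blast
  note \<alpha>_carr = star_homD(1)[OF F.\<alpha>] and \<beta>_carr = star_homD(1)[OF G.\<alpha>]
  have "(\<tau> \<circ> \<rho>) b = b" if "b \<in> carr O\<^sub>H" for b
    by (rule D.star_hom_unique[OF D.O.cstar_algebra_axioms star_hom_comp[OF \<rho> \<tau>] star_hom_id _ _ that])
      (simp_all add: \<rho>k \<tau>k F.U_map \<alpha>_carr F.WU \<beta>\<alpha>)
  moreover have "(\<rho> \<circ> \<tau>) b = b" if "b \<in> carr O\<^sub>H'" for b
    by (rule C.star_hom_unique[OF C.O.cstar_algebra_axioms star_hom_comp[OF \<tau> \<rho>] star_hom_id _ _ that])
      (simp_all add: \<rho>k \<tau>k F.W \<beta>_carr F.UW \<alpha>\<beta>)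
  ultimately have "bij_betw \<rho> (carr O\<^sub>H) (carr O\<^sub>H')"
    using star_homD(1)[OF \<rho>] star_homD(1)[OF \<tau>] by (intro bij_betw_byWitness[of _ \<tau>]) auto
  then have "star_iso O\<^sub>H O\<^sub>H' \<rho>" using \<rho> by (simp add: star_iso_def)
  moreover have "\<gamma>' z (\<rho> b) = \<rho> (\<gamma> z b)" if z: "z \<in> sphere 0 1" and b: "b \<in> carr O\<^sub>H" for z b
  proof -
    have hom: "star_hom O\<^sub>H O\<^sub>H (\<gamma> z)" "star_hom O\<^sub>H' O\<^sub>H' (\<gamma>' z)"
      using \<gamma> \<gamma>' z by (simp_all add: gauge_action_def star_iso_def)
    have gen: "\<And>a. a \<in> carr A \<Longrightarrow> \<gamma> z (k\<^sub>A a) = k\<^sub>A a" "\<And>\<xi>. \<xi> \<in> carr H \<Longrightarrow> \<gamma> z (k\<^sub>H \<xi>) = vscale O\<^sub>H z (k\<^sub>H \<xi>)"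
      "\<And>a. a \<in> carr A' \<Longrightarrow> \<gamma>' z (k\<^sub>A' a) = k\<^sub>A' a" "\<And>\<xi>. \<xi> \<in> carr H' \<Longrightarrow> \<gamma>' z (k\<^sub>H' \<xi>) = vscale O\<^sub>H' z (k\<^sub>H' \<xi>)"
      using \<gamma> \<gamma>' z by (simp_all add: gauge_action_def)
    \<comment> \<open>On generators both composites send the image of \<open>\<xi>\<close> to
      \<open>z\<close> times the image of \<open>U \<xi>\<close>, and the image of \<open>a\<close>
      to that of \<open>\<alpha> a\<close>.\<close>
    have "(\<gamma>' z \<circ> \<rho>) b = (\<rho> \<circ> \<gamma> z) b"
      by (rule D.star_hom_unique[OF C.O.cstar_algebra_axioms star_hom_comp[OF \<rho> hom(2)]
            star_hom_comp[OF hom(1) \<rho>] _ _ b])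
        (simp_all add: \<rho>k gen F.U_map \<alpha>_carr star_homD(3)[OF \<rho>] D.generators_closed)
    then show ?thesis by simp
  qed
  ultimately show ?thesis by blast
qed

section \<open>Conjugate subshifts\<close>

lemma full_shift_topspace: "topspace (full_shift \<AA>) = {x. \<forall>i. x i \<in> \<AA>}"
  by (auto simp: full_shift_def)

lemma subshiftD:
  assumes "subshift \<AA> X"
  shows "finite \<AA>" "closedin (full_shift \<AA>) X" "shift ` X \<subseteq> X"
    and "x \<in> X \<Longrightarrow> x i \<in> \<AA>" and "x \<in> X \<Longrightarrow> shift x \<in> X" and "case_nat a x \<in> X \<Longrightarrow> x \<in> X"
    and "case_nat a x \<in> X \<Longrightarrow> a \<in> \<AA>"
proof -
  show X: "finite \<AA>" "closedin (full_shift \<AA>) X" "shift ` X \<subseteq> X"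
    using assms by (auto simp: subshift_def)
  show mem: "x \<in> X \<Longrightarrow> x i \<in> \<AA>" for x i
    using closedin_subset[OF X(2)] by (auto simp: full_shift_topspace)
  show "x \<in> X \<Longrightarrow> shift x \<in> X" using X(3) by auto
  show "case_nat a x \<in> X \<Longrightarrow> x \<in> X" using X(3) shift_case_nat by fastforce
  show "case_nat a x \<in> X \<Longrightarrow> a \<in> \<AA>" using mem[of "case_nat a x" 0] by simp
qed

text \<open>The cylinder of \<open>w\<close> in the full shift, written as a product set so that the
  criteria for open and closed products apply.\<close>

definition word_box :: "'a set \<Rightarrow> 'a list \<Rightarrow> (nat \<Rightarrow> 'a) set" where
  "word_box \<AA> w = (\<Pi>\<^sub>E i\<in>UNIV. if i < length w then {w ! i} else \<AA>)"

lemma word_box_iff: "x \<in> word_box \<AA> w \<longleftrightarrow> (\<forall>i. if i < length w then x i = w ! i else x i \<in> \<AA>)"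
  by (auto simp: word_box_def PiE_iff split: if_splits)

lemma word_box_clopen:
  assumes "w \<in> lists \<AA>"
  shows "openin (full_shift \<AA>) (word_box \<AA> w)" "closedin (full_shift \<AA>) (word_box \<AA> w)"
proof -
  have nth: "w ! i \<in> \<AA>" if "i < length w" for i using assms that by auto
  have "finite {i. (if i < length w then {w ! i} else \<AA>) \<noteq> \<AA>}"
    by (rule finite_subset[of _ "{..<length w}"]) auto
  then show "openin (full_shift \<AA>) (word_box \<AA> w)"
    unfolding full_shift_def word_box_def openin_PiE_gen by (auto simp: nth)
  show "closedin (full_shift \<AA>) (word_box \<AA> w)"
    unfolding full_shift_def word_box_def closedin_product_topology by (auto simp: nth)
qed

lemma cylinder_eq_word_box: "subshift \<AA> X \<Longrightarrow> cylinder X w = X \<inter> word_box \<AA> w"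
  using subshiftD(4)[of \<AA> X] by (auto simp: cylinder_iff word_box_iff)

text \<open>Since the alphabet is finite, the full shift is compact, and so is the closed set
  \<open>S\<close>. As \<open>S\<close> is relatively open, it is covered by word boxes whose trace
  on \<open>X\<close> lies in \<open>S\<close>, and a finite subcover suffices.\<close>

lemma clopen_eq_Union_cylinders:
  assumes X: "subshift \<AA> X"
    and S: "openin (subtopology (full_shift \<AA>) X) S" "closedin (subtopology (full_shift \<AA>) X) S"
  obtains W where "finite W" "W \<subseteq> lists \<AA>" "S = (\<Union>w\<in>W. cylinder X w)"
proof -
  let ?\<W> = "{w \<in> lists \<AA>. cylinder X w \<subseteq> S}"
  obtain G where G: "openin (full_shift \<AA>) G" "S = G \<inter> X"
    using S(1) unfolding openin_subtopology by blast
  have "compact_space (full_shift \<AA>)"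
    using subshiftD(1)[OF X]
    by (simp add: full_shift_def compact_space_product_topology compact_space_discrete_topology)
  moreover have "closedin (full_shift \<AA>) S"
    using closedin_trans_full[OF S(2) subshiftD(2)[OF X]] .
  ultimately have compact: "compactin (full_shift \<AA>) S"
    by (rule closedin_compact_space)
  have cover: "S \<subseteq> \<Union>(word_box \<AA> ` ?\<W>)"
  proof
    fix x assume x: "x \<in> S"
    then have xX: "x \<in> X" using G by blast
    have "\<exists>U. finite {i. U i \<noteq> \<AA>} \<and> (\<forall>i. U i \<subseteq> \<AA>) \<and> x \<in> Pi\<^sub>E UNIV U \<and> Pi\<^sub>E UNIV U \<subseteq> G"
      using G x unfolding full_shift_def openin_product_topology_alt by auto
    then obtain U where U: "finite {i. U i \<noteq> \<AA>}" "\<And>i. x i \<in> U i" "Pi\<^sub>E UNIV U \<subseteq> G"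
      by (auto simp: PiE_iff)
    \<comment> \<open>A basic neighbourhood restricts finitely many coordinates only; the prefix of
      \<open>x\<close> of a length \<open>n\<close> exceeding them all already forces membership in
      \<open>G\<close>.\<close>
    obtain n where n: "\<And>i. U i \<noteq> \<AA> \<Longrightarrow> i < n"
      using U(1) unfolding finite_nat_set_iff_bounded by auto
    let ?w = "map x [0..<n]"
    have "y \<in> G" if y: "y \<in> cylinder X ?w" for y
    proof -
      have "y i \<in> U i" for i
      proof (cases "U i = \<AA>")
        case True
        then show ?thesis using y subshiftD(4)[OF X] by (simp add: cylinder_iff)
      next
        case False
        then show ?thesis using y n[OF False] U(2)[of i] by (simp add: cylinder_iff)
      qed
      then show ?thesis using U(3) by (auto simp: PiE_iff)
    qed
    moreover have "?w \<in> lists \<AA>" using subshiftD(4)[OF X xX] by auto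
    ultimately have "?w \<in> ?\<W>" using G(2) by (auto simp: cylinder_iff)
    moreover have "x \<in> word_box \<AA> ?w" using subshiftD(4)[OF X xX] by (simp add: word_box_iff)
    ultimately show "x \<in> \<Union>(word_box \<AA> ` ?\<W>)" by blast
  qed
  have "openin (full_shift \<AA>) U" if U: "U \<in> word_box \<AA> ` ?\<W>" for U
  proof -
    from U obtain w where "U = word_box \<AA> w" "w \<in> lists \<AA>" by auto
    then show ?thesis by (simp only: word_box_clopen(1))
  qed
  from compactinD[OF compact this cover]
  obtain \<F> where \<F>: "finite \<F>" "\<F> \<subseteq> word_box \<AA> ` ?\<W>" "S \<subseteq> \<Union>\<F>"
    by blast
  from finite_subset_image[OF \<F>(1,2)] obtain W where "W \<subseteq> ?\<W>" "finite W" "\<F> = word_box \<AA> ` W"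
    by blast
  with \<F>(3) have W: "finite W" "W \<subseteq> ?\<W>" "S \<subseteq> \<Union>(word_box \<AA> ` W)"
    by simp_all
  have "S = (\<Union>w\<in>W. cylinder X w)"
  proof
    show "S \<subseteq> (\<Union>w\<in>W. cylinder X w)"
      using W(3) G(2) by (auto simp: cylinder_eq_word_box[OF X])
    show "(\<Union>w\<in>W. cylinder X w) \<subseteq> S" using W(2) by blast
  qed
  then show ?thesis using that W(1,2) by blast
qed

section \<open>Pullbacks of functions\<close>

definition pullback :: "'y set \<Rightarrow> ('y \<Rightarrow> 'x) \<Rightarrow> ('x \<Rightarrow> complex) \<Rightarrow> 'y \<Rightarrow> complex" where
  "pullback Z g f y = (if y \<in> Z then f (g y) else 0)"

lemma pullback_simps:
  "pullback Z g (\<lambda>x. 0) = (\<lambda>y. 0)"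
  "pullback Z g (\<lambda>x. f x + h x) = (\<lambda>y. pullback Z g f y + pullback Z g h y)"
  "pullback Z g (\<lambda>x. f x - h x) = (\<lambda>y. pullback Z g f y - pullback Z g h y)"
  "pullback Z g (\<lambda>x. f x * h x) = (\<lambda>y. pullback Z g f y * pullback Z g h y)"
  "pullback Z g (\<lambda>x. c * f x) = (\<lambda>y. c * pullback Z g f y)"
  "pullback Z g (\<lambda>x. cnj (f x)) = (\<lambda>y. cnj (pullback Z g f y))"
  by (auto simp: fun_eq_iff pullback_def)

lemma pullback_bounded:
  assumes Z: "Z \<subseteq> Y" and f: "f \<in> carr (bounded_functions X)"
  shows "pullback Z g f \<in> carr (bounded_functions Y)"
    and "vnorm (bounded_functions Y) (pullback Z g f) \<le> vnorm (bounded_functions X) f"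
proof -
  have *: "cmod (pullback Z g f y) \<le> vnorm (bounded_functions X) f" for y
    using cmod_le_vnorm[OF f] vnorm_nonneg[OF f] by (simp add: pullback_def)
  show "pullback Z g f \<in> carr (bounded_functions Y)"
    using Z by (intro carr_bounded_functionsI[OF _ *]) (auto simp: pullback_def)
  show "vnorm (bounded_functions Y) (pullback Z g f) \<le> vnorm (bounded_functions X) f"
    using * by (rule vnorm_le)
qed

text \<open>The functions whose pullback lies in the target algebra form a C*-subalgebra, because
  pulling back is a contractive star-homomorphism; hence the generators decide. The cutoff set
  \<open>Z\<close> may be smaller than \<open>Y\<close>, for instance a single cylinder.\<close>

lemma pullback_subshift_algebra:
  assumes Z: "Z \<subseteq> Y"
    and gen: "\<And>\<mu> \<nu>. \<lbrakk>\<mu> \<in> lists \<AA>; \<nu> \<in> lists \<AA>\<rbrakk> \<Longrightarrow>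
      pullback Z g (indicator (cylinder2 X \<mu> \<nu>)) \<in> carr (subshift_algebra \<BB> Y)"
    and f: "f \<in> carr (subshift_algebra \<AA> X)"
  shows "pullback Z g f \<in> carr (subshift_algebra \<BB> Y)"
proof -
  let ?B = "bounded_functions X" and ?C = "bounded_functions Y"
  let ?D = "carr (subshift_algebra \<BB> Y)" and ?T = "pullback Z g"
  let ?S = "{f \<in> carr ?B. ?T f \<in> ?D}"
  note T = pullback_simps[of Z g]
  have D: "closed_subspace ?C ?D"
    using cstar_subalgebra_subshift_algebra[of Y \<BB>] unfolding cstar_subalgebra_def by blast
  have lim: "u \<in> ?S" if h: "\<forall>n::nat. h n \<in> ?S" "u \<in> carr ?B" "(\<lambda>n. vnorm ?B (vdiff ?B (h n) u)) \<longlonglongrightarrow> 0" for h u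
  proof -
    have d: "(\<lambda>x. h n x - u x) \<in> carr ?B" for n
      using bounded_functions_add(1)[of "h n" X, OF _ bounded_functions_scale(1)[OF h(2), of "-1"]] h(1) by simp
    have "(\<lambda>n. vnorm ?C (\<lambda>x. ?T (h n) x - ?T u x)) \<longlonglongrightarrow> 0"
    proof (rule tendsto_sandwich[OF _ _ tendsto_const])
      show "(\<lambda>n. vnorm ?B (\<lambda>x. h n x - u x)) \<longlonglongrightarrow> 0" using h(3) by simp
      show "\<forall>\<^sub>F n in sequentially. 0 \<le> vnorm ?C (\<lambda>x. ?T (h n) x - ?T u x)"
        using vnorm_nonneg[OF pullback_bounded(1)[OF Z d, of g]] by (simp add: T)
      show "\<forall>\<^sub>F n in sequentially. vnorm ?C (\<lambda>x. ?T (h n) x - ?T u x) \<le> vnorm ?B (\<lambda>x. h n x - u x)"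
        using pullback_bounded(2)[OF Z d, of g] by (simp add: T)
    qed
    then have "?T u \<in> ?D"
      using h(1) closed_subspace_limit[OF D _ pullback_bounded(1)[OF Z h(2)], of "\<lambda>n. ?T (h n)" g] by simp
    then show ?thesis using h(2) by simp
  qed
  have "cstar_subalgebra ?B ?S"
    unfolding cstar_subalgebra_def closed_subspace_def
  proof (intro conjI ballI allI impI)
    show "vzero ?B \<in> ?S"
      using subshift_algebra_zero subshift_algebra_bounded[OF subshift_algebra_zero[of \<AA> X]] by (simp add: T)
    show "x \<in> ?S" if "(\<forall>n. f n \<in> ?S) \<and> x \<in> carr ?B \<and> (\<lambda>n. vnorm ?B (vdiff ?B (f n) x)) \<longlonglongrightarrow> 0" for f x
      by (rule lim[of f x]) (use that in auto)
    fix u h c assume u: "u \<in> ?S"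
    show "vscale ?B c u \<in> ?S" "vstar ?B u \<in> ?S"
      using u bounded_functions_scale(1)[of u X c] bounded_functions_cnj[of u X]
        subshift_algebra_closed(1,2)[of "?T u" \<BB> Y]
      unfolding bounded_functions_simps mem_Collect_eq T(5,6) by simp_all
    assume h: "h \<in> ?S"
    show "vadd ?B u h \<in> ?S" "vmult ?B u h \<in> ?S"
      using u h bounded_functions_add(1)[of u X h] bounded_functions_mult(1)[of u X h]
        subshift_algebra_closed(3,4)[of "?T u" \<BB> Y "?T h"]
      unfolding bounded_functions_simps mem_Collect_eq T(2,4) by simp_all
  qed blast
  moreover have "indicator (cylinder2 X \<mu> \<nu>) \<in> ?S" if "\<mu> \<in> lists \<AA>" "\<nu> \<in> lists \<AA>" for \<mu> \<nu>
    using gen[OF that] by (simp add: indicator_bounded_functions cylinder2_subset)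
  ultimately have "carr (subshift_algebra \<AA> X) \<subseteq> ?S"
    by (intro subshift_algebra_least) blast+
  then show ?thesis using f by auto
qed

section \<open>Closure properties of the function algebra of a subshift\<close>

context
  fixes \<AA> :: "'a set" and X :: "(nat \<Rightarrow> 'a) set"
  assumes X: "subshift \<AA> X"
begin

abbreviation (input) "D \<equiv> carr (subshift_algebra \<AA> X)"

lemma indicator_Int_algebra:
  "\<lbrakk>indicator S \<in> D; indicator T \<in> D\<rbrakk> \<Longrightarrow> indicator (S \<inter> T) \<in> D"
  unfolding indicator_inter_arith[abs_def] by (rule subshift_algebra_closed(4))

lemma indicator_Un_algebra:
  assumes "indicator S \<in> D" "indicator T \<in> D"
  shows "indicator (S \<union> T) \<in> D"
proof -
  have "indicator (S \<union> T) = (\<lambda>x. (indicator S x + indicator T x) + (-1) * (indicator S x * indicator T x) :: complex)"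
    by (auto simp: fun_eq_iff indicator_def)
  then show ?thesis
    using assms by (simp only:) (intro subshift_algebra_closed)
qed

lemma indicator_UN_algebra:
  "\<lbrakk>finite I; \<And>i. i \<in> I \<Longrightarrow> indicator (S i) \<in> D\<rbrakk> \<Longrightarrow> indicator (\<Union>i\<in>I. S i) \<in> D"
proof (induction I rule: finite_induct)
  case empty
  then show ?case using subshift_algebra_zero[of \<AA> X] by (simp add: indicator_def)
qed (simp add: indicator_Un_algebra)

lemma funpow_shift_mem: "x \<in> X \<Longrightarrow> (shift ^^ n) x \<in> X"
  by (induction n) (simp_all add: subshiftD(5)[OF X])

lemma cylinder_algebra:
  assumes "w \<in> lists \<AA>"
  shows "indicator (cylinder X w) \<in> D"
proof -
  have "cylinder2 X [] w = cylinder X w"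
    using funpow_shift_mem by (auto simp: cylinder2_def cylinder_def)
  then show ?thesis using subshift_algebra_generator[of "[]" \<AA> w X] assms by simp
qed

text \<open>This is the function sending ax to the value of \<open>\<xi> a\<close> at x. It is the
  sum over letters of pullbacks along the shift cut off to C(a), and such a pullback turns the
  generator for (\<mu>, \<nu>) into the one for (\<mu>, a\<nu>).\<close>

lemma letterwise_shift_algebra:
  assumes "\<And>a. a \<in> \<AA> \<Longrightarrow> \<xi> a \<in> D"
  shows "(\<lambda>x. if x \<in> X then \<xi> (x 0) (shift x) else 0) \<in> D"
proof -
  have "pullback (cylinder X [a]) shift (\<xi> a) \<in> D" if a: "a \<in> \<AA>" for a
  proof (rule pullback_subshift_algebra[OF _ _ assms[OF a]])
    fix \<mu> \<nu> assume w: "\<mu> \<in> lists \<AA>" "\<nu> \<in> lists \<AA>"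
    have "x \<in> cylinder X [a] \<and> shift x \<in> cylinder2 X \<mu> \<nu> \<longleftrightarrow> x \<in> cylinder2 X \<mu> (a # \<nu>)" for x
      using subshiftD(5)[OF X, of x]
      by (auto simp: cylinder2_iff cylinder_iff shift_def All_less_Suc2)
    then have "pullback (cylinder X [a]) shift (indicator (cylinder2 X \<mu> \<nu>)) = indicator (cylinder2 X \<mu> (a # \<nu>))"
      by (auto simp: fun_eq_iff pullback_def indicator_def)
    then show "pullback (cylinder X [a]) shift (indicator (cylinder2 X \<mu> \<nu>)) \<in> D"
      using subshift_algebra_generator[of \<mu> \<AA> "a # \<nu>" X] w a by simp
  qed (auto simp: cylinder_def)
  then have "(\<lambda>x. \<Sum>a\<in>\<AA>. pullback (cylinder X [a]) shift (\<xi> a) x) \<in> D"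
    by (intro subshift_algebra_sum subshiftD(1)[OF X])
  moreover have "(\<Sum>a\<in>\<AA>. pullback (cylinder X [a]) shift (\<xi> a) x) = (if x \<in> X then \<xi> (x 0) (shift x) else 0)" for x
  proof (cases "x \<in> X")
    case True
    then have "(\<Sum>a\<in>\<AA>. pullback (cylinder X [a]) shift (\<xi> a) x) = (\<Sum>a\<in>\<AA>. if a = x 0 then \<xi> (x 0) (shift x) else 0)"
      by (intro sum.cong) (auto simp: pullback_def cylinder_iff)
    then show ?thesis using True subshiftD(1)[OF X] subshiftD(4)[OF X True, of 0] by (simp add: sum.delta)
  qed (simp add: pullback_def cylinder_iff)
  ultimately show ?thesis by simp
qed

text \<open>Composition with the shift is the letterwise construction for a constant family; the
  induction splits off the shift that is applied first.\<close>

lemma funpow_shift_preimage_algebra: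
  assumes "indicator S \<in> D"
  shows "indicator {x \<in> X. (shift ^^ n) x \<in> S} \<in> D"
proof (induction n)
  case 0
  have "{x \<in> X. x \<in> S} = X \<inter> S" by auto
  then show ?case using indicator_Int_algebra[OF subshift_algebra_unit assms] by simp
next
  case (Suc n)
  have "indicator {x \<in> X. (shift ^^ Suc n) x \<in> S}
      = (\<lambda>x. if x \<in> X then indicator {x \<in> X. (shift ^^ n) x \<in> S} (shift x) else (0::complex))"
    using subshiftD(5)[OF X] by (auto simp: fun_eq_iff indicator_def simp del: funpow.simps simp: funpow_Suc_right)
  then show ?case using letterwise_shift_algebra[OF Suc.IH] by simp
qed

text \<open>If \<open>w = uv\<close> with \<open>|u| = m\<close>, then \<open>\<sigma>\<^sup>m(C(w)) = C(w, v)\<close>; shorter words are extended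
  to length \<open>m\<close> first.\<close>

lemma funpow_shift_image_cylinder_algebra:
  "w \<in> lists \<AA> \<Longrightarrow> indicator ((shift ^^ m) ` cylinder X w) \<in> D"
proof (induction "m - length w" arbitrary: w)
  \<comment> \<open>Subtraction is truncated, so this case covers all words of length at least
    \<open>m\<close>.\<close>
  case 0
  then have m: "m \<le> length w" by simp
  have "(shift ^^ m) ` cylinder X w = cylinder2 X w (drop m w)"
  proof (intro set_eqI iffI)
    fix x assume "x \<in> (shift ^^ m) ` cylinder X w"
    then obtain y where y: "y \<in> cylinder X w" "x = (shift ^^ m) y" by blast
    then have "x \<in> cylinder X (drop m w)"
      using funpow_shift_mem[of y m] m by (auto simp: cylinder_iff funpow_shift)
    moreover have "x (length (drop m w) + i) = y (length w + i)" for i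
      using y(2) m by (simp add: funpow_shift)
    ultimately show "x \<in> cylinder2 X w (drop m w)"
      using y(1) unfolding cylinder2_iff by blast
  next
    fix x assume "x \<in> cylinder2 X w (drop m w)"
    then obtain y where x: "x \<in> cylinder X (drop m w)" and y: "y \<in> cylinder X w"
      and tail: "\<And>i. x (length w - m + i) = y (length w + i)"
      unfolding cylinder2_iff by auto
    have "x i = y (m + i)" for i
    proof (cases "i < length w - m")
      case True
      then show ?thesis using x y m by (simp add: cylinder_iff)
    next
      case False
      then show ?thesis using tail[of "i - (length w - m)"] m by (simp add: add.commute)
    qed
    then have "x = (shift ^^ m) y" by (simp add: funpow_shift fun_eq_iff)
    then show "x \<in> (shift ^^ m) ` cylinder X w" using y by blast
  qed
  moreover have "drop m w \<in> lists \<AA>" using 0 in_set_dropD by fastforce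
  ultimately show ?case using subshift_algebra_generator[of w \<AA> "drop m w" X] 0 by simp
next
  case (Suc k)
  \<comment> \<open>Every point of C(w) has some letter of the alphabet at position
    \<open>length w\<close>, so C(w) is a finite union of cylinders of words one letter
    longer.\<close>
  have "x \<in> cylinder X w \<longleftrightarrow> (\<exists>a\<in>\<AA>. x \<in> cylinder X (w @ [a]))" for x
    using subshiftD(4)[OF X, of x "length w"]
    by (auto simp: cylinder_iff less_Suc_eq nth_append)
  then have "(shift ^^ m) ` cylinder X w = (\<Union>a\<in>\<AA>. (shift ^^ m) ` cylinder X (w @ [a]))"
    by blast
  moreover have "indicator ((shift ^^ m) ` cylinder X (w @ [a])) \<in> D" if "a \<in> \<AA>" for a
    using Suc.hyps(2) Suc.prems that by (intro Suc.hyps(1)) auto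
  ultimately show ?case using indicator_UN_algebra[OF subshiftD(1)[OF X]] by simp
qed

text \<open>The set of x with ax in \<open>X\<close> is \<sigma>(C(a)). A function vanishing off it
  is unchanged by multiplication with the generating indicator; conversely, vanishing there is a
  closed ideal condition satisfied by the indicator.\<close>

lemma letter_ideal_eq:
  assumes a: "a \<in> \<AA>"
  shows "letter_ideal \<AA> X a = {f \<in> D. \<forall>x. case_nat a x \<notin> X \<longrightarrow> f x = 0}" (is "_ = ?I")
proof
  let ?A = "subshift_algebra \<AA> X" and ?e = "indicator (shift ` cylinder X [a]) :: _ \<Rightarrow> complex"
  have e: "?e x = (if case_nat a x \<in> X then 1 else 0)" for x
    by (simp add: shift_image_cylinder[OF subshiftD(3)[OF X]])
  have eD: "?e \<in> D"
    using subshift_algebra_generator[of "[a]" \<AA> "[]" X] a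
    by (simp add: shift_image_cylinder_eq_cylinder2[OF subshiftD(3)[OF X]])
  have "closed_ideal ?A ?I"
    unfolding closed_ideal_def closed_subspace_def
  proof (intro conjI ballI allI impI)
    fix f g assume h: "(\<forall>n::nat. f n \<in> ?I) \<and> g \<in> D \<and> (\<lambda>n. vnorm ?A (vdiff ?A (f n) g)) \<longlonglongrightarrow> 0"
    have "g x = 0" if x: "case_nat a x \<notin> X" for x
    proof -
      \<comment> \<open>\<open>f n x = 0\<close>, so the value of \<open>g\<close> at
        \<open>x\<close> is bounded by the uniform distance.\<close>
      have "cmod (g x) \<le> vnorm ?A (vdiff ?A (f n) g)" for n
      proof -
        have "(\<lambda>x. f n x + (-1) * g x) \<in> D"
          using h by (intro subshift_algebra_closed(3) subshift_algebra_closed(1)) simp_all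
        from cmod_le_vnorm[OF subshift_algebra_bounded[OF this], of x] show ?thesis
          using h x by simp
      qed
      then have "cmod (g x) \<le> 0" using h by (intro LIMSEQ_le_const[of _ 0]) auto
      then show ?thesis by simp
    qed
    then show "g \<in> ?I" using h by simp
  qed (auto simp: subshift_algebra_zero subshift_algebra_closed)
  moreover have "?e \<in> ?I" using eD e by simp
  ultimately show "letter_ideal \<AA> X a \<subseteq> ?I"
    unfolding letter_ideal_def ideal_generated_def by blast
  show "?I \<subseteq> letter_ideal \<AA> X a"
  proof
    fix f assume f: "f \<in> ?I"
    have "?e \<in> letter_ideal \<AA> X a" unfolding letter_ideal_def ideal_generated_def by blast
    then have "(\<lambda>x. ?e x * f x) \<in> letter_ideal \<AA> X a"
      using f by (intro letter_ideal_closed(5)[OF subshiftD(3)[OF X] a]) simp_all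
    moreover have "(\<lambda>x. ?e x * f x) = f" using f by (auto simp: fun_eq_iff e)
    ultimately show "f \<in> letter_ideal \<AA> X a" by simp
  qed
qed

lemma correspondence_zero:
  assumes "\<xi> \<in> carr (subshift_correspondence \<AA> X)" "case_nat a x \<notin> X"
  shows "\<xi> a x = 0"
  using assms letter_ideal_eq[of a] by (cases "a \<in> \<AA>") (auto simp: carr_subshift_correspondence)

end

text \<open>Identifying \<open>\<xi>\<close> with the function \<open>ax \<mapsto> \<xi>\<^sub>a(x)\<close> on \<open>X\<close> turns this map into composition with \<open>\<psi>\<close>.\<close>

definition correspondence_pullback ::
    "(nat \<Rightarrow> 'b) set \<Rightarrow> ((nat \<Rightarrow> 'b) \<Rightarrow> nat \<Rightarrow> 'a) \<Rightarrow>
     ('a \<Rightarrow> (nat \<Rightarrow> 'a) \<Rightarrow> complex) \<Rightarrow> 'b \<Rightarrow> (nat \<Rightarrow> 'b) \<Rightarrow> complex" where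
  "correspondence_pullback Y \<psi> \<xi> b y =
    (if case_nat b y \<in> Y then \<xi> (\<psi> (case_nat b y) 0) (\<psi> y) else 0)"

section \<open>The isomorphism of correspondences induced by a conjugacy\<close>

locale subshift_conjugacy =
  fixes \<AA> :: "'a set" and X :: "(nat \<Rightarrow> 'a) set" and \<BB> :: "'b set" and Y :: "(nat \<Rightarrow> 'b) set"
    and \<phi> :: "(nat \<Rightarrow> 'a) \<Rightarrow> nat \<Rightarrow> 'b" and \<psi> :: "(nat \<Rightarrow> 'b) \<Rightarrow> nat \<Rightarrow> 'a"
  assumes X: "subshift \<AA> X" and Y: "subshift \<BB> Y"
    and maps: "homeomorphic_maps (subtopology (full_shift \<AA>) X) (subtopology (full_shift \<BB>) Y) \<phi> \<psi>"
    and \<phi>_shift: "x \<in> X \<Longrightarrow> \<phi> (shift x) = shift (\<phi> x)"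
begin

abbreviation "H \<equiv> subshift_correspondence \<AA> X"
abbreviation "H' \<equiv> subshift_correspondence \<BB> Y"
abbreviation "U \<equiv> correspondence_pullback Y \<psi>"

lemma topspace_X: "topspace (subtopology (full_shift \<AA>) X) = X"
  by (rule topspace_subtopology_subset[OF closedin_subset[OF subshiftD(2)[OF X]]])

lemma topspace_Y: "topspace (subtopology (full_shift \<BB>) Y) = Y"
  by (rule topspace_subtopology_subset[OF closedin_subset[OF subshiftD(2)[OF Y]]])

lemma inverse:
  "x \<in> X \<Longrightarrow> \<phi> x \<in> Y" "x \<in> X \<Longrightarrow> \<psi> (\<phi> x) = x"
  "y \<in> Y \<Longrightarrow> \<psi> y \<in> X" "y \<in> Y \<Longrightarrow> \<phi> (\<psi> y) = y"
proof -
  have "\<phi> \<in> X \<rightarrow> Y" "\<psi> \<in> Y \<rightarrow> X"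
    using maps continuous_map_funspace unfolding homeomorphic_maps_def
    by (metis topspace_X topspace_Y)+
  then show "x \<in> X \<Longrightarrow> \<phi> x \<in> Y" "y \<in> Y \<Longrightarrow> \<psi> y \<in> X" by auto
  show "x \<in> X \<Longrightarrow> \<psi> (\<phi> x) = x" "y \<in> Y \<Longrightarrow> \<phi> (\<psi> y) = y"
    using maps unfolding homeomorphic_maps_def topspace_X topspace_Y by auto
qed

lemma \<psi>_shift:
  assumes y: "y \<in> Y"
  shows "\<psi> (shift y) = shift (\<psi> y)"
proof -
  have "\<phi> (shift (\<psi> y)) = shift y" using \<phi>_shift[OF inverse(3)[OF y]] by (simp only: inverse(4)[OF y])
  then show ?thesis using inverse(2)[OF subshiftD(5)[OF X inverse(3)[OF y]]] by simp
qed

text \<open>By this symmetry each later fact about \<open>\<psi>\<close> is also available for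
  \<open>\<phi>\<close>, with \<open>X\<close> and \<open>Y\<close> exchanged.\<close>

lemma converse: "subshift_conjugacy \<BB> Y \<AA> X \<psi> \<phi>"
  by (rule subshift_conjugacy.intro[OF Y X homeomorphic_maps_sym[THEN iffD1, OF maps] \<psi>_shift])

lemma \<psi>_funpow_shift: "y \<in> Y \<Longrightarrow> \<psi> ((shift ^^ n) y) = (shift ^^ n) (\<psi> y)"
  by (induction n) (simp_all add: \<psi>_shift funpow_shift_mem[OF Y])

text \<open>Equivariance makes \<open>\<psi> y\<close> the tail of the image of by, so only the
  first letter of that image is new. This is what gives the formula for
  \<open>correspondence_pullback\<close> its meaning.\<close>

lemma \<psi>_case_nat:
  assumes "case_nat b y \<in> Y"
  shows "case_nat (\<psi> (case_nat b y) 0) (\<psi> y) = \<psi> (case_nat b y)"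
  unfolding \<psi>_shift[OF assms, unfolded shift_case_nat] by (rule case_nat_shift[OF refl])

text \<open>Cylinders are clopen and \<open>\<psi>\<close> is continuous, so the preimage is clopen
  and compactness applies.\<close>

lemma preimage_cylinder:
  assumes w: "w \<in> lists \<AA>"
  obtains W where "finite W" "W \<subseteq> lists \<BB>" "{y \<in> Y. \<psi> y \<in> cylinder X w} = (\<Union>v\<in>W. cylinder Y v)"
proof -
  have cont: "continuous_map (subtopology (full_shift \<BB>) Y) (subtopology (full_shift \<AA>) X) \<psi>"
    using maps by (simp add: homeomorphic_maps_def)
  have "openin (subtopology (full_shift \<AA>) X) (cylinder X w)"
    "closedin (subtopology (full_shift \<AA>) X) (cylinder X w)"
    using word_box_clopen[OF w]
    by (auto simp: cylinder_eq_word_box[OF X] openin_subtopology closedin_subtopology)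
  from openin_continuous_map_preimage[OF cont this(1)] closedin_continuous_map_preimage[OF cont this(2)]
  have "openin (subtopology (full_shift \<BB>) Y) {y \<in> Y. \<psi> y \<in> cylinder X w}"
    "closedin (subtopology (full_shift \<BB>) Y) {y \<in> Y. \<psi> y \<in> cylinder X w}"
    by (simp_all only: topspace_Y)
  then show ?thesis by (rule clopen_eq_Union_cylinders[OF Y _ _ that])
qed

text \<open>The preimage of C(\<mu>, \<nu>) under \<open>\<psi>\<close> arises from the preimages of
  C(\<mu>) and C(\<nu>) by the same shift images and shift preimages. Those two are finite unions of
  cylinders of \<open>Y\<close>, to which the closure properties above apply.\<close>

lemma pullback_algebra:
  assumes f: "f \<in> carr (subshift_algebra \<AA> X)"
  shows "pullback Y \<psi> f \<in> carr (subshift_algebra \<BB> Y)"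
proof (rule pullback_subshift_algebra[OF order.refl _ f])
  let ?D = "carr (subshift_algebra \<BB> Y)"
  fix \<mu> \<nu> assume w: "\<mu> \<in> lists \<AA>" "\<nu> \<in> lists \<AA>"
  let ?P = "\<lambda>w. {y \<in> Y. \<psi> y \<in> cylinder X w}"
  obtain M where M: "finite M" "M \<subseteq> lists \<BB>" "?P \<mu> = (\<Union>v\<in>M. cylinder Y v)"
    by (rule preimage_cylinder[OF w(1)])
  obtain N where N: "finite N" "N \<subseteq> lists \<BB>" "?P \<nu> = (\<Union>v\<in>N. cylinder Y v)"
    by (rule preimage_cylinder[OF w(2)])
  have "(shift ^^ length \<mu>) ` ?P \<mu> = (\<Union>v\<in>M. (shift ^^ length \<mu>) ` cylinder Y v)"
    unfolding M(3) by blast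
  then have "indicator ((shift ^^ length \<mu>) ` ?P \<mu>) \<in> ?D"
    using M(1,2) by (auto intro!: indicator_UN_algebra[OF Y] funpow_shift_image_cylinder_algebra[OF Y])
  moreover have "indicator (?P \<nu>) \<in> ?D"
    unfolding N(3) using N(1,2) by (auto intro!: indicator_UN_algebra[OF Y] cylinder_algebra[OF Y])
  ultimately have "indicator (?P \<nu> \<inter> {y \<in> Y. (shift ^^ length \<nu>) y \<in> (shift ^^ length \<mu>) ` ?P \<mu>}) \<in> ?D"
    by (intro indicator_Int_algebra[OF Y] funpow_shift_preimage_algebra[OF Y])
  moreover have "(shift ^^ length \<nu>) (\<psi> y) \<in> (shift ^^ length \<mu>) ` cylinder X \<mu> \<longleftrightarrow>
      (shift ^^ length \<nu>) y \<in> (shift ^^ length \<mu>) ` ?P \<mu>" if y: "y \<in> Y" for y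
  proof
    assume "(shift ^^ length \<nu>) (\<psi> y) \<in> (shift ^^ length \<mu>) ` cylinder X \<mu>"
    then obtain x where x: "x \<in> cylinder X \<mu>" "\<psi> ((shift ^^ length \<nu>) y) = (shift ^^ length \<mu>) x"
      using \<psi>_funpow_shift[OF y] by auto
    then have xX: "x \<in> X" by (simp add: cylinder_iff)
    have "\<psi> ((shift ^^ length \<nu>) y) = \<psi> ((shift ^^ length \<mu>) (\<phi> x))"
      using x(2) xX by (simp add: \<psi>_funpow_shift inverse)
    \<comment> \<open>\<open>inverse(4)\<close> supplies the injectivity of \<open>\<psi>\<close> on
      \<open>Y\<close>.\<close>
    then have "(shift ^^ length \<nu>) y = (shift ^^ length \<mu>) (\<phi> x)"
      using inverse(4) funpow_shift_mem[OF Y] y inverse(1)[OF xX] by metis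
    then show "(shift ^^ length \<nu>) y \<in> (shift ^^ length \<mu>) ` ?P \<mu>"
      using x(1) xX by (intro image_eqI[of _ _ "\<phi> x"]) (simp_all add: inverse)
  next
    assume "(shift ^^ length \<nu>) y \<in> (shift ^^ length \<mu>) ` ?P \<mu>"
    then obtain z where z: "z \<in> Y" "\<psi> z \<in> cylinder X \<mu>" "(shift ^^ length \<nu>) y = (shift ^^ length \<mu>) z"
      by blast
    then have "(shift ^^ length \<nu>) (\<psi> y) = (shift ^^ length \<mu>) (\<psi> z)"
      using y by (metis \<psi>_funpow_shift)
    then show "(shift ^^ length \<nu>) (\<psi> y) \<in> (shift ^^ length \<mu>) ` cylinder X \<mu>" using z(2) by blast
  qed
  then have "pullback Y \<psi> (indicator (cylinder2 X \<mu> \<nu>)) =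
      indicator (?P \<nu> \<inter> {y \<in> Y. (shift ^^ length \<nu>) y \<in> (shift ^^ length \<mu>) ` ?P \<mu>})"
    by (auto simp: fun_eq_iff pullback_def indicator_def cylinder2_def)
  ultimately show "pullback Y \<psi> (indicator (cylinder2 X \<mu> \<nu>)) \<in> ?D" by simp
qed

lemma pullback_inverse:
  assumes "f \<in> carr (subshift_algebra \<AA> X)"
  shows "pullback X \<phi> (pullback Y \<psi> f) = f"
  using carr_bounded_functionsD[OF subshift_algebra_bounded[OF assms]]
  by (auto simp: fun_eq_iff pullback_def inverse)

text \<open>Both the pullback and its inverse are contractive.\<close>

lemma pullback_isometric:
  assumes f: "f \<in> carr (subshift_algebra \<AA> X)"
  shows "vnorm (subshift_algebra \<BB> Y) (pullback Y \<psi> f) = vnorm (subshift_algebra \<AA> X) f"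
proof -
  note f' = subshift_algebra_bounded[OF f]
  show ?thesis
    using pullback_bounded(2)[OF order.refl f', of Y \<psi>]
      pullback_bounded(2)[OF order.refl pullback_bounded(1)[OF order.refl f', of Y \<psi>], of X \<phi>]
    by (simp add: pullback_inverse[OF f])
qed

lemma star_hom_pullback: "star_hom (subshift_algebra \<AA> X) (subshift_algebra \<BB> Y) (pullback Y \<psi>)"
  by (auto simp: star_hom_def linear_map_def intro: pullback_algebra) (auto simp: pullback_def fun_eq_iff)

text \<open>Up to the identification with functions, \<open>U\<close> is a composite of three maps
  that preserve the algebras: assemble \<open>\<xi>\<close> into a function on \<open>X\<close>,
  pull it back to \<open>Y\<close>, and transfer along each letter \<open>b\<close>. The cutoff in
  \<open>U\<close> then places the result in the letter ideal.\<close>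

lemma correspondence_pullback_closed:
  assumes \<xi>: "\<xi> \<in> carr H"
  shows "U \<xi> \<in> carr H'"
proof -
  have "U \<xi> b \<in> letter_ideal \<BB> Y b" if b: "b \<in> \<BB>" for b
  proof -
    let ?F = "\<lambda>x. if x \<in> X then \<xi> (x 0) (shift x) else 0"
    have "\<xi> a \<in> carr (subshift_algebra \<AA> X)" if "a \<in> \<AA>" for a
      using \<xi> letter_ideal_closed(1)[OF subshiftD(3)[OF X] that] that
      by (simp add: carr_subshift_correspondence)
    then have "?F \<in> carr (subshift_algebra \<AA> X)"
      by (rule letterwise_shift_algebra[OF X])
    then have "letter_transfer Y b (pullback Y \<psi> ?F) \<in> carr (subshift_algebra \<BB> Y)"
      by (intro letter_transfer_algebra[OF subshiftD(3)[OF Y] b] pullback_algebra)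
    moreover have "letter_transfer Y b (pullback Y \<psi> ?F) = U \<xi> b"
      using inverse(3) \<psi>_shift
      by (auto simp: fun_eq_iff letter_transfer_def pullback_def correspondence_pullback_def shift_case_nat
          simp flip: \<psi>_shift)
    ultimately show ?thesis
      by (simp add: letter_ideal_eq[OF Y b] correspondence_pullback_def)
  qed
  moreover have "U \<xi> b = (\<lambda>x. 0)" if "b \<notin> \<BB>" for b
    using that subshiftD(7)[OF Y] by (auto simp: fun_eq_iff correspondence_pullback_def)
  ultimately show ?thesis by (simp add: carr_subshift_correspondence)
qed

lemma correspondence_pullback_inverse:
  assumes \<xi>: "\<xi> \<in> carr H"
  shows "correspondence_pullback X \<phi> (U \<xi>) = \<xi>"
proof (intro ext)
  interpret C: subshift_conjugacy \<BB> Y \<AA> X \<psi> \<phi> by (rule converse)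
  fix a x
  show "correspondence_pullback X \<phi> (U \<xi>) a x = \<xi> a x"
  proof (cases "case_nat a x \<in> X")
    case True
    then show ?thesis
      using C.\<psi>_case_nat[OF True] subshiftD(6)[OF X True]
      by (simp add: correspondence_pullback_def inverse)
  qed (simp add: correspondence_pullback_def correspondence_zero[OF X \<xi>])
qed

text \<open>At a point y of \<open>Y\<close> the two sides sum over the shift preimages of y and of
  \<open>\<psi> y\<close>, and \<open>\<psi>\<close> is a bijection between these.\<close>

lemma correspondence_pullback_inner:
  assumes \<xi>: "\<xi> \<in> carr H" and \<eta>: "\<eta> \<in> carr H"
  shows "hinner H' (U \<xi>) (U \<eta>) = pullback Y \<psi> (hinner H \<xi> \<eta>)"
proof
  interpret C: subshift_conjugacy \<BB> Y \<AA> X \<psi> \<phi> by (rule converse)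
  fix y
  show "hinner H' (U \<xi>) (U \<eta>) y = pullback Y \<psi> (hinner H \<xi> \<eta>) y"
  proof (cases "y \<in> Y")
    case False
    then have "case_nat b y \<notin> Y" for b using subshiftD(6)[OF Y] by blast
    then show ?thesis using False by (simp add: pullback_def correspondence_pullback_def)
  next
    case True
    let ?B = "{b \<in> \<BB>. case_nat b y \<in> Y}" and ?A = "{a \<in> \<AA>. case_nat a (\<psi> y) \<in> X}"
    have "(\<Sum>b\<in>\<BB>. cnj (U \<xi> b y) * U \<eta> b y) = (\<Sum>b\<in>?B. cnj (U \<xi> b y) * U \<eta> b y)"
      by (rule sum.mono_neutral_right) (auto simp: subshiftD(1)[OF Y] correspondence_pullback_def)
    \<comment> \<open>A preimage is determined by its first letter: \<open>b\<close> corresponds to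
      the first letter of the image of by under \<open>\<psi>\<close>, and the inverse
      correspondence comes from \<open>\<phi>\<close>.\<close>
    also have "\<dots> = (\<Sum>a\<in>?A. cnj (\<xi> a (\<psi> y)) * \<eta> a (\<psi> y))"
    proof (rule sum.reindex_bij_witness[of _ "\<lambda>a. \<phi> (case_nat a (\<psi> y)) 0" "\<lambda>b. \<psi> (case_nat b y) 0"])
      fix b assume b: "b \<in> ?B"
      then have "\<psi> (case_nat b y) \<in> X" by (simp add: inverse)
      then show "\<psi> (case_nat b y) 0 \<in> ?A"
        using b \<psi>_case_nat[of b y] subshiftD(4)[OF X] by simp
      show "\<phi> (case_nat (\<psi> (case_nat b y) 0) (\<psi> y)) 0 = b"
        using b \<psi>_case_nat[of b y] by (simp add: inverse)
      show "cnj (\<xi> (\<psi> (case_nat b y) 0) (\<psi> y)) * \<eta> (\<psi> (case_nat b y) 0) (\<psi> y) = cnj (U \<xi> b y) * U \<eta> b y"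
        using b by (simp add: correspondence_pullback_def)
    next
      fix a assume a: "a \<in> ?A"
      then have "\<phi> (case_nat a (\<psi> y)) \<in> Y" by (simp add: inverse)
      then show "\<phi> (case_nat a (\<psi> y)) 0 \<in> ?B"
        using a C.\<psi>_case_nat[of a "\<psi> y"] True subshiftD(4)[OF Y] by (simp add: inverse)
      show "\<psi> (case_nat (\<phi> (case_nat a (\<psi> y)) 0) y) 0 = a"
        using a C.\<psi>_case_nat[of a "\<psi> y"] True by (simp add: inverse)
    qed
    also have "\<dots> = (\<Sum>a\<in>\<AA>. cnj (\<xi> a (\<psi> y)) * \<eta> a (\<psi> y))"
      by (rule sum.mono_neutral_left) (auto simp: subshiftD(1)[OF X] correspondence_zero[OF X \<xi>])
    finally show ?thesis using True by (simp add: pullback_def)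
  qed
qed

lemma correspondence_iso_pullback:
  "correspondence_iso (subshift_algebra \<AA> X) H (subshift_algebra \<BB> Y) H'
    (pullback Y \<psi>) U (correspondence_pullback X \<phi>)"
proof -
  interpret C: subshift_conjugacy \<BB> Y \<AA> X \<psi> \<phi> by (rule converse)
  show ?thesis
  proof (intro correspondence_iso.intro correspondence_iso_axioms.intro
      cstar_correspondence_subshift X Y star_hom_pullback pullback_isometric
      C.correspondence_pullback_closed C.correspondence_pullback_inverse
      correspondence_pullback_inverse correspondence_pullback_inner)
    show "linear_map H H' U"
      by (simp add: linear_map_def correspondence_pullback_closed)
        (auto simp: fun_eq_iff correspondence_pullback_def)
  next
    fix \<xi> and f :: "(nat \<Rightarrow> 'a) \<Rightarrow> complex"
    show "U (ract H \<xi> f) = ract H' (U \<xi>) (pullback Y \<psi> f)"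
      using subshiftD(6)[OF Y] by (auto simp: fun_eq_iff correspondence_pullback_def pullback_def)
    \<comment> \<open>By \<open>\<psi>_case_nat\<close>, both transfers evaluate \<open>f\<close> at
      the image of by under \<open>\<psi>\<close>.\<close>
    show "U (lact H f \<xi>) = lact H' (pullback Y \<psi> f) (U \<xi>)"
      using inverse(3)
      by (auto simp: fun_eq_iff correspondence_pullback_def pullback_def letter_transfer_def \<psi>_case_nat)
  qed
qed

end

theorem theorem8p6:
  fixes \<AA> :: "'a set" and X :: "(nat \<Rightarrow> 'a) set"
    and \<BB> :: "'b set" and Y :: "(nat \<Rightarrow> 'b) set"
    and O\<^sub>X O\<^sub>Y :: "'w calgebra"
    and k\<^sub>X :: "('a \<Rightarrow> (nat \<Rightarrow> 'a) \<Rightarrow> complex) \<Rightarrow> 'w"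
    and \<iota>\<^sub>X :: "((nat \<Rightarrow> 'a) \<Rightarrow> complex) \<Rightarrow> 'w"
    and k\<^sub>Y :: "('b \<Rightarrow> (nat \<Rightarrow> 'b) \<Rightarrow> complex) \<Rightarrow> 'w"
    and \<iota>\<^sub>Y :: "((nat \<Rightarrow> 'b) \<Rightarrow> complex) \<Rightarrow> 'w"
    and \<gamma>\<^sub>X \<gamma>\<^sub>Y :: "complex \<Rightarrow> 'w \<Rightarrow> 'w"
  assumes "subshift \<AA> X" and "subshift \<BB> Y"
    and "cuntz_pimsner_algebra (subshift_algebra \<AA> X) (subshift_correspondence \<AA> X) O\<^sub>X k\<^sub>X \<iota>\<^sub>X"
    and "cuntz_pimsner_algebra (subshift_algebra \<BB> Y) (subshift_correspondence \<BB> Y) O\<^sub>Y k\<^sub>Y \<iota>\<^sub>Y"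
    and "gauge_action (subshift_algebra \<AA> X) (subshift_correspondence \<AA> X) O\<^sub>X k\<^sub>X \<iota>\<^sub>X \<gamma>\<^sub>X"
    and "gauge_action (subshift_algebra \<BB> Y) (subshift_correspondence \<BB> Y) O\<^sub>Y k\<^sub>Y \<iota>\<^sub>Y \<gamma>\<^sub>Y"
    and "conjugate_subshifts \<AA> X \<BB> Y"
  shows "\<exists>\<rho>. star_iso O\<^sub>X O\<^sub>Y \<rho> \<and>
    (\<forall>z\<in>sphere 0 1. \<forall>b\<in>carr O\<^sub>X. \<gamma>\<^sub>Y z (\<rho> b) = \<rho> (\<gamma>\<^sub>X z b))"
proof -
  obtain \<phi> \<psi> where
    "homeomorphic_maps (subtopology (full_shift \<AA>) X) (subtopology (full_shift \<BB>) Y) \<phi> \<psi>"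
    and "\<And>x. x \<in> X \<Longrightarrow> \<phi> (shift x) = shift (\<phi> x)"
    using assms(7) unfolding conjugate_subshifts_def homeomorphic_map_maps by blast
  then interpret subshift_conjugacy \<AA> X \<BB> Y \<phi> \<psi>
    using assms(1,2) by unfold_locales auto
  interpret C: subshift_conjugacy \<BB> Y \<AA> X \<psi> \<phi> by (rule converse)
  show ?thesis
    using cuntz_pimsner_iso[OF correspondence_iso_pullback C.correspondence_iso_pullback
        pullback_inverse C.pullback_inverse assms(3-6)] .
qed

end
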